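(* Let $\mathcal{H}$ be a real Hilbert space and let $f,g\colon\mathcal{H}\to\left]-\infty,+\infty\right]$ be proper convex lower semicontinuous functions with $\operatorname{dom} g\subset\operatorname{dom} f$. Suppose that $f$ is Gâteaux differentiable on $\operatorname{dom} g$ and that $\nabla f$ is uniformly continuous on any weakly compact subset of $\operatorname{dom} g$. Let $(\langle\cdot\mid\cdot\rangle_k)_{k\in\mathbb{N}}$ be a sequence of scalar products on $\mathcal{H}$ with induced norms $\|\cdot\|_k$ and associated positive operators $W_k$, and suppose that there exist $0<\nu\le\mu$ such that $\nu\|\cdot\|^2\le\|\cdot\|_k^2\le\mu\|\cdot\|^2$ for every $k\in\mathbb{N}$. Set $\nu_k=\inf_{\|x\|=1}\langle x\mid W_kx\rangle$ and $\mu_k=\sup_{\|x\|=1}\langle x\mid W_kx\rangle$. Suppose that at least one of the following holds: - there exists a summable sequence $(\eta_k)_{k\in\mathbb{N}}$ in $[0,+\infty[$ such that $\|\cdot\|_{k+1}^2\le(1+\eta_k)\|\cdot\|_k^2$ for every $k\in\mathbb{N}$; - $\sum_{k\in\mathbb{N}}(\mu_k-\nu_k)<+\infty$. Let $(x_k)_{k\in\mathbb{N}}$ and $(y_k)_{k\in\mathbb{N}}$ be generated by the algorithm (VM-FBS) using one of the line search procedures LS1, LS2, LS3, LS4 (all defined in the context) for determining the parameters $(\gamma_k)_{k\in\mathbb{N}}$ and $(\lambda_k)_{k\in\mathbb{N}}$. Set $S_*=\operatorname{argmin}_{\mathcal{H}}(f+g)$. Then the following hold. (i) $((f+g)(x_k))_{k\in\mathbb{N}}$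 is decreasing. (ii) If $\inf_{k\in\mathbb{N}}(f+g)(x_k)>-\infty$, then $\sum_{k\in\mathbb{N}}\|x_{k+1}-x_k\|^2<+\infty$. (iii) Suppose that $S_*\ne\varnothing$. Then (a) $(x_k)_{k\in\mathbb{N}}$ and $(y_k)_{k\in\mathbb{N}}$ converge weakly to the same point in $S_*$; (b) $(f+g)(y_k)\to\inf_{\mathcal{H}}(f+g)$; (c) if $\sum_{k\in\mathbb{N}}\gamma_k\lambda_k=+\infty$, then $(f+g)(x_k)\to\inf_{\mathcal{H}}(f+g)$; (d) if $\inf_{k\in\mathbb{N}}\gamma_k\lambda_k>0$, then $(f+g)(x_k)-\inf_{\mathcal{H}}(f+g)=o(1/k)$. (iv) If $S_*=\varnothing$, then $\|x_k\|\to+\infty$ and $(f+g)(x_k)\to\inf_{\mathcal{H}}(f+g)$.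
   Context: $\mathcal{H}$ has scalar product $\langle\cdot\mid\cdot\rangle$ and norm $\|\cdot\|$. "Decreasing" means nonincreasing. A proper convex function $h$ is Gâteaux differentiable at $x\in\operatorname{dom}h$ if there is $u\in\mathcal{H}$ with $\lim_{t\to0}(h(x+td)-h(x))/t=\langle d\mid u\rangle$ for all $d\in\mathcal{H}$; then $\nabla h(x):=u$. It is Gâteaux differentiable on a set if it is so at each point of the set. The positive operator $W_k\colon\mathcal{H}\to\mathcal{H}$ associated with $\langle\cdot\mid\cdot\rangle_k$ satisfies $\langle x\mid y\rangle_k=\langle x\mid W_ky\rangle$. $\nabla^kf$ is the gradient with respect to $\langle\cdot\mid\cdot\rangle_k$, i.e. $\nabla^kf(x)=W_k^{-1}\nabla f(x)$. For $h$ proper convex lower semicontinuous, $\operatorname{prox}^k_h(x)=\operatorname{argmin}_{y\in\mathcal{H}}\big(h(y)+\tfrac12\|y-x\|_k^2\big)$. For $x\in\operatorname{dom}g$, $\gamma>0$, $\lambda\in\left]0,1\right]$ set $$J_k(x,\gamma,\lambda)=x+\lambda\big(\operatorname{prox}^k_{\gamma g}(x-\gamma\nabla^kf(x))-x\big).$$ Algorithm (VM-FBS): let $x_0\in\operatorname{dom}g$ and, for $k=0,1,\dots$, choose $\gamma_k>0$, set $y_k=\operatorname{prox}^k_{\gamma_kg}(x_k-\gamma_k\nabla^kf(x_k))$, choose $\lambda_k\in\left]0,1\right]$, and set $x_{k+1}=x_k+\lambda_k(y_k-x_k)$ (so $x_{k+1}=J_k(x_k,\gamma_k,\lambda_k)$).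 Line searches (in each, $\delta,\theta\in\left]0,1\right[$ are fixed constants): LS1: $(\lambda_k)$ is given in $\left]0,1\right]$ with $\inf_k\lambda_k>0$; $\bar\gamma>0$; for every $k$, $\gamma_k$ is the largest $\gamma\in\{\bar\gamma\theta^i: i\in\mathbb{N}\}$ (with $0\in\mathbb{N}$) such that $f(J_k(x_k,\gamma,\lambda_k))-f(x_k)-\langle J_k(x_k,\gamma,\lambda_k)-x_k\mid\nabla f(x_k)\rangle\le\frac{\delta}{\gamma\lambda_k}\|J_k(x_k,\gamma,\lambda_k)-x_k\|_k^2$. LS2: $(\gamma_k)$ is given with $0<\inf_k\gamma_k\le\sup_k\gamma_k<+\infty$; $\bar\lambda\in\left]0,1\right]$; for every $k$, $\lambda_k$ is the largest $\lambda\in\{\bar\lambda\theta^i:i\in\mathbb{N}\}$ such that $f(J_k(x_k,\gamma_k,\lambda))-f(x_k)-\langle J_k(x_k,\gamma_k,\lambda)-x_k\mid\nabla f(x_k)\rangle\le\frac{\delta}{\gamma_k\lambda}\|J_k(x_k,\gamma_k,\lambda)-x_k\|_k^2$. LS3: $(\gamma_k)$ is given with $0<\inf_k\gamma_k\le\sup_k\gamma_k<+\infty$; $\bar\lambda\in\left]0,1\right]$; for every $k$, $\lambda_k$ is the largest $\lambda\in\{\bar\lambda\theta^i:i\in\mathbb{N}\}$ such that $(f+g)(J_k(x_k,\gamma_k,\lambda))-(f+g)(x_k)\le(1-\delta)\lambda\big(g(y_k)-g(x_k)+\langle y_k-x_k\mid\nabla f(x_k)\rangle\big)$. LS4: $(\lambda_k)$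 is given in $\left]0,1\right]$ with $\inf_k\lambda_k>0$; $\bar\gamma>0$; for every $k$, $\gamma_k$ is the largest $\gamma\in\{\bar\gamma\theta^i:i\in\mathbb{N}\}$ such that $\|\nabla^kf(J_k(x_k,\gamma,\lambda_k))-\nabla^kf(x_k)\|_k\le\frac{\delta}{\gamma\lambda_k}\|J_k(x_k,\gamma,\lambda_k)-x_k\|_k$. *)

theory Defs
  imports "HOL-Analysis.Analysis" "HOL-Library.Landau_Symbols"
begin

text \<open>A real Hilbert space is a type of sort \<open>{real_inner, complete_space}\<close>; functions into
  \<open>]-\<infinity>, +\<infinity>]\<close> are \<open>ereal\<close>-valued functions that never take the value \<open>-\<infinity>\<close>.\<close>

subsection \<open>Extended-real-valued convex functions\<close>

definition edom :: "('a \<Rightarrow> ereal) \<Rightarrow> 'a set" where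
  "edom h = {x. h x < \<infinity>}"

definition proper :: "('a \<Rightarrow> ereal) \<Rightarrow> bool" where
  "proper h \<longleftrightarrow> (\<forall>x. h x \<noteq> -\<infinity>) \<and> edom h \<noteq> {}"

definition econvex :: "('a::real_vector \<Rightarrow> ereal) \<Rightarrow> bool" where
  "econvex h \<longleftrightarrow> convex {(x, r :: real). h x \<le> ereal r}"

definition lsc :: "('a::topological_space \<Rightarrow> ereal) \<Rightarrow> bool" where
  "lsc h \<longleftrightarrow> (\<forall>x. h x \<le> Liminf (at x) h)"

definition minimizers :: "('a \<Rightarrow> ereal) \<Rightarrow> 'a set" where
  "minimizers h = {x. is_arg_min h (\<lambda>_. True) x}"

subsection \<open>Gateaux differentiability\<close>

definition has_gateaux_gradient :: "('a::real_inner \<Rightarrow> ereal) \<Rightarrow> 'a \<Rightarrow> 'a \<Rightarrow> bool" where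
  "has_gateaux_gradient h x u \<longleftrightarrow> x \<in> edom h \<and>
     (\<forall>d. ((\<lambda>t::real. (h (x + t *\<^sub>R d) - h x) / ereal t) \<longlongrightarrow> ereal (d \<bullet> u)) (at 0))"

definition gateaux_differentiable_on :: "('a::real_inner \<Rightarrow> ereal) \<Rightarrow> 'a set \<Rightarrow> bool" where
  "gateaux_differentiable_on h S \<longleftrightarrow> (\<forall>x\<in>S. \<exists>u. has_gateaux_gradient h x u)"

definition gradient :: "('a::real_inner \<Rightarrow> ereal) \<Rightarrow> 'a \<Rightarrow> 'a" where
  "gradient h x = (THE u. has_gateaux_gradient h x u)"

subsection \<open>Weak topology\<close>

definition weak_topology :: "'a::real_inner topology" where
  "weak_topology = topology_generated_by {(\<lambda>x. x \<bullet> u) -` U | u U. open U}"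

subsection \<open>Scalar products and the associated operators\<close>

definition is_scalar_product :: "('a::real_vector \<Rightarrow> 'a \<Rightarrow> real) \<Rightarrow> bool" where
  "is_scalar_product B \<longleftrightarrow> bilinear B \<and> (\<forall>x y. B x y = B y x) \<and> (\<forall>x. x \<noteq> 0 \<longrightarrow> B x x > 0)"

definition ipnorm :: "('a \<Rightarrow> 'a \<Rightarrow> real) \<Rightarrow> 'a \<Rightarrow> real" where
  "ipnorm B x = sqrt (B x x)"

text \<open>For a scalar product whose norm is equivalent to the one of the Hilbert space, such an
  operator exists by the Riesz representation theorem; it is always unique.\<close>

definition assoc_operator :: "('a::real_inner \<Rightarrow> 'a \<Rightarrow> real) \<Rightarrow> 'a \<Rightarrow> 'a" where
  "assoc_operator B = (THE W. \<forall>x y. B x y = x \<bullet> W y)"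

definition lower_bound :: "('a::real_inner \<Rightarrow> 'a \<Rightarrow> real) \<Rightarrow> real" where
  "lower_bound B = (INF x\<in>{x. norm x = 1}. x \<bullet> assoc_operator B x)"

definition upper_bound :: "('a::real_inner \<Rightarrow> 'a \<Rightarrow> real) \<Rightarrow> real" where
  "upper_bound B = (SUP x\<in>{x. norm x = 1}. x \<bullet> assoc_operator B x)"

definition gradient_wrt ::
    "('a::real_inner \<Rightarrow> 'a \<Rightarrow> real) \<Rightarrow> ('a \<Rightarrow> ereal) \<Rightarrow> 'a \<Rightarrow> 'a" where
  "gradient_wrt B h x = inv (assoc_operator B) (gradient h x)"

definition prox :: "('a::real_inner \<Rightarrow> 'a \<Rightarrow> real) \<Rightarrow> ('a \<Rightarrow> ereal) \<Rightarrow> 'a \<Rightarrow> 'a" where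
  "prox B h x = arg_min (\<lambda>y. h y + ereal (1/2 * (ipnorm B (y - x))\<^sup>2)) (\<lambda>_. True)"

subsection \<open>The variable metric forward-backward algorithm and its line searches\<close>

definition fb_point ::
    "('a::real_inner \<Rightarrow> 'a \<Rightarrow> real) \<Rightarrow> ('a \<Rightarrow> ereal) \<Rightarrow> ('a \<Rightarrow> ereal) \<Rightarrow> 'a \<Rightarrow> real \<Rightarrow> 'a" where
  "fb_point B f g x \<gamma> = prox B (\<lambda>z. ereal \<gamma> * g z) (x - \<gamma> *\<^sub>R gradient_wrt B f x)"

definition fb_step ::
    "('a::real_inner \<Rightarrow> 'a \<Rightarrow> real) \<Rightarrow> ('a \<Rightarrow> ereal) \<Rightarrow> ('a \<Rightarrow> ereal) \<Rightarrow> 'a \<Rightarrow> real \<Rightarrow> real \<Rightarrow> 'a" where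
  "fb_step B f g x \<gamma> lam = x + lam *\<^sub>R (fb_point B f g x \<gamma> - x)"

definition vm_fbs ::
    "(nat \<Rightarrow> 'a::real_inner \<Rightarrow> 'a \<Rightarrow> real) \<Rightarrow> ('a \<Rightarrow> ereal) \<Rightarrow> ('a \<Rightarrow> ereal) \<Rightarrow>
     (nat \<Rightarrow> real) \<Rightarrow> (nat \<Rightarrow> real) \<Rightarrow> (nat \<Rightarrow> 'a) \<Rightarrow> (nat \<Rightarrow> 'a) \<Rightarrow> bool" where
  "vm_fbs ip f g \<gamma> lam x y \<longleftrightarrow>
     x 0 \<in> edom g \<and>
     (\<forall>k. 0 < \<gamma> k \<and> 0 < lam k \<and> lam k \<le> 1 \<and>
          y k = fb_point (ip k) f g (x k) (\<gamma> k) \<and>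
          x (Suc k) = x k + lam k *\<^sub>R (y k - x k))"

definition is_largest :: "real \<Rightarrow> real set \<Rightarrow> bool" where
  "is_largest t A \<longleftrightarrow> t \<in> A \<and> (\<forall>s\<in>A. s \<le> t)"

text \<open>The inequality common to the first two line searches, for a metric \<open>B\<close>, a point \<open>x\<close> and
  trial parameters \<open>\<gamma>\<close>, \<open>lam\<close>.\<close>

definition descent_test ::
    "('a::real_inner \<Rightarrow> 'a \<Rightarrow> real) \<Rightarrow> ('a \<Rightarrow> ereal) \<Rightarrow> ('a \<Rightarrow> ereal) \<Rightarrow> real \<Rightarrow> 'a \<Rightarrow> real \<Rightarrow> real \<Rightarrow> bool" where
  "descent_test B f g \<delta> x \<gamma> lam \<longleftrightarrow>
     f (fb_step B f g x \<gamma> lam) - f x - ereal ((fb_step B f g x \<gamma> lam - x) \<bullet> gradient f x)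
       \<le> ereal (\<delta> / (\<gamma> * lam) * (ipnorm B (fb_step B f g x \<gamma> lam - x))\<^sup>2)"

definition LS1 ::
    "(nat \<Rightarrow> 'a::real_inner \<Rightarrow> 'a \<Rightarrow> real) \<Rightarrow> ('a \<Rightarrow> ereal) \<Rightarrow> ('a \<Rightarrow> ereal) \<Rightarrow> real \<Rightarrow> real \<Rightarrow> real \<Rightarrow>
     (nat \<Rightarrow> real) \<Rightarrow> (nat \<Rightarrow> real) \<Rightarrow> (nat \<Rightarrow> 'a) \<Rightarrow> bool" where
  "LS1 ip f g \<delta> \<theta> \<gamma>bar \<gamma> lam x \<longleftrightarrow>
     (\<forall>k. 0 < lam k \<and> lam k \<le> 1) \<and> 0 < (INF k. lam k) \<and> 0 < \<gamma>bar \<and>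
     (\<forall>k. is_largest (\<gamma> k)
        {t \<in> range (\<lambda>i::nat. \<gamma>bar * \<theta> ^ i). descent_test (ip k) f g \<delta> (x k) t (lam k)})"

definition LS2 ::
    "(nat \<Rightarrow> 'a::real_inner \<Rightarrow> 'a \<Rightarrow> real) \<Rightarrow> ('a \<Rightarrow> ereal) \<Rightarrow> ('a \<Rightarrow> ereal) \<Rightarrow> real \<Rightarrow> real \<Rightarrow> real \<Rightarrow>
     (nat \<Rightarrow> real) \<Rightarrow> (nat \<Rightarrow> real) \<Rightarrow> (nat \<Rightarrow> 'a) \<Rightarrow> bool" where
  "LS2 ip f g \<delta> \<theta> lbar \<gamma> lam x \<longleftrightarrow>
     (\<forall>k. 0 < \<gamma> k) \<and> 0 < (INF k. \<gamma> k) \<and> bdd_above (range \<gamma>) \<and> 0 < lbar \<and> lbar \<le> 1 \<and>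
     (\<forall>k. is_largest (lam k)
        {t \<in> range (\<lambda>i::nat. lbar * \<theta> ^ i). descent_test (ip k) f g \<delta> (x k) (\<gamma> k) t})"

definition LS3 ::
    "(nat \<Rightarrow> 'a::real_inner \<Rightarrow> 'a \<Rightarrow> real) \<Rightarrow> ('a \<Rightarrow> ereal) \<Rightarrow> ('a \<Rightarrow> ereal) \<Rightarrow> real \<Rightarrow> real \<Rightarrow> real \<Rightarrow>
     (nat \<Rightarrow> real) \<Rightarrow> (nat \<Rightarrow> real) \<Rightarrow> (nat \<Rightarrow> 'a) \<Rightarrow> (nat \<Rightarrow> 'a) \<Rightarrow> bool" where
  "LS3 ip f g \<delta> \<theta> lbar \<gamma> lam x y \<longleftrightarrow>
     (\<forall>k. 0 < \<gamma> k) \<and> 0 < (INF k. \<gamma> k) \<and> bdd_above (range \<gamma>) \<and> 0 < lbar \<and> lbar \<le> 1 \<and>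
     (\<forall>k. is_largest (lam k)
        {t \<in> range (\<lambda>i::nat. lbar * \<theta> ^ i).
           (f (fb_step (ip k) f g (x k) (\<gamma> k) t) + g (fb_step (ip k) f g (x k) (\<gamma> k) t))
             - (f (x k) + g (x k))
           \<le> ereal ((1 - \<delta>) * t) *
               (g (y k) - g (x k) + ereal ((y k - x k) \<bullet> gradient f (x k)))})"

definition LS4 ::
    "(nat \<Rightarrow> 'a::real_inner \<Rightarrow> 'a \<Rightarrow> real) \<Rightarrow> ('a \<Rightarrow> ereal) \<Rightarrow> ('a \<Rightarrow> ereal) \<Rightarrow> real \<Rightarrow> real \<Rightarrow> real \<Rightarrow>
     (nat \<Rightarrow> real) \<Rightarrow> (nat \<Rightarrow> real) \<Rightarrow> (nat \<Rightarrow> 'a) \<Rightarrow> bool" where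
  "LS4 ip f g \<delta> \<theta> \<gamma>bar \<gamma> lam x \<longleftrightarrow>
     (\<forall>k. 0 < lam k \<and> lam k \<le> 1) \<and> 0 < (INF k. lam k) \<and> 0 < \<gamma>bar \<and>
     (\<forall>k. is_largest (\<gamma> k)
        {t \<in> range (\<lambda>i::nat. \<gamma>bar * \<theta> ^ i).
           ipnorm (ip k) (gradient_wrt (ip k) f (fb_step (ip k) f g (x k) t (lam k))
                            - gradient_wrt (ip k) f (x k))
           \<le> \<delta> / (t * lam k) * ipnorm (ip k) (fb_step (ip k) f g (x k) t (lam k) - x k)})"

end

theory Submission
  imports Defs
begin

text \<open>Every line search yields the same sufficient decrease, so \<open>\<Sum>k. \<lambda>\<^sub>k \<Delta>\<^sub>k\<close> converges as soon as the values are
  bounded below, where \<open>\<Delta>\<^sub>k \<ge> \<parallel>y\<^sub>k - x\<^sub>k\<parallel>\<^sub>k\<^sup>2 / \<gamma>\<^sub>k\<close> is the predicted decrease; this makes \<open>(x\<^sub>k)\<close> quasi-Fejer monotone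
  with respect to every point whose value is below all \<open>(f + g)(x\<^sub>k)\<close>. A rejected trial step gives a lower bound
  of the variation of the gradient by \<open>\<parallel>y\<^sub>k - x\<^sub>k\<parallel> / \<gamma>\<^sub>k\<close>, up to constants. Hence, along any bounded part of the
  sequence, uniform continuity of the gradient forces \<open>\<parallel>y\<^sub>k - x\<^sub>k\<parallel> / \<gamma>\<^sub>k \<rightarrow> 0\<close> although the parameters may vanish,
  and the subgradient inequalities at \<open>y\<^sub>k\<close> show that \<open>(f + g)(y\<^sub>k)\<close> tends to the infimum. Weak cluster points are
  therefore minimizers, and Opial's argument gives weak convergence; without minimizers no part of the sequence
  can stay bounded.\<close>

subsection \<open>Hilbert space preliminaries\<close>

text \<open>The gradient is only known to be uniformly continuous on weakly compact subsets of the
  domain of \<open>g\<close>, and this domain need not be closed. The sets used are bounded pieces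
  of sublevel sets of \<open>g\<close>: they are closed and convex, hence weakly compact, and they
  stay inside the domain. Weak compactness of balls comes from Tychonoff's theorem, so cluster
  points are obtained along finer filters rather than along subsequences. The asymptotic lemmas are
  therefore stated for an arbitrary filter \<open>E\<close> below \<open>sequentially\<close>, which
  covers the whole sequence, the indices violating a supposed limit, and the indices of bounded
  iterates. Two families of metrics are kept apart: \<open>B\<close>, in which proximal points are
  computed, and \<open>C\<close>, in which distances along the iteration are measured. This lets
  both conditions on the metrics share one convergence proof. Existence of proximal points is used
  beyond the algorithm: it also yields the Riesz representation and the separation behind weak
  closedness.\<close>

lemma psd_Cauchy_Schwarz:
  fixes B :: "'a::real_vector \<Rightarrow> 'a \<Rightarrow> real"
  assumes bil: "bilinear B" and sym: "\<And>x y. B x y = B y x" and psd: "\<And>x. 0 \<le> B x x"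
  shows "(B u v)\<^sup>2 \<le> B u u * B v v"
proof -
  have q: "0 \<le> B u u + 2 * t * B u v + t\<^sup>2 * B v v" for t
  proof -
    have "B (u + t *\<^sub>R v) (u + t *\<^sub>R v) = B u u + t * B v u + (t * B u v + t * (t * B v v))"
      by (simp add: bilinear_ladd[OF bil] bilinear_radd[OF bil] bilinear_lmul[OF bil] bilinear_rmul[OF bil] distrib_left)
    also have "\<dots> = B u u + 2 * t * B u v + t\<^sup>2 * B v v"
      unfolding sym[of v u] power2_eq_square by (simp only: mult.assoc mult_2 distrib_right add.assoc)
    finally show ?thesis using psd[of "u + t *\<^sub>R v"] by simp
  qed
  show ?thesis
  proof (cases "B v v = 0")
    case True
    have "B u v = 0"
    proof (rule ccontr)
      assume "B u v \<noteq> 0"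
      \<comment> \<open>With \<open>B v v = 0\<close> the quadratic is affine in \<open>t\<close>;
        this \<open>t\<close> gives it the value -1.\<close>
      then have "2 * (- (B u u + 1) / (2 * B u v)) * B u v = - (B u u + 1)" by simp
      with q[of "- (B u u + 1) / (2 * B u v)"] True show False by simp
    qed
    then show ?thesis using psd by simp
  next
    case False
    then have v: "B v v > 0" using psd[of v] by simp
    have "0 \<le> B u u + 2 * (- B u v / B v v) * B u v + (- B u v / B v v)\<^sup>2 * B v v" by (rule q)
    also have "\<dots> = B u u - (B u v)\<^sup>2 / B v v"
      using v by (simp add: field_simps power2_eq_square)
    finally show ?thesis using v by (simp add: field_simps)
  qed
qed

text \<open>Equivalence of the norms makes the space complete for \<open>B\<close> as well, so
  projections and Riesz vectors can be formed in \<open>B\<close> itself. The locale serves the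
  metrics of the iteration and, with both constants 1, the ambient inner product.\<close>

locale equivalent_scalar_product =
  fixes B :: "'a::{real_inner, complete_space} \<Rightarrow> 'a \<Rightarrow> real" and \<nu> \<mu> :: real
  assumes scalar_product: "is_scalar_product B"
    and pos: "0 < \<nu>"
    and lower: "\<And>z. \<nu> * (norm z)\<^sup>2 \<le> B z z"
    and upper: "\<And>z. B z z \<le> \<mu> * (norm z)\<^sup>2"
begin

lemma bilinear: "bilinear B" and commute: "B x y = B y x"
  using scalar_product by (auto simp: is_scalar_product_def)

lemmas algebra = bilinear_ladd[OF bilinear] bilinear_radd[OF bilinear]
  bilinear_lsub[OF bilinear] bilinear_rsub[OF bilinear]
  bilinear_lneg[OF bilinear] bilinear_rneg[OF bilinear]
  bilinear_lmul[OF bilinear, unfolded real_scaleR_def]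
  bilinear_rmul[OF bilinear, unfolded real_scaleR_def]
  bilinear_lzero[OF bilinear] bilinear_rzero[OF bilinear]

lemma nonneg: "0 \<le> B x x"
  by (rule order_trans[OF _ lower]) (use pos in simp)

lemma upper_nonneg: "0 \<le> \<mu> * (norm (z::'a))\<^sup>2"
  by (rule order_trans[OF nonneg upper])

lemma ipnorm_power2: "(ipnorm B x)\<^sup>2 = B x x"
  using nonneg by (simp add: ipnorm_def)

lemma ipnorm_nonneg: "0 \<le> ipnorm B x"
  by (simp add: ipnorm_def nonneg)

lemma Cauchy_Schwarz: "\<bar>B u v\<bar> \<le> ipnorm B u * ipnorm B v"
proof -
  have "(B u v)\<^sup>2 \<le> (ipnorm B u * ipnorm B v)\<^sup>2"
    using psd_Cauchy_Schwarz[OF bilinear commute nonneg]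
    by (simp add: power_mult_distrib ipnorm_power2)
  then have "\<bar>B u v\<bar> \<le> \<bar>ipnorm B u * ipnorm B v\<bar>" by (simp only: abs_le_square_iff)
  then show ?thesis using ipnorm_nonneg by (simp add: abs_mult)
qed

lemma abs_le_norm: "\<bar>B u v\<bar> \<le> \<mu> * norm u * norm v"
proof (cases "u = 0")
  case True then show ?thesis by (simp add: algebra)
next
  case False
  \<comment> \<open>The sign of \<open>\<mu>\<close> is read off from a nonzero vector.\<close>
  then have mu: "0 \<le> \<mu>" using upper_nonneg[of u] by (simp add: zero_le_mult_iff)
  have "(B u v)\<^sup>2 \<le> B u u * B v v"
    by (rule psd_Cauchy_Schwarz[OF bilinear commute nonneg])
  also have "\<dots> \<le> (\<mu> * (norm u)\<^sup>2) * (\<mu> * (norm v)\<^sup>2)"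
    by (rule mult_mono[OF upper upper upper_nonneg nonneg])
  also have "\<dots> = (\<mu> * norm u * norm v)\<^sup>2" by (simp only: power_mult_distrib power2_eq_square[of \<mu>] mult_ac)
  finally have "\<bar>B u v\<bar> \<le> \<bar>\<mu> * norm u * norm v\<bar>" by (simp only: abs_le_square_iff)
  then show ?thesis using mu by (simp add: abs_mult)
qed

lemma sq_add: "B (u + v) (u + v) = B u u + 2 * B u v + B v v"
  using commute[of v u] by (simp add: algebra(1,2))

lemma bounded_bilinear: "bounded_bilinear B"
proof
  show "\<exists>K. \<forall>a b. norm (B a b) \<le> norm a * norm b * K"
    using abs_le_norm by (auto simp: mult_ac intro!: exI[of _ \<mu>])
qed (simp_all add: algebra)

lemma bounded_linear_left: "bounded_linear (\<lambda>u. B u v)"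
  by (rule bounded_bilinear.bounded_linear_left[OF bounded_bilinear])

lemma continuous: "continuous_on UNIV (\<lambda>u. B (u - x) (u - x))"
  by (rule bounded_bilinear.continuous_on[OF bounded_bilinear])
     (intro continuous_intros)+

end

text \<open>A proper convex lower semicontinuous function in real-valued form: \<open>D\<close> is
  its effective domain, and sublevel sets closed in the whole space express lower semicontinuity of
  the extension by \<infinity>. \<open>D\<close> itself may fail to be closed.\<close>

locale closed_convex_function =
  fixes D :: "'a::real_normed_vector set" and h :: "'a \<Rightarrow> real"
  assumes nonempty: "D \<noteq> {}"
    and convex_on: "convex_on D h"
    and closed_sublevel: "\<And>c. closed {z \<in> D. h z \<le> c}"
begin

lemma segment:
  assumes "z \<in> D" "w \<in> D" "0 \<le> t" "t \<le> 1"
  shows "z + t *\<^sub>R (w - z) \<in> D" "h (z + t *\<^sub>R (w - z)) \<le> h z + t * (h w - h z)"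
proof -
  have e: "z + t *\<^sub>R (w - z) = (1 - t) *\<^sub>R z + t *\<^sub>R w" by (simp add: algebra_simps)
  show "z + t *\<^sub>R (w - z) \<in> D"
    unfolding e using convex_on_imp_convex[OF convex_on] assms by (intro convexD) auto
  have "h ((1 - t) *\<^sub>R z + t *\<^sub>R w) \<le> (1 - t) * h z + t * h w"
    using convex_onD[OF convex_on] assms by simp
  then show "h (z + t *\<^sub>R (w - z)) \<le> h z + t * (h w - h z)"
    unfolding e by (simp add: algebra_simps)
qed

lemma convex_sublevel: "convex {z \<in> D. h z \<le> c}"
  unfolding convex_alt
proof (intro ballI allI impI)
  fix z w and t :: real
  assume z: "z \<in> {z \<in> D. h z \<le> c}" and w: "w \<in> {z \<in> D. h z \<le> c}" and t: "0 \<le> t \<and> t \<le> 1"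
  have e: "z + t *\<^sub>R (w - z) = (1 - t) *\<^sub>R z + t *\<^sub>R w" by (simp add: algebra_simps)
  have "h z + t * (h w - h z) = (1 - t) * h z + t * h w" by (simp add: algebra_simps)
  also have "\<dots> \<le> (1 - t) * c + t * c"
    by (intro add_mono mult_left_mono) (use z w t in auto)
  also have "\<dots> = c" by (simp add: algebra_simps)
  finally show "(1 - t) *\<^sub>R z + t *\<^sub>R w \<in> {z \<in> D. h z \<le> c}"
    using segment[of z w t] z w t by (auto simp: e)
qed

text \<open>Lower semicontinuity bounds \<open>h\<close> from below on a ball around a point of the domain, and
  convexity propagates the bound linearly; no separation theorem is needed.\<close>

lemma conical_minorant: "\<exists>a b. 0 \<le> b \<and> (\<forall>z\<in>D. a - b * norm z \<le> h z)"
proof -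
  obtain x where x: "x \<in> D" using nonempty by blast
  have "open (- {z \<in> D. h z \<le> h x - 1})" using closed_sublevel by (simp add: open_Compl)
  moreover have "x \<in> - {z \<in> D. h z \<le> h x - 1}" by simp
  ultimately obtain r where r: "0 < r" "ball x r \<subseteq> - {z \<in> D. h z \<le> h x - 1}"
    using open_contains_ball by blast
  have near: "h x - 1 < h z" if "z \<in> D" "norm (z - x) < r" for z
    using r that by (auto simp: dist_norm norm_minus_commute subset_iff)
  have "(h x - 1 - 2 / r * norm x) - 2 / r * norm z \<le> h z" if z: "z \<in> D" for z
  proof -
    have "h x - 1 - 2 / r * norm (z - x) \<le> h z"
    proof (cases "norm (z - x) < r")
      case True
      then have "h x - 1 < h z" by (rule near[OF z])
      moreover have "0 \<le> 2 / r * norm (z - x)" using r by simp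
      ultimately show ?thesis by linarith
    next
      case False
      \<comment> \<open>Places the intermediate point at distance \<open>r / 2\<close> from
        \<open>x\<close>, inside the ball on which \<open>h\<close> exceeds
        \<open>h x - 1\<close>.\<close>
      define t where "t = r / (2 * norm (z - x))"
      have n: "0 < norm (z - x)" using False r(1) by linarith
      have t: "0 < t" "t \<le> 1" using False r(1) n by (auto simp: t_def field_simps)
      have "norm (x + t *\<^sub>R (z - x) - x) < r" using n r(1) by (simp add: t_def)
      then have "h x - 1 < h (x + t *\<^sub>R (z - x))"
        by (rule near[rotated]) (use segment[OF x z] t in auto)
      also have "\<dots> \<le> h x + t * (h z - h x)" using segment[OF x z] t by auto
      finally have "- 1 < t * (h z - h x)" by simp
      then have "- (1 / t) < h z - h x" using t by (simp add: field_simps)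
      moreover have "1 / t = 2 / r * norm (z - x)" using r n by (simp add: t_def)
      ultimately show ?thesis by linarith
    qed
    moreover have "2 / r * norm (z - x) \<le> 2 / r * (norm x + norm z)"
      using r norm_triangle_ineq4[of z x] by (intro mult_left_mono) auto
    ultimately show ?thesis by (simp add: algebra_simps add_divide_distrib)
  qed
  then show ?thesis using r(1) by (intro exI[of _ "h x - 1 - 2 / r * norm x"] exI[of _ "2 / r"]) auto
qed

end

lemma equivalent_scalar_product_inner:
  "equivalent_scalar_product (inner :: 'a::{real_inner, complete_space} \<Rightarrow> 'a \<Rightarrow> real) 1 1"
  by standard (auto simp: is_scalar_product_def inner_commute dot_square_norm bilinear_def linear_iff
      inner_add_left inner_add_right)

section \<open>Proximal points, Riesz representation and the associated operator\<close>

context equivalent_scalar_product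
begin

text \<open>The quadratic term makes \<open>\<phi>\<close> strongly convex, so a minimizing sequence
  is Cauchy and converges in norm. The conical minorant of \<open>h\<close> falls only linearly and
  is dominated by the quadratic, which bounds \<open>\<phi>\<close> from below.\<close>

lemma proximal_point_exists:
  assumes "closed_convex_function D h"
  shows "\<exists>p\<in>D. \<forall>z\<in>D. h p + 1/2 * B (p - x) (p - x) \<le> h z + 1/2 * B (z - x) (z - x)"
proof -
  interpret h: closed_convex_function D h by fact
  define \<phi> where "\<phi> z = h z + 1/2 * B (z - x) (z - x)" for z
  have bdd: "bdd_below (\<phi> ` D)"
  proof -
    obtain a b where ab: "0 \<le> b" "\<And>z. z \<in> D \<Longrightarrow> a - b * norm z \<le> h z"
      using h.conical_minorant by blast
    have "a - b * norm x - b\<^sup>2 / (2 * \<nu>) \<le> \<phi> z" if z: "z \<in> D" for z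
    proof -
      have "b * norm z \<le> b * (norm x + norm (z - x))"
        using ab(1) norm_triangle_sub[of z x] by (intro mult_left_mono) auto
      moreover have "b * norm (z - x) \<le> b\<^sup>2 / (2 * \<nu>) + 1/2 * (\<nu> * (norm (z - x))\<^sup>2)"
      proof -
        \<comment> \<open>Young's inequality: the quadratic absorbs the linear loss up to a
          constant.\<close>
        have "0 \<le> (b - \<nu> * norm (z - x))\<^sup>2 / (2 * \<nu>)" using pos by simp
        also have "\<dots> = b\<^sup>2 / (2 * \<nu>) + 1/2 * (\<nu> * (norm (z - x))\<^sup>2) - b * norm (z - x)"
          using pos by (simp add: field_simps power2_eq_square)
        finally show ?thesis by simp
      qed
      ultimately show ?thesis
        using ab(2)[OF z] lower[of "z - x"] unfolding \<phi>_def by (simp add: algebra_simps)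
    qed
    then show ?thesis by (auto simp: bdd_below_def)
  qed
  define m where "m = Inf (\<phi> ` D)"
  have m: "m \<le> \<phi> z" if "z \<in> D" for z
    unfolding m_def using bdd that by (intro cInf_lower) auto
  have "\<exists>z\<in>D. \<phi> z < m + 1 / real (Suc n)" for n
    using cInf_lessD[of "\<phi> ` D" "m + 1 / real (Suc n)"] h.nonempty unfolding m_def by auto
  then obtain p where p: "\<And>n. p n \<in> D" "\<And>n. \<phi> (p n) < m + 1 / real (Suc n)" by metis
  have strong: "\<nu> * (norm (z - w))\<^sup>2 \<le> 4 * (\<phi> z - m) + 4 * (\<phi> w - m)" if "z \<in> D" "w \<in> D" for z w
  proof -
    \<comment> \<open>The midpoint has value at least \<open>m\<close>; the parallelogram identity
      then bounds the distance of two points by their excesses over \<open>m\<close>.\<close>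
    define c where "c = w + (1/2) *\<^sub>R (z - w)"
    have c: "c \<in> D" "h c \<le> h w + 1/2 * (h z - h w)" using h.segment[of w z "1/2"] that by (auto simp: c_def)
    have "(z - x) + (w - x) = (z - w) + ((w - x) + (w - x))" by simp
    then have "c - x = (1/2) *\<^sub>R ((z - x) + (w - x))"
      by (simp only: c_def scaleR_add_right[of _ "z - w"] scaleR_half_double) simp
    moreover have "B ((1/2) *\<^sub>R (u + v)) ((1/2) *\<^sub>R (u + v)) = 1/2 * B u u + 1/2 * B v v - 1/4 * B (u - v) (u - v)" for u v
      using commute[of v u] by (simp add: algebra field_simps)
    ultimately have "B (c - x) (c - x) = 1/2 * B (z - x) (z - x) + 1/2 * B (w - x) (w - x) - 1/4 * B (z - w) (z - w)"
      using diff_diff_eq2[of "z - x" w x] by simp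
    then have "\<phi> c \<le> 1/2 * \<phi> z + 1/2 * \<phi> w - 1/8 * B (z - w) (z - w)"
      using c by (simp add: \<phi>_def field_simps)
    then show ?thesis using m[OF c(1)] lower[of "z - w"] by simp
  qed
  have "Cauchy p"
  proof (rule metric_CauchyI)
    fix e :: real assume e: "0 < e"
    \<comment> \<open>Two excesses below \<open>1 / N\<close>, each with weight 4 in
      \<open>strong\<close>, account for the 8.\<close>
    obtain N where N: "8 / (\<nu> * e\<^sup>2) < real N" using reals_Archimedean2 by blast
    have "dist (p i) (p j) < e" if ij: "N \<le> i" "N \<le> j" for i j
    proof -
      have N0: "0 < real N" using N e pos by (smt (verit) divide_pos_pos mult_pos_pos zero_less_power)
      have s: "\<phi> (p k) - m < 1 / real N" if "N \<le> k" for k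
      proof -
        have "1 / real (Suc k) \<le> 1 / real N" using that N0 by (simp add: field_simps)
        then show ?thesis using p(2)[of k] by linarith
      qed
      have "\<nu> * (norm (p i - p j))\<^sup>2 < 8 / real N"
        using strong[OF p(1)[of i] p(1)[of j]] s[OF ij(1)] s[OF ij(2)] by simp
      also have "\<dots> < \<nu> * e\<^sup>2" using N N0 e pos by (simp add: field_simps)
      finally show ?thesis using pos e by (simp add: dist_norm power_less_imp_less_base[of _ 2])
    qed
    then show "\<exists>N. \<forall>i\<ge>N. \<forall>j\<ge>N. dist (p i) (p j) < e" by blast
  qed
  then obtain q where q: "p \<longlonglongrightarrow> q" by (auto simp: Cauchy_convergent_iff convergent_def)
  have Bq: "(\<lambda>n. B (p n - x) (p n - x)) \<longlonglongrightarrow> B (q - x) (q - x)"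
    using continuous_on_tendsto_compose[OF continuous q, of x] by simp
  \<comment> \<open>A closed sublevel set needs a fixed level, while the quadratic terms only
    converge; the slack \<open>e\<close> provides one and is removed afterwards.\<close>
  have step: "q \<in> {z \<in> D. h z \<le> m - 1/2 * B (q - x) (q - x) + e}" if e: "0 < e" for e
  proof (rule Lim_in_closed_set[OF h.closed_sublevel _ trivial_limit_sequentially q])
    have "(\<lambda>n. m + 1 / real (Suc n) - 1/2 * B (p n - x) (p n - x)) \<longlonglongrightarrow> m + 0 - 1/2 * B (q - x) (q - x)"
      by (intro tendsto_intros Bq LIMSEQ_inverse_real_of_nat[unfolded inverse_eq_divide])
    then have "\<forall>\<^sub>F n in sequentially. m + 1 / real (Suc n) - 1/2 * B (p n - x) (p n - x)
        < m - 1/2 * B (q - x) (q - x) + e"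
      by (rule order_tendstoD) (use e in simp)
    then show "\<forall>\<^sub>F n in sequentially. p n \<in> {z \<in> D. h z \<le> m - 1/2 * B (q - x) (q - x) + e}"
    proof eventually_elim
      case (elim n)
      then show ?case using p(1)[of n] p(2)[of n] unfolding \<phi>_def by simp
    qed
  qed
  have "h q + 1/2 * B (q - x) (q - x) \<le> m"
    by (rule field_le_epsilon) (use step in fastforce)
  then show ?thesis
    using step[of 1] m unfolding \<phi>_def by (intro bexI[of _ q] ballI) (auto intro: order_trans)
qed

text \<open>Comparing \<open>p\<close> with \<open>p + t *\<^sub>R (z - p)\<close>, dividing by
  \<open>t\<close> and letting \<open>t\<close> tend to 0 removes the quadratic remainder. The
  result says that \<open>x - p\<close> is a subgradient of \<open>h\<close> at \<open>p\<close> in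
  the metric \<open>B\<close>, the form in which proximal points enter all later estimates.\<close>

lemma proximal_point_variational:
  assumes conv: "convex_on D h" and p: "p \<in> D"
    and min: "\<And>z. z \<in> D \<Longrightarrow> h p + 1/2 * B (p - x) (p - x) \<le> h z + 1/2 * B (z - x) (z - x)"
    and z: "z \<in> D"
  shows "h p + B (z - p) (x - p) \<le> h z"
proof -
  define Q where "Q = B (z - p) (z - p)"
  have "h p + B (z - p) (x - p) - h z \<le> t / 2 * Q" if t: "0 < t" "t \<le> 1" for t
  proof -
    have e: "p + t *\<^sub>R (z - p) = (1 - t) *\<^sub>R p + t *\<^sub>R z" by (simp add: algebra_simps)
    have mem: "p + t *\<^sub>R (z - p) \<in> D"
      unfolding e using convex_on_imp_convex[OF conv] t p z by (intro convexD) auto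
    have "h (p + t *\<^sub>R (z - p)) \<le> h p + t * (h z - h p)"
      unfolding e using convex_onD[OF conv, of t p z] t p z by (simp add: algebra_simps)
    moreover have "B (p + t *\<^sub>R (z - p) - x) (p + t *\<^sub>R (z - p) - x)
        = B (p - x) (p - x) - 2 * t * B (z - p) (x - p) + t\<^sup>2 * Q"
    proof -
      have "p + t *\<^sub>R (z - p) - x = t *\<^sub>R (z - p) + (p - x)" by simp
      then show ?thesis unfolding Q_def
        by (simp only: sq_add) (simp add: algebra power2_eq_square algebra_simps)
    qed
    ultimately have "0 \<le> t * (h z - h p) - t * B (z - p) (x - p) + 1/2 * t\<^sup>2 * Q"
      using min[OF mem] by (simp add: diff_divide_distrib add_divide_distrib)
    also have "\<dots> = t * (h z - h p - B (z - p) (x - p) + t / 2 * Q)"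
      by (simp add: power2_eq_square algebra_simps)
    finally show ?thesis using t by (simp add: zero_le_mult_iff)
  qed
  note * = this
  have lim: "((\<lambda>t. t / 2 * Q) \<longlongrightarrow> 0 / 2 * Q) (at_right 0)" by (intro tendsto_intros) auto
  have "h p + B (z - p) (x - p) - h z \<le> 0 / 2 * Q"
  proof (rule tendsto_lowerbound[OF lim])
    show "\<forall>\<^sub>F t in at_right 0. h p + B (z - p) (x - p) - h z \<le> t / 2 * Q"
      by (rule eventually_at_rightI[of 0 1]) (use * in auto)
  qed simp
  then show ?thesis by simp
qed

text \<open>The proximal point of \<open>\<phi>\<close> at the origin is the negative of the
  representing vector: for a linear function the variational inequality, tested at
  \<open>p + d\<close> and \<open>p - d\<close>, becomes an equality.\<close>

lemma Riesz_representation: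
  fixes \<phi> :: "'a \<Rightarrow> real"
  assumes "bounded_linear \<phi>"
  shows "\<exists>w. \<forall>d. \<phi> d = B d w"
proof -
  interpret \<phi>: bounded_linear \<phi> by fact
  have conv: "convex_on UNIV \<phi>" by (auto simp: convex_on_def \<phi>.add \<phi>.scaleR)
  have "closed_convex_function UNIV \<phi>"
  proof
    show "closed {z \<in> UNIV. \<phi> z \<le> c}" for c
      using closed_Collect_le[of \<phi> "\<lambda>_. c"] assms
      by (simp add: linear_continuous_on)
  qed (use conv in auto)
  from proximal_point_exists[OF this, of 0]
  obtain p where p: "\<And>z. \<phi> p + 1/2 * B (p - 0) (p - 0) \<le> \<phi> z + 1/2 * B (z - 0) (z - 0)" by auto
  have var: "\<phi> p + B (z - p) (0 - p) \<le> \<phi> z" for z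
    by (rule proximal_point_variational[OF conv]) (use p in auto)
  have "\<phi> d = B d (- p)" for d
    using var[of "p + d"] var[of "p - d"] by (simp add: algebra \<phi>.add \<phi>.diff)
  then show ?thesis by blast
qed

text \<open>Riesz representation in the ambient inner product gives existence; together with
  uniqueness it gives the definite description in \<open>assoc_operator\<close> its meaning.\<close>

lemma assoc_operator: "B x y = x \<bullet> assoc_operator B y"
proof -
  interpret I: equivalent_scalar_product "inner :: 'a \<Rightarrow> 'a \<Rightarrow> real" 1 1
    by (rule equivalent_scalar_product_inner)
  have "\<exists>w. \<forall>x. B x y = x \<bullet> w" for y
    by (rule I.Riesz_representation[OF bounded_linear_left])
  then obtain W where W: "\<forall>x y. B x y = x \<bullet> W y" by metis
  have "W' = W" if "\<forall>x y. B x y = x \<bullet> W' y" for W'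
  proof
    fix y
    have "\<forall>d. d \<bullet> W' y = d \<bullet> W y" using that W by simp
    then show "W' y = W y" by (simp only: vector_eq_ldot)
  qed
  then have "assoc_operator B = W" unfolding assoc_operator_def by (intro the_equality W) simp
  then show ?thesis using W by simp
qed

text \<open>\<open>inv\<close> is a choice function, meaningful here since every \<open>u\<close>
  lies in the range of the operator, by Riesz representation in \<open>B\<close>. This rule turns
  gradients with respect to \<open>B\<close> back into ordinary ones.\<close>

lemma inv_assoc_operator: "B d (inv (assoc_operator B) u) = d \<bullet> u"
proof -
  have "bounded_linear (\<lambda>d. d \<bullet> u)" by (rule bounded_linear_inner_left)
  from Riesz_representation[OF this] obtain w where w: "\<And>d. d \<bullet> u = B d w" by auto
  have "assoc_operator B w = u"
    using w assoc_operator[of _ w] by (subst vector_eq_ldot[symmetric]) metis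
  then have "assoc_operator B (inv (assoc_operator B) u) = u"
    by (intro f_inv_into_f) auto
  then show ?thesis by (simp add: assoc_operator)
qed

lemma norm_equivalence:
  "sqrt \<nu> * norm z \<le> ipnorm B z" "ipnorm B z \<le> sqrt \<mu> * norm z"
  using real_sqrt_le_mono[OF lower[of z]] real_sqrt_le_mono[OF upper[of z]]
  by (simp_all add: ipnorm_def real_sqrt_mult)

text \<open>The unit vector excludes the zero space, where the infimum and the supremum defining the
  bounds range over the empty set.\<close>

lemma assoc_operator_bounds:
  fixes e :: 'a
  assumes e: "norm e = 1"
  shows "\<nu> \<le> lower_bound B" "lower_bound B \<le> upper_bound B" "upper_bound B \<le> \<mu>"
    and "lower_bound B * (norm z)\<^sup>2 \<le> B z z" "B z z \<le> upper_bound B * (norm z)\<^sup>2"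
proof -
  have lb: "lower_bound B = (INF x\<in>{x. norm x = 1}. B x x)" and ub: "upper_bound B = (SUP x\<in>{x. norm x = 1}. B x x)"
    by (simp_all add: lower_bound_def upper_bound_def assoc_operator)
  have bd: "\<nu> \<le> B x x" "B x x \<le> \<mu>" if "norm x = 1" for x
    using lower[of x] upper[of x] that by simp_all
  have bb: "bdd_below ((\<lambda>x. B x x) ` {x. norm x = 1})" and ba: "bdd_above ((\<lambda>x. B x x) ` {x. norm x = 1})"
    using bd by (auto intro!: bdd_belowI2 bdd_aboveI2)
  have ne: "{x :: 'a. norm x = 1} \<noteq> {}" using e by blast
  show "\<nu> \<le> lower_bound B" unfolding lb by (rule cINF_greatest[OF ne]) (simp add: bd)
  show "upper_bound B \<le> \<mu>" unfolding ub by (rule cSUP_least[OF ne]) (simp add: bd)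
  have unit: "lower_bound B \<le> B x x" "B x x \<le> upper_bound B" if "norm x = 1" for x
    unfolding lb ub using that by (auto intro: cINF_lower[OF bb] cSUP_upper[OF _ ba])
  show "lower_bound B \<le> upper_bound B" using unit[OF e] by linarith
  have "lower_bound B * (norm z)\<^sup>2 \<le> B z z \<and> B z z \<le> upper_bound B * (norm z)\<^sup>2"
  proof (cases "z = 0")
    case False
    then have n: "norm (z /\<^sub>R norm z) = 1" and p: "0 < (norm z)\<^sup>2" by simp_all
    have "B z z = B (z /\<^sub>R norm z) (z /\<^sub>R norm z) * (norm z)\<^sup>2"
      using False by (simp add: algebra power2_eq_square field_simps)
    then show ?thesis using unit[OF n] p by (metis less_imp_le mult_right_mono)
  qed (simp add: algebra)
  then show "lower_bound B * (norm z)\<^sup>2 \<le> B z z" "B z z \<le> upper_bound B * (norm z)\<^sup>2" by auto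
qed

end

subsection \<open>Weak topology\<close>

lemma topspace_weak_topology [simp]: "topspace weak_topology = UNIV"
  unfolding weak_topology_def topology_generated_by_topspace by auto

lemma openin_weak_topology_vimage: "open U \<Longrightarrow> openin weak_topology ((\<lambda>x. x \<bullet> u) -` U)"
  unfolding weak_topology_def by (rule topology_generated_by_Basis) auto

lemma limitin_weak_topology_iff:
  "limitin weak_topology x p F \<longleftrightarrow> (\<forall>u. ((\<lambda>k. x k \<bullet> u) \<longlongrightarrow> p \<bullet> u) F)"
proof
  assume lim: "limitin weak_topology x p F"
  show "\<forall>u. ((\<lambda>k. x k \<bullet> u) \<longlongrightarrow> p \<bullet> u) F"
  proof (intro allI topological_tendstoI)
    fix u U assume "open U" "p \<bullet> u \<in> U"
    with lim have "\<forall>\<^sub>F k in F. x k \<in> (\<lambda>x. x \<bullet> u) -` U"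
      unfolding limitin_def using openin_weak_topology_vimage[of U u] by blast
    then show "\<forall>\<^sub>F k in F. x k \<bullet> u \<in> U" by simp
  qed
next
  assume lim: "\<forall>u. ((\<lambda>k. x k \<bullet> u) \<longlongrightarrow> p \<bullet> u) F"
  have "\<forall>\<^sub>F k in F. x k \<in> U"
    if "generate_topology_on {(\<lambda>x. x \<bullet> u) -` U | u U. open U} U" "p \<in> U" for U
    using that
  proof (induction rule: generate_topology_on.induct)
    case (Int a b)
    then show ?case by (auto simp: eventually_conj)
  next
    case (UN K)
    then obtain k where k: "k \<in> K" "p \<in> k" by blast
    with UN have "\<forall>\<^sub>F j in F. x j \<in> k" by blast
    then show ?case by eventually_elim (use k in blast)
  next
    case (Basis s)
    then obtain u U where "s = (\<lambda>x. x \<bullet> u) -` U" "open U" by blast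
    then show ?case using lim Basis.prems by (auto dest: topological_tendstoD)
  qed simp
  then show "limitin weak_topology x p F"
    unfolding limitin_def topspace_weak_topology
    unfolding weak_topology_def openin_topology_generated_by_iff by simp
qed

text \<open>Projecting an outside point \<open>x\<close> onto \<open>C\<close>, as a proximal point
  of the zero function, gives a \<open>p\<close> whose variational inequality puts \<open>C\<close>
  on one side of a hyperplane; the open half-space on the other side is a weak neighbourhood of
  \<open>x\<close>.\<close>

lemma closed_convex_closedin_weak_topology:
  fixes C :: "'a::{real_inner, complete_space} set"
  assumes "closed C" "convex C"
  shows "closedin weak_topology C"
proof (cases "C = {}")
  case False
  interpret I: equivalent_scalar_product "inner :: 'a \<Rightarrow> 'a \<Rightarrow> real" 1 1
    by (rule equivalent_scalar_product_inner)
  have conv: "convex_on C (\<lambda>_. 0)" using assms(2) by (simp add: convex_on_def)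
  have "closed_convex_function C (\<lambda>_. 0)"
  proof
    show "closed {z \<in> C. (0::real) \<le> c}" for c using assms(1) by (cases "0 \<le> c") auto
  qed (use False conv in auto)
  note proj = I.proximal_point_exists[OF this]
  have "\<exists>T. openin weak_topology T \<and> x \<in> T \<and> T \<subseteq> - C" if x: "x \<notin> C" for x
  proof -
    obtain p where p: "p \<in> C"
      "\<And>z. z \<in> C \<Longrightarrow> 0 + 1/2 * ((p - x) \<bullet> (p - x)) \<le> 0 + 1/2 * ((z - x) \<bullet> (z - x))"
      using proj[of x] by blast
    have var: "0 + (z - p) \<bullet> (x - p) \<le> 0" if "z \<in> C" for z
      by (rule I.proximal_point_variational[OF conv p that])
    show ?thesis
    proof (intro exI conjI)
      show "openin weak_topology ((\<lambda>z. z \<bullet> (x - p)) -` {p \<bullet> (x - p)<..})"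
        by (rule openin_weak_topology_vimage) simp
      have "0 < (x - p) \<bullet> (x - p)" using x p by (metis inner_gt_zero_iff right_minus_eq)
      then show "x \<in> (\<lambda>z. z \<bullet> (x - p)) -` {p \<bullet> (x - p)<..}" by (simp add: inner_diff_left)
      show "(\<lambda>z. z \<bullet> (x - p)) -` {p \<bullet> (x - p)<..} \<subseteq> - C"
        using var by (force simp: inner_diff_left)
    qed
  qed
  then have "openin weak_topology (- C)" by (subst openin_subopen) auto
  then show ?thesis by (simp add: closedin_def Compl_eq_Diff_UNIV)
qed simp

text \<open>Tychonoff's theorem in the space of all real functions: those that are linear and
  bounded by \<open>R * norm u\<close> at each \<open>u\<close> form a compact set \<open>L\<close>,
  and the Riesz map \<open>\<Psi>\<close> carries \<open>L\<close> continuously onto the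
  ball.\<close>

lemma compactin_weak_topology_cball:
  "compactin weak_topology (cball (0 :: 'a::{real_inner, complete_space}) R)"
proof (cases "0 \<le> R")
  case R: True
  define L :: "('a \<Rightarrow> real) set" where
    "L = Pi UNIV (\<lambda>u. {- R * norm u .. R * norm u}) \<inter>
      ((\<Inter>u v. {\<phi>. \<phi> (u + v) = \<phi> u + \<phi> v}) \<inter> (\<Inter>c u. {\<phi>. \<phi> (c *\<^sub>R u) = c * \<phi> u}))"
  have "compact (Pi UNIV (\<lambda>u :: 'a. {- R * norm u .. R * norm u}))"
    using compactin_PiE[of "\<lambda>_. euclidean :: real topology" "UNIV :: 'a set" "\<lambda>u. {- R * norm u .. R * norm u}"]
    by (simp add: euclidean_product_topology PiE_UNIV_domain)
  moreover have "closed ((\<Inter>u v. {\<phi> :: 'a \<Rightarrow> real. \<phi> (u + v) = \<phi> u + \<phi> v}) \<inter> (\<Inter>c u. {\<phi>. \<phi> (c *\<^sub>R u) = c * \<phi> u}))"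
    by (intro closed_Int closed_INT ballI closed_Collect_eq continuous_on_add continuous_on_mult
        continuous_on_const continuous_on_product_coordinates)
  ultimately have L: "compact L" unfolding L_def by (rule compact_Int_closed)
  have "\<exists>w. \<forall>d. \<phi> d = d \<bullet> w" if "\<phi> \<in> L" for \<phi>
  proof (rule equivalent_scalar_product.Riesz_representation[OF equivalent_scalar_product_inner])
    show "bounded_linear \<phi>"
    proof (rule bounded_linear_intro)
      fix u v c
      have "- R * norm u \<le> \<phi> u" "\<phi> u \<le> R * norm u" using that by (auto simp: L_def)
      then show "norm (\<phi> u) \<le> norm u * R" by (simp add: abs_le_iff mult.commute)
      show "\<phi> (u + v) = \<phi> u + \<phi> v" "\<phi> (c *\<^sub>R u) = c *\<^sub>R \<phi> u"
        using that by (auto simp: L_def)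
    qed
  qed
  then obtain \<Psi> where \<Psi>: "\<And>\<phi> d. \<phi> \<in> L \<Longrightarrow> \<phi> d = d \<bullet> \<Psi> \<phi>" by metis
  have norm_\<Psi>: "norm (\<Psi> \<phi>) \<le> R" if "\<phi> \<in> L" for \<phi>
  proof (cases "\<Psi> \<phi> = 0")
    case True then show ?thesis using R by simp
  next
    case False
    have "norm (\<Psi> \<phi>) * norm (\<Psi> \<phi>) = \<phi> (\<Psi> \<phi>)" using \<Psi>[OF that] by (simp add: power2_norm_eq_inner flip: power2_eq_square)
    also have "\<dots> \<le> R * norm (\<Psi> \<phi>)" using that by (auto simp: L_def)
    finally show ?thesis using False by simp
  qed
  have "continuous_map (subtopology euclidean L) weak_topology \<Psi>"
    unfolding weak_topology_def
  proof (rule continuous_on_generated_topo)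
    fix V assume "V \<in> {(\<lambda>x :: 'a. x \<bullet> u) -` U | u U. open U}"
    then obtain u U where V: "V = (\<lambda>x. x \<bullet> u) -` U" and U: "open U" by blast
    \<comment> \<open>A subbasic weakly open set pulls back to a condition on the single coordinate
      \<open>u\<close> of the product.\<close>
    have "\<Psi> -` V \<inter> L = L \<inter> (\<lambda>\<phi>. \<phi> u) -` U"
      using \<Psi> by (auto simp: V inner_commute)
    moreover have "open ((\<lambda>\<phi> :: 'a \<Rightarrow> real. \<phi> u) -` U)"
      by (rule open_vimage[OF U continuous_on_product_coordinates])
    ultimately show "openin (subtopology euclidean L) (\<Psi> -` V \<inter> topspace (subtopology euclidean L))"
      by (simp add: openin_open_Int)
  qed (use topspace_weak_topology[where 'a = 'a] in \<open>simp add: weak_topology_def\<close>)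
  moreover have "compactin (subtopology euclidean L) L" using L by (simp add: compactin_subtopology)
  ultimately have "compactin weak_topology (\<Psi> ` L)" by (rule image_compactin[rotated])
  moreover have "\<Psi> ` L = cball 0 R"
  proof (intro equalityI subsetI)
    fix w :: 'a assume w: "w \<in> cball 0 R"
    have "\<bar>u \<bullet> w\<bar> \<le> R * norm u" for u
      using Cauchy_Schwarz_ineq2[of u w] mult_right_mono[of "norm w" R "norm u"] w
      by (simp add: mult.commute)
    then have m: "(\<lambda>u. u \<bullet> w) \<in> L" by (auto simp: L_def inner_add_left abs_le_iff minus_le_iff)
    have "\<Psi> (\<lambda>u. u \<bullet> w) = w" by (subst vector_eq_ldot[symmetric]) (simp flip: \<Psi>[OF m])
    with m show "w \<in> \<Psi> ` L" by (metis imageI)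
  qed (use norm_\<Psi> in auto)
  ultimately show ?thesis by simp
next
  case False
  then have "cball (0 :: 'a) R = {}" by simp
  then show ?thesis by simp
qed

text \<open>The usual covering argument yields a point all of whose neighbourhoods are visited
  frequently; intersecting \<open>F\<close> with the pulled back neighbourhood filter makes it a
  limit. This takes the place of extracting a subsequence.\<close>

lemma compactin_cluster_filter:
  assumes K: "compactin X K" and F: "F \<noteq> bot" "\<forall>\<^sub>F k in F. x k \<in> K"
  shows "\<exists>p\<in>K. \<exists>F'\<le>F. F' \<noteq> bot \<and> limitin X x p F'"
proof -
  have "\<exists>p\<in>K. \<forall>U. openin X U \<and> p \<in> U \<longrightarrow> (\<exists>\<^sub>F k in F. x k \<in> U)"
  proof (rule ccontr)
    assume "\<not> ?thesis"
    then have "\<forall>p\<in>K. \<exists>U. openin X U \<and> p \<in> U \<and> (\<forall>\<^sub>F k in F. x k \<notin> U)"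
      by (auto simp: not_frequently)
    then obtain U where U: "\<And>p. p \<in> K \<Longrightarrow> openin X (U p) \<and> p \<in> U p \<and> (\<forall>\<^sub>F k in F. x k \<notin> U p)" by metis
    then have "(\<forall>V\<in>U ` K. openin X V) \<and> K \<subseteq> \<Union>(U ` K)" by blast
    then obtain \<F> where \<F>: "finite \<F>" "\<F> \<subseteq> U ` K" "K \<subseteq> \<Union>\<F>"
      using K unfolding compactin_def by meson
    have "\<forall>\<^sub>F k in F. \<forall>V\<in>\<F>. x k \<notin> V"
    proof (rule eventually_ball_finite[OF \<F>(1)], rule ballI)
      fix V assume "V \<in> \<F>"
      with \<F>(2) U show "\<forall>\<^sub>F k in F. x k \<notin> V" by blast
    qed
    with F(2) have "\<forall>\<^sub>F k in F. False" by eventually_elim (use \<F>(3) in blast)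
    with F(1) show False by (simp only: eventually_False)
  qed
  then obtain p where p: "p \<in> K" "\<forall>U. openin X U \<and> p \<in> U \<longrightarrow> (\<exists>\<^sub>F k in F. x k \<in> U)"
    by (rule bexE)
  have pX: "p \<in> topspace X" by (rule subsetD[OF compactin_subset_topspace[OF K] p(1)])
  define F' where "F' = inf F (filtercomap x (nhdsin X p))"
  have ev: "\<forall>\<^sub>F k in F'. x k \<in> U" if "openin X U" "p \<in> U" for U
    unfolding F'_def
  proof (rule filter_leD[OF inf_le2])
    have "eventually (\<lambda>z. z \<in> U) (nhdsin X p)"
      using that pX by (auto simp: eventually_nhdsin)
    then show "\<forall>\<^sub>F k in filtercomap x (nhdsin X p). x k \<in> U"
      by (rule eventually_filtercomapI)
  qed
  have "F' \<noteq> bot"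
  proof
    assume "F' = bot"
    then have "eventually (\<lambda>_. False) F'" by simp
    then obtain P Q where P: "eventually P F" and Q: "eventually Q (filtercomap x (nhdsin X p))"
      and PQ: "\<And>k. P k \<Longrightarrow> Q k \<Longrightarrow> False"
      unfolding F'_def eventually_inf by blast
    obtain U where U: "openin X U" "p \<in> U" "\<And>k. x k \<in> U \<Longrightarrow> Q k"
      using Q pX unfolding eventually_filtercomap eventually_nhdsin by blast
    have "\<exists>\<^sub>F k in F. False"
      by (rule frequently_mp[OF _ p(2)[rule_format, OF conjI, OF U(1,2)]]) (use P PQ U(3) in \<open>auto elim!: eventually_mono\<close>)
    then show False by simp
  qed
  moreover have "limitin X x p F'" using ev pX by (simp add: limitin_def)
  moreover have "F' \<le> F" by (simp add: F'_def)
  ultimately show ?thesis using p(1) by blast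
qed

subsection \<open>Extended-real-valued convex functions\<close>

lemma proper_ereal_real:
  assumes "proper h" "z \<in> edom h"
  shows "h z = ereal (real_of_ereal (h z))"
  using assms by (cases "h z") (auto simp: proper_def edom_def)

lemma proper_not_edom: "z \<notin> edom h \<Longrightarrow> h z = \<infinity>"
  by (simp add: edom_def)

lemma econvex_convex_on:
  assumes "proper h" "econvex h"
  shows "convex_on (edom h) (\<lambda>z. real_of_ereal (h z))"
proof -
  have *: "h (u *\<^sub>R x + v *\<^sub>R y) \<le> ereal (u * real_of_ereal (h x) + v * real_of_ereal (h y))"
    if "x \<in> edom h" "y \<in> edom h" "0 \<le> u" "0 \<le> v" "u + v = 1" for x y u v
  proof -
    have "(x, real_of_ereal (h x)) \<in> {(x, r). h x \<le> ereal r}" "(y, real_of_ereal (h y)) \<in> {(x, r). h x \<le> ereal r}"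
      using proper_ereal_real[OF assms(1)] that by auto
    from convexD[OF assms(2)[unfolded econvex_def] this that(3-5)]
    show ?thesis by simp
  qed
  have mem: "u *\<^sub>R x + v *\<^sub>R y \<in> edom h"
    if "x \<in> edom h" "y \<in> edom h" "0 \<le> u" "0 \<le> v" "u + v = 1" for x y u v
    using *[OF that] by (cases "h (u *\<^sub>R x + v *\<^sub>R y)") (auto simp: edom_def)
  show ?thesis unfolding convex_on_def
  proof (intro conjI ballI allI impI)
    show "convex (edom h)" using mem by (auto simp: convex_def)
    fix x y and u v :: real
    assume a: "x \<in> edom h" "y \<in> edom h" "0 \<le> u" "0 \<le> v" "u + v = 1"
    show "real_of_ereal (h (u *\<^sub>R x + v *\<^sub>R y)) \<le> u * real_of_ereal (h x) + v * real_of_ereal (h y)"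
      using *[OF a] proper_ereal_real[OF assms(1) mem[OF a]] by (metis ereal_less_eq(3))
  qed
qed

lemma lsc_closed_sublevel:
  assumes "lsc h"
  shows "closed {z. h z \<le> c}"
proof -
  have "open {z. c < h z}"
  proof (subst open_subopen, intro ballI)
    fix z assume z: "z \<in> {z. c < h z}"
    have "\<forall>\<^sub>F y in at z. c < h y"
      using assms z unfolding lsc_def by (metis (mono_tags) le_Liminf_iff mem_Collect_eq)
    \<comment> \<open>The lower limit in \<open>lsc\<close> leaves out the point itself; there the
      inequality is the assumption on \<open>z\<close>.\<close>
    then have "\<forall>\<^sub>F y in nhds z. c < h y" using z by (simp add: eventually_nhds_conv_at)
    then show "\<exists>T. open T \<and> z \<in> T \<and> T \<subseteq> {z. c < h z}"
      unfolding eventually_nhds by blast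
  qed
  moreover have "- {z. h z \<le> c} = {z. c < h z}" by auto
  ultimately show ?thesis by (simp add: closed_def)
qed

lemma closed_convex_function_edom:
  fixes h :: "'a::real_normed_vector \<Rightarrow> ereal"
  assumes "proper h" "econvex h" "lsc h"
  shows "closed_convex_function (edom h) (\<lambda>z. real_of_ereal (h z))"
proof
  show "edom h \<noteq> {}" using assms(1) by (simp add: proper_def)
  show "convex_on (edom h) (\<lambda>z. real_of_ereal (h z))" by (rule econvex_convex_on[OF assms(1,2)])
  fix c
  have "{z \<in> edom h. real_of_ereal (h z) \<le> c} = {z. h z \<le> ereal c}"
  proof (intro Collect_cong)
    fix z
    show "(z \<in> edom h \<and> real_of_ereal (h z) \<le> c) = (h z \<le> ereal c)"
      using assms(1) by (cases "h z") (auto simp: edom_def proper_def)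
  qed
  then show "closed {z \<in> edom h. real_of_ereal (h z) \<le> c}"
    using lsc_closed_sublevel[OF assms(3)] by simp
qed

lemma gradient_eq:
  assumes "has_gateaux_gradient h x u"
  shows "gradient h x = u"
  unfolding gradient_def
proof (rule the_equality)
  show "has_gateaux_gradient h x u" by fact
  fix v assume v: "has_gateaux_gradient h x v"
  have "d \<bullet> v = d \<bullet> u" for d
    using assms v tendsto_unique[OF trivial_limit_at] unfolding has_gateaux_gradient_def
    by (metis ereal.inject)
  then show "v = u" by (intro vector_eq_ldot[THEN iffD1]) simp
qed

text \<open>By convexity the difference quotients of \<open>h\<close> from \<open>x\<close> towards
  \<open>z\<close> never exceed \<open>h z - h x\<close>, and the limit from the right keeps this
  bound.\<close>

lemma gradient_inequality:
  assumes h: "proper h" "econvex h" and x: "has_gateaux_gradient h x u" and z: "z \<in> edom h"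
  shows "real_of_ereal (h x) + (z - x) \<bullet> u \<le> real_of_ereal (h z)"
proof -
  let ?h = "\<lambda>z. real_of_ereal (h z)"
  have xd: "x \<in> edom h" using x by (simp add: has_gateaux_gradient_def)
  note conv = econvex_convex_on[OF h]
  have lim: "((\<lambda>t. (h (x + t *\<^sub>R (z - x)) - h x) / ereal t) \<longlongrightarrow> ereal ((z - x) \<bullet> u)) (at_right 0)"
    using x filterlim_mono[OF _ order_refl at_le[OF subset_UNIV]] unfolding has_gateaux_gradient_def by blast
  have "(h (x + t *\<^sub>R (z - x)) - h x) / ereal t \<le> ereal (?h z - ?h x)" if t: "0 < t" "t < 1" for t
  proof -
    have e: "x + t *\<^sub>R (z - x) = (1 - t) *\<^sub>R x + t *\<^sub>R z" by (simp add: algebra_simps)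
    have mem: "x + t *\<^sub>R (z - x) \<in> edom h"
      unfolding e using convex_on_imp_convex[OF conv] t xd z by (intro convexD) auto
    have "?h (x + t *\<^sub>R (z - x)) \<le> ?h x + t * (?h z - ?h x)"
      unfolding e using convex_onD[OF conv, of t x z] t xd z by (simp add: algebra_simps)
    then have "(?h (x + t *\<^sub>R (z - x)) - ?h x) / t \<le> ?h z - ?h x"
      using t by (simp add: field_simps)
    moreover have "(h (x + t *\<^sub>R (z - x)) - h x) / ereal t = ereal ((?h (x + t *\<^sub>R (z - x)) - ?h x) / t)"
      using t by (subst (1 2) proper_ereal_real[OF h(1)]) (auto simp: mem xd)
    ultimately show ?thesis by simp
  qed
  then have "ereal ((z - x) \<bullet> u) \<le> ereal (?h z - ?h x)"
    by (intro tendsto_upperbound[OF lim] eventually_at_rightI[of 0 1]) auto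
  then show ?thesis by simp
qed

text \<open>Existence of a minimizer makes the \<open>SOME\<close> hidden in \<open>arg_min\<close> meaningful.\<close>

lemma (in equivalent_scalar_product) fb_point_variational:
  assumes g: "proper g" "econvex g" "lsc g" and t: "0 < t"
  shows "fb_point B f g x t \<in> edom g"
    and "z \<in> edom g \<Longrightarrow> real_of_ereal (g (fb_point B f g x t))
           + B (z - fb_point B f g x t) (x - fb_point B f g x t) / t
         \<le> real_of_ereal (g z) + (z - fb_point B f g x t) \<bullet> gradient f x"
proof -
  let ?g = "\<lambda>z. real_of_ereal (g z)"
  define w where "w = x - t *\<^sub>R gradient_wrt B f x"
  define \<phi> where "\<phi> z = ereal t * g z + ereal (1/2 * (ipnorm B (z - w))\<^sup>2)" for z
  interpret g: closed_convex_function "edom g" ?g by (rule closed_convex_function_edom[OF g])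
  have tg: "closed_convex_function (edom g) (\<lambda>z. t * ?g z)"
  proof
    show "convex_on (edom g) (\<lambda>z. t * ?g z)" using t g.convex_on by (intro convex_on_cmul) auto
    have "{z \<in> edom g. t * ?g z \<le> c} = {z \<in> edom g. ?g z \<le> c / t}" for c
      using t by (auto simp: field_simps)
    then show "closed {z \<in> edom g. t * ?g z \<le> c}" for c using g.closed_sublevel by simp
  qed (rule g.nonempty)
  have \<phi>: "\<phi> z = ereal (t * ?g z + 1/2 * B (z - w) (z - w))" if "z \<in> edom g" for z
    unfolding \<phi>_def ipnorm_power2 by (subst proper_ereal_real[OF g(1) that]) simp
  have \<phi>_inf: "\<phi> z = \<infinity>" if "z \<notin> edom g" for z
    unfolding \<phi>_def using t that by (simp add: proper_not_edom)
  obtain q where q: "q \<in> edom g" "\<And>z. z \<in> edom g \<Longrightarrow> t * ?g q + 1/2 * B (q - w) (q - w) \<le> t * ?g z + 1/2 * B (z - w) (z - w)"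
    using proximal_point_exists[OF tg, of w] by blast
  have "is_arg_min \<phi> (\<lambda>_. True) q"
    unfolding is_arg_min_linorder using q by (metis \<phi> \<phi>_inf ereal_less_eq(1,3))
  then have min: "is_arg_min \<phi> (\<lambda>_. True) (fb_point B f g x t)"
    unfolding fb_point_def prox_def arg_min_def \<phi>_def[abs_def] w_def by (rule someI)
  define p where "p = fb_point B f g x t"
  have le: "\<phi> p \<le> \<phi> z" for z using min by (simp add: is_arg_min_linorder p_def)
  have p: "p \<in> edom g" using le[of q] \<phi>[OF q(1)] \<phi>_inf[of p] by (cases "p \<in> edom g") auto
  then show "fb_point B f g x t \<in> edom g" by (simp add: p_def)
  assume z: "z \<in> edom g"
  have min': "t * ?g p + 1/2 * B (p - w) (p - w) \<le> t * ?g v + 1/2 * B (v - w) (v - w)" if "v \<in> edom g" for v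
    using le[of v] \<phi>[OF p] \<phi>[OF that] by simp
  have "t * ?g p + B (z - p) (w - p) \<le> t * ?g z"
    by (rule proximal_point_variational[OF closed_convex_function.convex_on[OF tg] p min' z])
  \<comment> \<open>The forward step, taken along the gradient with respect to \<open>B\<close>,
    contributes the ordinary inner product with the gradient of \<open>f\<close>.\<close>
  also have "B (z - p) (w - p) = B (z - p) (x - p) - t * ((z - p) \<bullet> gradient f x)"
    unfolding w_def gradient_wrt_def
    by (simp add: algebra inv_assoc_operator inner_diff_left algebra_simps)
  finally have "t * (?g p + B (z - p) (x - p) / t) \<le> t * (?g z + (z - p) \<bullet> gradient f x)"
    using t by (simp add: algebra_simps)
  then show "?g (fb_point B f g x t) + B (z - fb_point B f g x t) (x - fb_point B f g x t) / t
      \<le> ?g z + (z - fb_point B f g x t) \<bullet> gradient f x"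
    using t by (simp add: p_def)
qed

subsection \<open>Quasi-Fejer sequences and Opial's lemma\<close>

lemma convergent_growth_factors:
  fixes \<eta> :: "nat \<Rightarrow> real"
  assumes "\<And>k. 0 \<le> \<eta> k" "summable \<eta>"
  shows "1 \<le> (\<Prod>i<k. 1 + \<eta> i)" "(\<Prod>i<k. 1 + \<eta> i) \<le> exp (suminf \<eta>)"
    "convergent (\<lambda>k. \<Prod>i<k. 1 + \<eta> i)"
proof -
  show ge: "1 \<le> (\<Prod>i<k. 1 + \<eta> i)" for k by (rule prod_ge_1) (simp add: assms(1))
  show le: "(\<Prod>i<k. 1 + \<eta> i) \<le> exp (suminf \<eta>)" for k
  proof -
    have "(\<Prod>i<k. 1 + \<eta> i) \<le> (\<Prod>i<k. exp (\<eta> i))"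
      by (rule prod_mono) (simp add: assms(1) exp_ge_add_one_self)
    also have "\<dots> = exp (\<Sum>i<k. \<eta> i)" by (simp add: exp_sum)
    also have "\<dots> \<le> exp (suminf \<eta>)" by (simp add: sum_le_suminf assms)
    finally show ?thesis .
  qed
  have "incseq (\<lambda>k. \<Prod>i<k. 1 + \<eta> i)"
  proof (rule incseq_SucI)
    fix k
    have "0 \<le> (\<Prod>i<k. 1 + \<eta> i)" using ge[of k] by linarith
    then have "(\<Prod>i<k. 1 + \<eta> i) * 1 \<le> (\<Prod>i<k. 1 + \<eta> i) * (1 + \<eta> k)"
      by (rule mult_left_mono[rotated]) (simp add: assms(1))
    then show "(\<Prod>i<k. 1 + \<eta> i) \<le> (\<Prod>i<Suc k. 1 + \<eta> i)" by simp
  qed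
  then obtain L where "(\<lambda>k. \<Prod>i<k. 1 + \<eta> i) \<longlonglongrightarrow> L"
    using incseq_convergent le by blast
  then show "convergent (\<lambda>k. \<Prod>i<k. 1 + \<eta> i)" by (rule convergentI)
qed

text \<open>A deterministic form of the Robbins-Siegmund argument. Dividing by the growth factors
  \<open>\<tau>\<close> removes the multiplicative errors; adding the accumulated \<open>b\<close>
  and subtracting the accumulated \<open>\<epsilon>\<close> then gives a nonincreasing sequence
  bounded below. Its convergence passes back to \<open>a\<close> because \<open>\<tau>\<close>
  converges.\<close>

lemma quasi_Fejer_sequence:
  fixes a b \<epsilon> \<eta> :: "nat \<Rightarrow> real"
  assumes nonneg: "\<And>k. 0 \<le> a k" "\<And>k. 0 \<le> b k" "\<And>k. 0 \<le> \<epsilon> k" "\<And>k. 0 \<le> \<eta> k"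
    and summable: "summable \<eta>" "summable \<epsilon>"
    and step: "\<And>k. a (Suc k) \<le> (1 + \<eta> k) * a k + \<epsilon> k - b k"
  shows "convergent a" "summable b"
proof -
  define \<tau> where "\<tau> k = (\<Prod>i<k. 1 + \<eta> i)" for k
  define T where "T = exp (suminf \<eta>)"
  have \<tau>: "1 \<le> \<tau> k" "\<tau> k \<le> T" for k
    using convergent_growth_factors(1,2)[of \<eta> k] nonneg summable by (auto simp: \<tau>_def T_def)
  have T: "0 < T" by (simp add: T_def)
  define c where "c k = a k / \<tau> k" for k
  \<comment> \<open>The gains carry the factor \<open>1 / T\<close>, a lower bound of all
    \<open>1 / \<tau> k\<close>.\<close>
  define d where "d k = c k - (\<Sum>i<k. \<epsilon> i) + (\<Sum>i<k. b i) / T" for k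
  have c0: "0 \<le> c k" for k using nonneg(1)[of k] \<tau>(1)[of k] by (simp add: c_def)
  have c_step: "c (Suc k) \<le> c k + \<epsilon> k - b k / T" for k
  proof -
    have s: "\<tau> (Suc k) = (1 + \<eta> k) * \<tau> k" by (simp add: \<tau>_def)
    have p: "0 < \<tau> (Suc k)" "0 < \<tau> k" "0 < 1 + \<eta> k"
      using \<tau>(1)[of "Suc k"] \<tau>(1)[of k] nonneg(4)[of k] by linarith+
    have "c (Suc k) \<le> ((1 + \<eta> k) * a k + \<epsilon> k - b k) / \<tau> (Suc k)"
      unfolding c_def using step[of k] p by (intro divide_right_mono) auto
    also have "\<dots> = (1 + \<eta> k) * a k / \<tau> (Suc k) + \<epsilon> k / \<tau> (Suc k) - b k / \<tau> (Suc k)"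
      by (simp add: add_divide_distrib diff_divide_distrib)
    also have "(1 + \<eta> k) * a k / \<tau> (Suc k) = c k" unfolding c_def s using p by simp
    finally have "c (Suc k) \<le> c k + \<epsilon> k / \<tau> (Suc k) - b k / \<tau> (Suc k)" .
    moreover have "\<epsilon> k / \<tau> (Suc k) \<le> \<epsilon> k / 1"
      by (rule divide_left_mono) (use nonneg(3) \<tau>(1)[of "Suc k"] p in auto)
    moreover have "b k / T \<le> b k / \<tau> (Suc k)"
      by (rule divide_left_mono) (use nonneg(2) \<tau>(2)[of "Suc k"] p T in auto)
    ultimately show ?thesis by simp
  qed
  have "d (Suc k) \<le> d k" for k using c_step[of k] by (simp add: d_def add_divide_distrib)
  then have dec: "decseq d" by (rule decseq_SucI)
  have eps: "(\<Sum>i<k. \<epsilon> i) \<le> suminf \<epsilon>" for k by (intro sum_le_suminf summable) (auto simp: nonneg)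
  have lower: "- suminf \<epsilon> + (\<Sum>i<k. b i) / T \<le> d k" for k using eps[of k] c0[of k] by (simp add: d_def)
  have "(\<Sum>i<k. b i) \<le> (d 0 + suminf \<epsilon>) * T" for k
  proof -
    have "(\<Sum>i<k. b i) / T \<le> d 0 + suminf \<epsilon>" using lower[of k] decseqD[OF dec, of 0 k] by simp
    then show ?thesis using T by (simp add: pos_divide_le_eq)
  qed
  with nonneg(2) show b: "summable b" by (rule summableI_nonneg_bounded)
  have "- suminf \<epsilon> \<le> d k" for k
  proof -
    have "0 \<le> (\<Sum>i<k. b i) / T" using T nonneg(2) by (simp add: sum_nonneg)
    then show ?thesis using lower[of k] by linarith
  qed
  then obtain L where "d \<longlonglongrightarrow> L" using decseq_convergent[OF dec] by blast
  then have "convergent d" by (rule convergentI)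
  moreover have "convergent (\<lambda>k. \<Sum>i<k. \<epsilon> i)" "convergent (\<lambda>k. \<Sum>i<k. b i)"
    using summable(2) b by (simp_all add: summable_iff_convergent)
  ultimately have "convergent (\<lambda>k. d k + (\<Sum>i<k. \<epsilon> i) - (\<Sum>i<k. b i) * inverse T)"
    by (intro convergent_add convergent_diff convergent_mult convergent_const)
  then have "convergent (\<lambda>k. (d k + (\<Sum>i<k. \<epsilon> i) - (\<Sum>i<k. b i) * inverse T) * \<tau> k)"
    unfolding \<tau>_def by (rule convergent_mult[OF _ convergent_growth_factors(3)[OF nonneg(4) summable(1)]])
  moreover have "(d k + (\<Sum>i<k. \<epsilon> i) - (\<Sum>i<k. b i) * inverse T) * \<tau> k = a k" for k
    using \<tau>(1)[of k] by (simp add: d_def c_def field_simps)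
  ultimately show "convergent a" by simp
qed

locale quasi_decreasing_metrics =
  fixes C :: "nat \<Rightarrow> 'a::{real_inner, complete_space} \<Rightarrow> 'a \<Rightarrow> real" and \<nu> \<mu> :: real and \<eta> :: "nat \<Rightarrow> real"
  assumes metric: "\<And>k. equivalent_scalar_product (C k) \<nu> \<mu>"
    and \<nu>_le_\<mu>: "\<nu> \<le> \<mu>"
    and \<eta>_nonneg: "\<And>k. 0 \<le> \<eta> k" and \<eta>_summable: "summable \<eta>"
    and quasi_decreasing: "\<And>k z. C (Suc k) z z \<le> (1 + \<eta> k) * C k z z"
begin

text \<open>Opial's lemma. After division by the growth factors the metrics decrease, and the
  Cauchy--Schwarz inequality for their differences makes \<open>C k u d\<close> almost independent of \<open>k\<close>,
  uniformly for \<open>u\<close> in a bounded set.\<close>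

lemma weak_cluster_point_unique:
  assumes conv: "convergent (\<lambda>k. C k (x k - p) (x k - p))" "convergent (\<lambda>k. C k (x k - q) (x k - q))"
    and bdd: "\<And>k. norm (x k) \<le> R"
    and p: "E \<le> sequentially" "E \<noteq> bot" "limitin weak_topology x p E"
    and q: "E' \<le> sequentially" "E' \<noteq> bot" "limitin weak_topology x q E'"
  shows "p = q"
proof -
  note C = metric[THEN equivalent_scalar_product.algebra(1)] metric[THEN equivalent_scalar_product.algebra(2)]
    metric[THEN equivalent_scalar_product.algebra(3)] metric[THEN equivalent_scalar_product.algebra(4)]
  note bil = equivalent_scalar_product.bilinear[OF metric]
  note comm = equivalent_scalar_product.commute[OF metric]
  define \<tau> where "\<tau> k = (\<Prod>i<k. 1 + \<eta> i)" for k
  define T where "T = exp (suminf \<eta>)"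
  have \<tau>: "1 \<le> \<tau> k" "\<tau> k \<le> T" for k
    using convergent_growth_factors(1,2)[of \<eta> k] \<eta>_nonneg \<eta>_summable by (auto simp: \<tau>_def T_def)
  have \<tau>_conv: "convergent \<tau>"
    unfolding \<tau>_def by (rule convergent_growth_factors(3)[OF \<eta>_nonneg \<eta>_summable])
  obtain t where t: "\<tau> \<longlonglongrightarrow> t" using \<tau>_conv by (auto simp: convergent_def)
  have t1: "1 \<le> t" by (rule LIMSEQ_le_const[OF t]) (use \<tau> in auto)
  define A where "A k u v = C k u v / \<tau> k" for k u v
  have A_Suc: "A (Suc k) z z \<le> A k z z" for k z
  proof -
    have p: "0 < \<tau> k" "0 < 1 + \<eta> k" using \<tau>(1)[of k] \<eta>_nonneg[of k] by linarith+
    have s: "\<tau> (Suc k) = (1 + \<eta> k) * \<tau> k" by (simp add: \<tau>_def)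
    have "C (Suc k) z z / \<tau> (Suc k) \<le> (1 + \<eta> k) * C k z z / \<tau> (Suc k)"
      using quasi_decreasing[of k z] \<tau>(1)[of "Suc k"] by (intro divide_right_mono) auto
    also have "\<dots> = C k z z / \<tau> k" unfolding s using p by simp
    finally show ?thesis by (simp add: A_def)
  qed
  have A_dec: "A k z z \<le> A n z z" if "n \<le> k" for n k z
    using decseqD[OF decseq_SucI[of "\<lambda>k. A k z z"] that] A_Suc by simp
  have A_nonneg: "0 \<le> A k z z" for k z
    using equivalent_scalar_product.nonneg[OF metric, of k z] \<tau>(1)[of k] by (simp add: A_def)
  have A_conv: "convergent (\<lambda>k. A k z z)" for z
    by (rule decseq_convergent[OF decseq_SucI[of "\<lambda>k. A k z z"], of 0])
       (auto simp: A_Suc A_nonneg intro: convergentI)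
  have A_upper: "A k z z \<le> \<mu> * (norm z)\<^sup>2" for k z
  proof -
    have "C k z z / \<tau> k \<le> C k z z / 1"
      using equivalent_scalar_product.nonneg[OF metric, of k z] \<tau>(1)[of k] by (intro divide_left_mono) auto
    then show ?thesis using equivalent_scalar_product.upper[OF metric, of k z] by (simp add: A_def)
  qed
  have A_lower: "\<nu> / T * (norm z)\<^sup>2 \<le> A k z z" for k z
  proof -
    have "C k z z / T \<le> C k z z / \<tau> k"
      using equivalent_scalar_product.nonneg[OF metric, of k z] \<tau>[of k] by (intro divide_left_mono) auto
    moreover have "\<nu> * (norm z)\<^sup>2 / T \<le> C k z z / T"
      using equivalent_scalar_product.lower[OF metric, of z k] by (intro divide_right_mono) (auto simp: T_def)
    ultimately show ?thesis by (simp add: A_def)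
  qed
  define d where "d = p - q"
  \<comment> \<open>The difference of the squared distances to \<open>p\<close> and \<open>q\<close>
    is affine in \<open>x k\<close>, so their convergence forces that of the pairing with
    \<open>d\<close>.\<close>
  have Cd: "C k (x k) d = (C k p p - C k q q - (C k (x k - p) (x k - p) - C k (x k - q) (x k - q))) / 2" for k
    unfolding d_def using comm[of k p "x k"] comm[of k q "x k"] by (simp add: C)
  have "convergent (\<lambda>k. A k z z * \<tau> k)" for z by (rule convergent_mult[OF A_conv \<tau>_conv])
  moreover have "A k z z * \<tau> k = C k z z" for k z using \<tau>(1)[of k] by (simp add: A_def)
  ultimately have C_conv: "convergent (\<lambda>k. C k z z)" for z by simp
  have "convergent (\<lambda>k. C k (x k) d)"
    unfolding Cd divide_inverse by (intro convergent_diff convergent_mult convergent_const conv C_conv)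
  then obtain l where l: "(\<lambda>k. C k (x k) d) \<longlonglongrightarrow> l" by (auto simp: convergent_def)
  have lA: "(\<lambda>k. A k (x k) d) \<longlonglongrightarrow> l / t"
    unfolding A_def by (rule tendsto_divide[OF l t]) (use t1 in simp)
  have \<mu>: "0 < \<mu>" using equivalent_scalar_product.pos[OF metric] \<nu>_le_\<mu> by (rule less_le_trans)
  \<comment> \<open>The summand 1 keeps the divisor \<open>M\<close> positive also when
    \<open>R\<close> is 0.\<close>
  define M where "M = \<mu> * R\<^sup>2 + 1"
  have M: "0 < M" using \<mu> by (simp add: M_def add_nonneg_pos)
  have xM: "\<mu> * (norm (x k))\<^sup>2 \<le> M" for k
  proof -
    have "(norm (x k))\<^sup>2 \<le> R\<^sup>2" using bdd by (intro power_mono) auto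
    then have "\<mu> * (norm (x k))\<^sup>2 \<le> \<mu> * R\<^sup>2" using \<mu> by (intro mult_left_mono) auto
    then show ?thesis by (simp add: M_def)
  qed
  have bound: "\<nu> / T * (norm d)\<^sup>2 \<le> 4 * e" if e: "0 < e" for e
  proof -
    have "Cauchy (\<lambda>k. A k d d)" using A_conv[of d] by (simp add: Cauchy_convergent_iff)
    then obtain N where N: "\<And>m n. N \<le> m \<Longrightarrow> N \<le> n \<Longrightarrow> norm (A m d d - A n d d) < e\<^sup>2 / M"
      using CauchyD[of "\<lambda>k. A k d d" "e\<^sup>2 / M"] e M by auto
    have close: "\<bar>A N (x k) d - A k (x k) d\<bar> \<le> e" if k: "N \<le> k" for k
    proof -
      let ?D = "\<lambda>u v. A N u v - A k u v"
      have "linear (C n u)" "linear (\<lambda>v. C n v u)" for n u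
        using bil[of n] by (simp_all add: bilinear_def)
      then have bilD: "bilinear ?D"
        by (auto simp: bilinear_def A_def linear_iff add_divide_distrib right_diff_distrib)
      have "(?D (x k) d)\<^sup>2 \<le> ?D (x k) (x k) * ?D d d"
        by (rule psd_Cauchy_Schwarz[OF bilD]) (use comm A_dec[OF k] in \<open>auto simp: A_def\<close>)
      also have "\<dots> \<le> M * (e\<^sup>2 / M)"
      proof (rule mult_mono)
        show "?D (x k) (x k) \<le> M"
          using A_upper[of N "x k"] A_nonneg[of k "x k"] xM[of k] by linarith
        show "?D d d \<le> e\<^sup>2 / M" using N[of N k] k by auto
      qed (use M A_dec[OF k] in auto)
      also have "\<dots> = e\<^sup>2" using M by simp
      finally have "\<bar>?D (x k) d\<bar> \<le> \<bar>e\<bar>" by (simp only: abs_le_square_iff)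
      then show ?thesis using e by simp
    qed
    have ev: "\<forall>\<^sub>F k in sequentially. \<bar>A N (x k) d - l / t\<bar> \<le> 2 * e"
      using tendstoD[OF lA e] eventually_ge_at_top[of N]
    proof eventually_elim
      case (elim k)
      then show ?case using close[of k] by (simp add: dist_real_def)
    qed
    \<comment> \<open>With \<open>N\<close> frozen, pairing with \<open>d\<close> in
      \<open>A N\<close> is an inner product with a fixed vector and passes to weak limits.\<close>
    define w where "w = assoc_operator (C N) d /\<^sub>R \<tau> N"
    have w: "A N u d = u \<bullet> w" for u
      using equivalent_scalar_product.assoc_operator[OF metric, of N u d]
      by (simp add: A_def w_def divide_inverse mult.commute)
    have *: "\<bar>A N z d - l / t\<bar> \<le> 2 * e"
      if "E \<le> sequentially" "E \<noteq> bot" "limitin weak_topology x z E" for z E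
    proof (rule tendsto_upperbound)
      show "((\<lambda>k. \<bar>A N (x k) d - l / t\<bar>) \<longlongrightarrow> \<bar>A N z d - l / t\<bar>) E"
        unfolding w using that(3)[unfolded limitin_weak_topology_iff, rule_format, of w]
        by (intro tendsto_rabs tendsto_diff tendsto_const)
      show "\<forall>\<^sub>F k in E. \<bar>A N (x k) d - l / t\<bar> \<le> 2 * e" using that(1) ev by (rule filter_leD)
    qed (rule that(2))
    have "A N d d = A N p d - A N q d" unfolding w by (simp only: d_def inner_diff_left)
    then have "A N d d \<le> 4 * e" using *[OF p] *[OF q] by linarith
    then show ?thesis using A_lower[of d N] by linarith
  qed
  have "\<nu> / T * (norm d)\<^sup>2 \<le> 0"
    by (rule field_le_epsilon) (use bound[of "_ / 4"] in auto)
  moreover have "0 < \<nu> / T" using equivalent_scalar_product.pos[OF metric] by (simp add: T_def)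
  ultimately have "\<not> 0 < (norm d)\<^sup>2" using mult_pos_pos by (meson not_less)
  then show ?thesis by (simp add: d_def)
qed

end

subsection \<open>The forward-backward iteration\<close>

lemma (in closed_convex_function) convex_sublevel_cball:
  "convex ({z \<in> D. h z \<le> M} \<inter> cball 0 R)"
  by (intro convex_Int convex_sublevel convex_cball)

text \<open>A sublevel set of \<open>h\<close> is closed and convex, hence weakly closed, and its
  part in a ball is weakly compact. Such sets lie in \<open>D\<close>, so the uniform continuity
  assumption applies to them.\<close>

lemma sublevel_cball_compactin_weak:
  fixes h :: "'a::{real_inner, complete_space} \<Rightarrow> real"
  assumes "closed_convex_function D h"
  shows "compactin weak_topology ({z \<in> D. h z \<le> M} \<inter> cball 0 R)"
proof -
  interpret closed_convex_function D h by fact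
  show ?thesis
    by (rule closed_Int_compactin[OF closed_convex_closedin_weak_topology compactin_weak_topology_cball])
       (rule closed_sublevel convex_sublevel)+
qed

text \<open>A ball of an infinite-dimensional space is not totally bounded, so boundedness is obtained
  along segments.\<close>

lemma uniformly_continuous_on_convex_bounded:
  fixes G :: "'a::real_normed_vector \<Rightarrow> 'b::real_normed_vector"
  assumes uc: "uniformly_continuous_on K G" and K: "convex K" "K \<subseteq> cball 0 R"
  shows "\<exists>c. 0 \<le> c \<and> (\<forall>z\<in>K. norm (G z) \<le> c)"
proof (cases "K = {}")
  case False
  then obtain a where a: "a \<in> K" by blast
  obtain d where d: "0 < d" "\<And>z w. z \<in> K \<Longrightarrow> w \<in> K \<Longrightarrow> dist w z < d \<Longrightarrow> dist (G w) (G z) < 1"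
    using uniformly_continuous_onE[OF uc, of 1] by (metis zero_less_one)
  have R: "0 \<le> R" using a K(2) norm_ge_zero[of a] by (auto simp: subset_iff simp del: norm_ge_zero intro: order_trans)
  \<comment> \<open>Two points of the ball are at most \<open>2 * R\<close> apart, so
    \<open>N\<close> equal pieces of a segment are shorter than \<open>d\<close>, and each adds at
    most 1 to the norm of \<open>G\<close>.\<close>
  obtain N where N: "2 * R / d < real N" using reals_Archimedean2 by blast
  have N0: "0 < real N" using N R d(1) by (intro le_less_trans[OF _ N]) simp
  have "norm (G z) \<le> norm (G a) + real N" if z: "z \<in> K" for z
  proof -
    define p where "p i = a + (real i / real N) *\<^sub>R (z - a)" for i
    have p: "p i \<in> K" if "i \<le> N" for i
    proof -
      have "p i = (1 - real i / real N) *\<^sub>R a + (real i / real N) *\<^sub>R z"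
        by (simp add: p_def algebra_simps)
      then show ?thesis using K(1) a z that N0 by (auto intro!: convexD)
    qed
    have step: "dist (G (p (Suc i))) (G (p i)) < 1" if "Suc i \<le> N" for i
    proof (rule d(2))
      have "p (Suc i) - p i = (1 / real N) *\<^sub>R (z - a)"
        by (simp add: p_def add_divide_distrib flip: scaleR_diff_left)
      then have "dist (p (Suc i)) (p i) = norm (z - a) / real N" using N0 by (simp add: dist_norm)
      also have "\<dots> \<le> 2 * R / real N"
      proof (rule divide_right_mono)
        have "norm z \<le> R" "norm a \<le> R" using K(2) a z by auto
        then show "norm (z - a) \<le> 2 * R" using norm_triangle_ineq4[of z a] by linarith
      qed simp
      also have "\<dots> < d" using N N0 d(1) by (simp add: field_simps)
      finally show "dist (p (Suc i)) (p i) < d" .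
    qed (use p that in auto)
    have "norm (G (p i)) \<le> norm (G a) + real i" if "i \<le> N" for i
      using that
    proof (induction i)
      case 0 then show ?case by (simp add: p_def)
    next
      case (Suc i)
      then show ?case using step[of i] norm_triangle_sub[of "G (p (Suc i))" "G (p i)"]
        by (simp add: dist_norm)
    qed
    from this[of N] show ?thesis using N0 by (simp add: p_def)
  qed
  then show ?thesis by (intro exI[of _ "norm (G a) + real N"]) simp
qed auto

text \<open>The common consequence of a rejected trial in all four line searches, used with
  \<open>c = \<delta> * \<nu>\<close>. It is phrased in the ambient norm, the one of the uniform
  continuity assumption.\<close>

definition line_search_failure :: "('a::real_normed_vector \<Rightarrow> 'b::real_normed_vector) \<Rightarrow> real \<Rightarrow> 'a \<Rightarrow> 'a \<Rightarrow> real \<Rightarrow> real \<Rightarrow> bool" where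
  "line_search_failure G c z p t s \<longleftrightarrow> c * norm (p - z) / t \<le> norm (G (z + s *\<^sub>R (p - z)) - G z)"

text \<open>\<open>P\<close> stands for the forward-backward point, known only through its
  membership in \<open>D\<close> and its variational inequality. The two alternatives in
  \<open>parameters\<close> are backtracking of the step sizes and of the relaxation parameters;
  \<open>\<gamma> k / \<theta>\<close> and \<open>lam k / \<theta>\<close> are the last rejected
  trial values. In the first alternative \<open>\<gamma>max\<close> is the initial trial
  value.\<close>

locale fb_sequence = closed_convex_function D g
  for D :: "'a::{real_inner, complete_space} set" and g +
  fixes f :: "'a \<Rightarrow> real" and G :: "'a \<Rightarrow> 'a" and B :: "nat \<Rightarrow> 'a \<Rightarrow> 'a \<Rightarrow> real"
    and \<nu> \<mu> \<delta> \<theta> \<gamma>max :: real and P :: "nat \<Rightarrow> 'a \<Rightarrow> real \<Rightarrow> 'a"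
    and x y :: "nat \<Rightarrow> 'a" and \<gamma> lam :: "nat \<Rightarrow> real"
  assumes metric: "\<And>k. equivalent_scalar_product (B k) \<nu> \<mu>" and \<nu>_le_\<mu>: "\<nu> \<le> \<mu>"
    and subgradient: "\<And>z w. z \<in> D \<Longrightarrow> w \<in> D \<Longrightarrow> f z + (w - z) \<bullet> G z \<le> f w"
    and uniform: "\<And>K. compactin weak_topology K \<Longrightarrow> K \<subseteq> D \<Longrightarrow> uniformly_continuous_on K G"
    and P_mem: "\<And>k z t. 0 < t \<Longrightarrow> P k z t \<in> D"
    and P_variational: "\<And>k z t w. 0 < t \<Longrightarrow> w \<in> D \<Longrightarrow>
          g (P k z t) + B k (w - P k z t) (z - P k z t) / t \<le> g w + (w - P k z t) \<bullet> G z"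
    and x0: "x 0 \<in> D"
    and y_def: "\<And>k. y k = P k (x k) (\<gamma> k)"
    and x_Suc: "\<And>k. x (Suc k) = x k + lam k *\<^sub>R (y k - x k)"
    and \<gamma>: "\<And>k. 0 < \<gamma> k" "\<And>k. \<gamma> k \<le> \<gamma>max"
    and lam: "\<And>k. 0 < lam k" "\<And>k. lam k \<le> 1"
    and \<delta>: "0 < \<delta>" "\<delta> < 1" and \<theta>: "0 < \<theta>" "\<theta> < 1"
    and sufficient_decrease: "\<And>k. f (x (Suc k)) + g (x (Suc k)) - (f (x k) + g (x k))
          \<le> (1 - \<delta>) * lam k * (g (y k) - g (x k) + (y k - x k) \<bullet> G (x k))"
    and parameters: "(\<exists>c>0. \<forall>k. c \<le> lam k)
            \<and> (\<forall>k. \<gamma> k = \<gamma>max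
                  \<or> line_search_failure G (\<delta> * \<nu>) (x k) (P k (x k) (\<gamma> k / \<theta>)) (\<gamma> k / \<theta>) (lam k))
        \<or> (\<exists>c>0. \<forall>k. c \<le> \<gamma> k)
            \<and> (\<exists>l. 0 < l \<and> l \<le> 1 \<and> (\<forall>k. lam k = l \<or> lam k / \<theta> \<le> l
                  \<and> line_search_failure G (\<delta> * \<nu>) (x k) (y k) (\<gamma> k) (lam k / \<theta>)))"
begin

lemmas \<nu> = equivalent_scalar_product.pos[OF metric]
lemmas B_lower = equivalent_scalar_product.lower[OF metric]
  and B_nonneg = equivalent_scalar_product.nonneg[OF metric]
  and B_algebra = equivalent_scalar_product.algebra(1)[OF metric] equivalent_scalar_product.algebra(2)[OF metric]
     equivalent_scalar_product.algebra(3)[OF metric] equivalent_scalar_product.algebra(4)[OF metric]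
     equivalent_scalar_product.algebra(5)[OF metric] equivalent_scalar_product.algebra(6)[OF metric]
     equivalent_scalar_product.algebra(7)[OF metric] equivalent_scalar_product.algebra(8)[OF metric]
  and B_commute = equivalent_scalar_product.commute[OF metric]

lemma \<mu>: "0 < \<mu>" using \<nu> \<nu>_le_\<mu> by (rule less_le_trans)

lemma \<gamma>max: "0 < \<gamma>max" using \<gamma>(1)[of 0] \<gamma>(2)[of 0] by linarith

definition F where "F z = f z + g z"

definition \<Delta> where "\<Delta> k = g (x k) - g (y k) - (y k - x k) \<bullet> G (x k)"

lemma y_mem: "y k \<in> D"
  unfolding y_def by (rule P_mem[OF \<gamma>(1)])

lemma x_mem: "x k \<in> D"
proof (induction k)
  case (Suc k)
  then show ?case unfolding x_Suc using segment(1)[OF _ y_mem] lam less_imp_le by blast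
qed (rule x0)

lemma y_variational:
  "w \<in> D \<Longrightarrow> g (y k) + B k (w - y k) (x k - y k) / \<gamma> k \<le> g w + (w - y k) \<bullet> G (x k)"
  unfolding y_def by (rule P_variational[OF \<gamma>(1)])

lemma \<Delta>_lower: "B k (y k - x k) (y k - x k) / \<gamma> k \<le> \<Delta> k"
  using y_variational[OF x_mem, of k k]
  by (simp add: \<Delta>_def B_algebra inner_diff_left algebra_simps)

lemma norm_le_\<Delta>: "(norm (y k - x k))\<^sup>2 / \<gamma> k \<le> \<Delta> k / \<nu>"
proof -
  have "\<nu> * (norm (y k - x k))\<^sup>2 / \<gamma> k \<le> B k (y k - x k) (y k - x k) / \<gamma> k"
    using B_lower \<gamma>(1)[of k] by (intro divide_right_mono) auto
  then show ?thesis using \<Delta>_lower[of k] \<nu> by (simp add: field_simps)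
qed

lemma \<Delta>_nonneg: "0 \<le> \<Delta> k"
  by (rule order_trans[OF _ \<Delta>_lower]) (use B_nonneg \<gamma>(1)[of k] in simp)

lemma F_decrease: "(1 - \<delta>) * (lam k * \<Delta> k) \<le> F (x k) - F (x (Suc k))"
  using sufficient_decrease[of k] by (simp add: F_def \<Delta>_def algebra_simps)

lemma decseq_F: "decseq (\<lambda>k. F (x k))"
proof (rule decseq_SucI)
  fix k
  have "0 \<le> (1 - \<delta>) * (lam k * \<Delta> k)" using \<delta> lam(1)[of k] \<Delta>_nonneg by simp
  then show "F (x (Suc k)) \<le> F (x k)" using F_decrease[of k] by linarith
qed

lemma summable_\<Delta>:
  assumes "\<And>k. m \<le> F (x k)"
  shows "summable (\<lambda>k. lam k * \<Delta> k)"
proof (rule summableI_nonneg_bounded)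
  show "0 \<le> lam k * \<Delta> k" for k using lam(1)[of k] \<Delta>_nonneg by simp
  fix n
  have "(1 - \<delta>) * (\<Sum>k<n. lam k * \<Delta> k) \<le> (\<Sum>k<n. F (x k) - F (x (Suc k)))"
    unfolding sum_distrib_left by (rule sum_mono) (rule F_decrease)
  also have "\<dots> = F (x 0) - F (x n)" by (rule sum_lessThan_telescope')
  also have "\<dots> \<le> F (x 0) - m" using assms by simp
  finally show "(\<Sum>k<n. lam k * \<Delta> k) \<le> (F (x 0) - m) / (1 - \<delta>)"
    using \<delta> by (simp add: field_simps)
qed

lemma summable_steps:
  assumes "\<And>k. m \<le> F (x k)"
  shows "summable (\<lambda>k. (norm (x (Suc k) - x k))\<^sup>2)"
proof (rule summable_comparison_test_ev)
  show "summable (\<lambda>k. \<gamma>max / \<nu> * (lam k * \<Delta> k))"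
    using summable_\<Delta>[OF assms] by (rule summable_mult)
  have "(norm (x (Suc k) - x k))\<^sup>2 \<le> \<gamma>max / \<nu> * (lam k * \<Delta> k)" for k
  proof -
    have "(norm (x (Suc k) - x k))\<^sup>2 = lam k * lam k * (norm (y k - x k))\<^sup>2"
      using lam(1)[of k] by (simp add: x_Suc power_mult_distrib power2_eq_square[of "lam k"])
    also have "\<dots> \<le> lam k * 1 * (\<gamma>max * (\<Delta> k / \<nu>))"
    proof (rule mult_mono)
      have "(norm (y k - x k))\<^sup>2 \<le> \<gamma> k * (\<Delta> k / \<nu>)"
        using norm_le_\<Delta>[of k] \<gamma>(1)[of k] by (simp add: field_simps)
      also have "\<dots> \<le> \<gamma>max * (\<Delta> k / \<nu>)" using \<gamma>(2) \<Delta>_nonneg \<nu> by (intro mult_right_mono) auto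
      finally show "(norm (y k - x k))\<^sup>2 \<le> \<gamma>max * (\<Delta> k / \<nu>)" .
    qed (use lam[of k] in \<open>auto intro: mult_left_le\<close>)
    finally show ?thesis by (simp add: mult_ac)
  qed
  then show "\<forall>\<^sub>F k in sequentially. norm ((norm (x (Suc k) - x k))\<^sup>2) \<le> \<gamma>max / \<nu> * (lam k * \<Delta> k)"
    by simp
qed

text \<open>Expanding the square leaves a cross term, bounded by the variational inequality at
  \<open>y k\<close> tested at \<open>z\<close> and the subgradient inequality of \<open>f\<close>
  at \<open>x k\<close>. What remains is the gap in values and a multiple of
  \<open>lam k * \<Delta> k\<close>, which is summable when the values are bounded below.\<close>

lemma Fejer_inequality:
  assumes z: "z \<in> D"
  shows "B k (x (Suc k) - z) (x (Suc k) - z)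
    \<le> B k (x k - z) (x k - z) + (2 * \<gamma> k * lam k * (F z - F (x k)) + 2 * \<gamma> k * (lam k * \<Delta> k))"
proof -
  let ?X = "B k (x k - z) (x k - z)" and ?Y = "B k (y k - x k) (y k - x k)" and ?Z = "B k (y k - x k) (x k - z)"
  have "B k (x (Suc k) - z) (x (Suc k) - z) = ?X + 2 * lam k * ?Z + (lam k)\<^sup>2 * ?Y"
  proof -
    have e: "x (Suc k) - z = lam k *\<^sub>R (y k - x k) + (x k - z)" by (simp add: x_Suc)
    show ?thesis unfolding e equivalent_scalar_product.sq_add[OF metric]
      by (simp only: B_algebra(7,8)) (simp add: power2_eq_square)
  qed
  moreover have "B k (z - y k) (x k - y k) = ?Z + ?Y"
  proof -
    have e: "z - y k = - ((y k - x k) + (x k - z))" "x k - y k = - (y k - x k)" by simp_all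
    show ?thesis unfolding e by (simp only: B_algebra(5,6,1)) (simp add: B_commute[of k "x k - z" "y k - x k"])
  qed
  moreover have "(?Z + ?Y) / \<gamma> k \<le> F z - F (x k) + \<Delta> k"
    using y_variational[OF z, of k] subgradient[OF x_mem z, of k] calculation(2)
    by (simp add: F_def \<Delta>_def inner_diff_left)
  then have "lam k * (?Z + ?Y) \<le> lam k * (\<gamma> k * (F z - F (x k) + \<Delta> k))"
    using \<gamma>(1)[of k] lam(1)[of k] by (intro mult_left_mono) (auto simp: pos_divide_le_eq mult.commute)
  \<comment> \<open>The relaxed step costs \<open>?Y\<close> times the square of
    \<open>lam k\<close>; the variational inequality supplies twice \<open>lam k * ?Y\<close> to pay
    for it.\<close>
  moreover have "(lam k)\<^sup>2 * ?Y \<le> lam k * ?Y"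
    using lam[of k] B_nonneg by (intro mult_right_mono) (auto simp: power2_eq_square mult_left_le)
  moreover have "0 \<le> lam k * ?Y" using lam(1)[of k] B_nonneg by simp
  ultimately show ?thesis by (simp add: algebra_simps)
qed

text \<open>Adding the variational inequalities at the two points cancels \<open>g\<close> and the
  gradient, and Cauchy-Schwarz gives \<open>(a - b) * (a / s - b / t) \<le> 0\<close> for the two
  step lengths; the signs follow. This compares an accepted step with the trial rejected before
  it.\<close>

lemma step_length_mono:
  assumes t: "0 < s" "s \<le> t"
  shows "ipnorm (B k) (P k z s - z) \<le> ipnorm (B k) (P k z t - z)"
    and "ipnorm (B k) (P k z t - z) / t \<le> ipnorm (B k) (P k z s - z) / s"
proof -
  interpret B: equivalent_scalar_product "B k" \<nu> \<mu> by (rule metric)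
  define a b where "a = P k z s - z" and "b = P k z t - z"
  have t0: "0 < t" using t by linarith
  have "B k (P k z t - P k z s) (z - P k z s) / s + B k (P k z s - P k z t) (z - P k z t) / t \<le> 0"
    using P_variational[OF t(1) P_mem[OF t0], of k z k z] P_variational[OF t0 P_mem[OF t(1)], of k z k z]
    by (simp add: inner_diff_left)
  moreover have "P k z t - P k z s = b - a" "z - P k z s = - a" "P k z s - P k z t = a - b" "z - P k z t = - b"
    by (simp_all add: a_def b_def)
  ultimately have "B k a a / s + B k b b / t \<le> B k a b * (1 / s + 1 / t)"
    by (simp add: B.algebra B.commute[of b a] diff_divide_distrib algebra_simps)
  also have "\<dots> \<le> ipnorm (B k) a * ipnorm (B k) b * (1 / s + 1 / t)"
    using B.Cauchy_Schwarz[of a b] t t0 by (intro mult_right_mono) auto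
  finally have *: "(ipnorm (B k) a - ipnorm (B k) b) * (ipnorm (B k) a / s - ipnorm (B k) b / t) \<le> 0"
    unfolding B.ipnorm_power2[symmetric] by (simp add: power2_eq_square algebra_simps)
  have b0: "0 \<le> ipnorm (B k) b" "0 \<le> ipnorm (B k) a" by (rule B.ipnorm_nonneg)+
  have "1 / t \<le> 1 / s" using t by (simp add: frac_le)
  then have bt: "ipnorm (B k) b / t \<le> ipnorm (B k) b / s"
    using b0 by (simp add: divide_inverse mult_left_mono)
  have le: "ipnorm (B k) a \<le> ipnorm (B k) b"
  proof (rule ccontr)
    assume "\<not> ?thesis"
    then have ab: "ipnorm (B k) b < ipnorm (B k) a" by simp
    then have "ipnorm (B k) b / s < ipnorm (B k) a / s" using t by (simp add: divide_strict_right_mono)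
    with bt have "0 < ipnorm (B k) a / s - ipnorm (B k) b / t" by linarith
    with ab have "0 < (ipnorm (B k) a - ipnorm (B k) b) * (ipnorm (B k) a / s - ipnorm (B k) b / t)" by simp
    with * show False by simp
  qed
  then show "ipnorm (B k) (P k z s - z) \<le> ipnorm (B k) (P k z t - z)" by (simp add: a_def b_def)
  have "ipnorm (B k) b / t \<le> ipnorm (B k) a / s"
  proof (cases "ipnorm (B k) a = ipnorm (B k) b")
    case True then show ?thesis using bt by simp
  next
    case False
    with le have "ipnorm (B k) a - ipnorm (B k) b < 0" by simp
    with * show ?thesis by (simp add: mult_le_0_iff)
  qed
  then show "ipnorm (B k) (P k z t - z) / t \<le> ipnorm (B k) (P k z s - z) / s" by (simp add: a_def b_def)
qed

lemmas norm_equivalence = equivalent_scalar_product.norm_equivalence[OF metric]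

text \<open>\<open>\<kappa>\<close> is the price of replacing the norm of the current metric by the
  ambient norm, in which the gradient is controlled.\<close>

lemma norm_step_mono:
  assumes t: "0 < s" "s \<le> t"
  defines "\<kappa> \<equiv> sqrt (\<mu> / \<nu>)"
  shows "norm (P k z s - z) \<le> \<kappa> * norm (P k z t - z)"
    and "norm (P k z t - z) / t \<le> \<kappa> * norm (P k z s - z) / s"
proof -
  have s\<nu>: "0 < sqrt \<nu>" using \<nu> by simp
  have "sqrt \<nu> * norm (P k z s - z) \<le> sqrt \<mu> * norm (P k z t - z)"
    using step_length_mono(1)[OF t, of k z] norm_equivalence(1)[of "P k z s - z" k]
      norm_equivalence(2)[of k "P k z t - z"] by linarith
  then show "norm (P k z s - z) \<le> \<kappa> * norm (P k z t - z)"
    using s\<nu> by (simp add: \<kappa>_def real_sqrt_divide field_simps)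
  have "sqrt \<nu> * norm (P k z t - z) / t \<le> ipnorm (B k) (P k z t - z) / t"
    using norm_equivalence(1) t by (intro divide_right_mono) auto
  also have "\<dots> \<le> ipnorm (B k) (P k z s - z) / s" by (rule step_length_mono(2)[OF t])
  also have "\<dots> \<le> sqrt \<mu> * norm (P k z s - z) / s"
    using norm_equivalence(2) t by (intro divide_right_mono) auto
  finally have "sqrt \<nu> * (norm (P k z t - z) / t) \<le> sqrt \<nu> * (\<kappa> * norm (P k z s - z) / s)"
    using s\<nu> by (simp add: \<kappa>_def real_sqrt_divide)
  then show "norm (P k z t - z) / t \<le> \<kappa> * norm (P k z s - z) / s" using s\<nu> by (simp only: mult_le_cancel_left_pos)
qed

end

section \<open>Vanishing steps and weak cluster points along bounded parts of the sequence\<close>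

context fb_sequence
begin

text \<open>The set \<open>K\<close> also contains the trial points rejected by the line search; this is what lets the
  uniform continuity of the gradient contradict a rejection.\<close>

lemma bounded_iterates_compact:
  assumes bdd: "\<forall>\<^sub>F k in E. norm (x k) \<le> R"
  obtains K r where "compactin weak_topology K" "convex K" "K \<subseteq> D" "0 < r"
    "\<forall>\<^sub>F k in E. x k \<in> K \<and> y k \<in> K \<and> norm (y k - x k) \<le> r \<and>
       (\<forall>t>0. norm (P k (x k) t - x k) \<le> sqrt (\<mu> / \<nu>) / \<theta> * norm (y k - x k) \<longrightarrow> P k (x k) t \<in> K)"
proof -
  \<comment> \<open>Bounds \<open>g (x k)\<close>: the values \<open>F (x k)\<close> do not exceed
    the initial one, and \<open>f\<close> is bounded below on the ball by its affine minorant at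
    \<open>x 0\<close>.\<close>
  define M where "M = F (x 0) - f (x 0) + (R + norm (x 0)) * norm (G (x 0))"
  define K0 where "K0 = {z \<in> D. g z \<le> M} \<inter> cball 0 R"
  have M: "g (x k) \<le> M" if "norm (x k) \<le> R" for k
  proof -
    have "F (x k) \<le> F (x 0)" using decseqD[OF decseq_F, of 0 k] by simp
    moreover have "f (x 0) + (x k - x 0) \<bullet> G (x 0) \<le> f (x k)" by (rule subgradient[OF x0 x_mem])
    moreover have "- ((x k - x 0) \<bullet> G (x 0)) \<le> norm (x k - x 0) * norm (G (x 0))"
      using Cauchy_Schwarz_ineq2[of "x k - x 0" "G (x 0)"] by (simp add: abs_le_iff)
    moreover have "norm (x k - x 0) * norm (G (x 0)) \<le> (R + norm (x 0)) * norm (G (x 0))"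
      using norm_triangle_ineq4[of "x k" "x 0"] that by (intro mult_right_mono) auto
    ultimately show ?thesis unfolding F_def M_def by linarith
  qed
  have "uniformly_continuous_on K0 G"
    unfolding K0_def by (rule uniform[OF sublevel_cball_compactin_weak]) (use closed_convex_function_axioms in auto)
  moreover have "convex K0" unfolding K0_def by (rule convex_sublevel_cball)
  moreover have "K0 \<subseteq> cball 0 R" by (simp add: K0_def)
  ultimately obtain c where c: "0 \<le> c" "\<And>z. z \<in> K0 \<Longrightarrow> norm (G z) \<le> c"
    using uniformly_continuous_on_convex_bounded by blast
  have Gx: "norm (G (x k)) \<le> c" if "norm (x k) \<le> R" for k
    using that x_mem M by (intro c) (auto simp: K0_def)
  obtain a b where ab: "0 \<le> b" "\<And>z. z \<in> D \<Longrightarrow> a - b * norm z \<le> g z"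
    using conical_minorant by blast
  \<comment> \<open>By the conical minorant of \<open>g\<close>, \<open>\<Delta> k\<close> is at
    most \<open>q\<close> times the step length once this exceeds 1, whereas it is at least
    \<open>\<nu> / \<gamma>max\<close> times its square. Hence the bound \<open>r\<close>; the
    summand 1 covers the short steps.\<close>
  define q where "q = \<bar>M - a + b * R\<bar> + (b + c)"
  define r where "r = 1 + q * \<gamma>max / \<nu>"
  have q: "0 \<le> q" using ab(1) c(1) by (simp add: q_def)
  have r: "0 < r" using q \<gamma>max \<nu> by (simp add: r_def add_pos_nonneg)
  have yx: "norm (y k - x k) \<le> r" if k: "norm (x k) \<le> R" for k
  proof (cases "norm (y k - x k) \<le> 1")
    case True
    then show ?thesis using q \<gamma>max \<nu> by (simp add: r_def add_increasing2)
  next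
    case False
    define s where "s = norm (y k - x k)"
    have s: "1 < s" using False by (simp add: s_def)
    have "\<Delta> k = g (x k) - g (y k) - (y k - x k) \<bullet> G (x k)" by (simp add: \<Delta>_def)
    moreover have "- ((y k - x k) \<bullet> G (x k)) \<le> s * c"
      using Cauchy_Schwarz_ineq2[of "y k - x k" "G (x k)"] mult_left_mono[OF Gx[OF k], of s]
      by (simp add: abs_le_iff s_def)
    moreover have "b * norm (y k) \<le> b * (R + s)"
      using norm_triangle_sub[of "y k" "x k"] k ab(1) by (intro mult_left_mono) (auto simp: s_def)
    ultimately have "\<Delta> k \<le> (M - a + b * R) + (b + c) * s"
      using M[OF k] ab(2)[OF y_mem, of k] by (simp add: algebra_simps)
    also have "\<dots> \<le> \<bar>M - a + b * R\<bar> * s + (b + c) * s"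
      using s mult_left_mono[of 1 s "\<bar>M - a + b * R\<bar>"] by simp
    finally have "\<Delta> k \<le> q * s" by (simp add: q_def algebra_simps)
    have "s\<^sup>2 \<le> \<gamma> k * (\<Delta> k / \<nu>)"
      using norm_le_\<Delta>[of k] \<gamma>(1)[of k] by (simp add: field_simps s_def)
    also have "\<dots> \<le> \<gamma>max * (q * s / \<nu>)"
      by (rule mult_mono) (use \<gamma> \<gamma>max \<Delta>_nonneg \<nu> \<open>\<Delta> k \<le> q * s\<close> in \<open>auto intro: divide_right_mono less_imp_le\<close>)
    finally have "s * s \<le> (q * \<gamma>max / \<nu>) * s" by (simp add: power2_eq_square mult_ac)
    then have "s \<le> q * \<gamma>max / \<nu>" using s by (simp only: mult_le_cancel_right_pos)
    then show ?thesis by (simp add: r_def s_def)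
  qed
  \<comment> \<open>The second summand makes room for trial points: with step size
    \<open>\<gamma> k / \<theta>\<close> the trial moves at most
    \<open>sqrt (\<mu> / \<nu>) / \<theta>\<close> times as far as the accepted step.\<close>
  define r' where "r' = r + sqrt (\<mu> / \<nu>) / \<theta> * r"
  define K where "K = {z \<in> D. g z \<le> M + r' * c} \<inter> cball 0 (R + r')"
  have r': "0 \<le> r'" "r \<le> r'" "sqrt (\<mu> / \<nu>) / \<theta> * r \<le> r'" using r \<mu> \<nu> \<theta> by (auto simp: r'_def)
  have near: "P k (x k) t \<in> K" if k: "norm (x k) \<le> R" and t: "0 < t" and n: "norm (P k (x k) t - x k) \<le> r'" for k t
  proof -
    let ?p = "P k (x k) t"
    have "g ?p + B k (x k - ?p) (x k - ?p) / t \<le> g (x k) + (x k - ?p) \<bullet> G (x k)"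
      by (rule P_variational[OF t x_mem])
    moreover have "0 \<le> B k (x k - ?p) (x k - ?p) / t" using B_nonneg t by simp
    moreover have "(x k - ?p) \<bullet> G (x k) \<le> norm (x k - ?p) * norm (G (x k))" by (rule norm_cauchy_schwarz)
    moreover have "norm (x k - ?p) * norm (G (x k)) \<le> r' * c"
      by (rule mult_mono) (use n Gx[OF k] r' in \<open>auto simp: norm_minus_commute\<close>)
    ultimately have "g ?p \<le> M + r' * c" using M[OF k] by linarith
    moreover have "norm ?p \<le> R + r'" using norm_triangle_sub[of ?p "x k"] k n by linarith
    ultimately show ?thesis using P_mem[OF t] by (simp add: K_def)
  qed
  have all: "x k \<in> K \<and> y k \<in> K \<and> norm (y k - x k) \<le> r \<and>
       (\<forall>t>0. norm (P k (x k) t - x k) \<le> sqrt (\<mu> / \<nu>) / \<theta> * norm (y k - x k) \<longrightarrow> P k (x k) t \<in> K)"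
    if k: "norm (x k) \<le> R" for k
  proof (intro conjI allI impI)
    have "0 \<le> r' * c" using r' c by simp
    then show "x k \<in> K" using M[OF k] k r'(1) x_mem by (simp add: K_def)
    show "norm (y k - x k) \<le> r" by (rule yx[OF k])
    then show "y k \<in> K" unfolding y_def by (intro near k \<gamma>(1)) (use r'(2) in simp)
    fix t :: real assume t: "0 < t" and "norm (P k (x k) t - x k) \<le> sqrt (\<mu> / \<nu>) / \<theta> * norm (y k - x k)"
    moreover have "sqrt (\<mu> / \<nu>) / \<theta> * norm (y k - x k) \<le> sqrt (\<mu> / \<nu>) / \<theta> * r"
      using \<mu> \<nu> \<theta> yx[OF k] by (intro mult_left_mono) auto
    ultimately show "P k (x k) t \<in> K" using r'(3) by (intro near k t) linarith
  qed
  show ?thesis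
  proof (rule that[of K r])
    show "compactin weak_topology K"
      unfolding K_def by (rule sublevel_cball_compactin_weak) (rule closed_convex_function_axioms)
    show "convex K" unfolding K_def by (rule convex_sublevel_cball)
    show "K \<subseteq> D" by (auto simp: K_def)
    show "\<forall>\<^sub>F k in E. x k \<in> K \<and> y k \<in> K \<and> norm (y k - x k) \<le> r \<and>
       (\<forall>t>0. norm (P k (x k) t - x k) \<le> sqrt (\<mu> / \<nu>) / \<theta> * norm (y k - x k) \<longrightarrow> P k (x k) t \<in> K)"
      using bdd by (rule eventually_mono) (rule all)
  qed (rule r)
qed

lemma scaled_steps_small:
  assumes E: "E \<le> sequentially" and m: "\<And>k. m \<le> F (x k)" and e: "0 < e"
  shows "\<forall>\<^sub>F k in E. lam k * ((norm (y k - x k))\<^sup>2 / \<gamma> k) < e"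
proof -
  have "(\<lambda>k. lam k * \<Delta> k) \<longlonglongrightarrow> 0" by (rule summable_LIMSEQ_zero[OF summable_\<Delta>[OF m]])
  then have "\<forall>\<^sub>F k in sequentially. lam k * \<Delta> k < e * \<nu>"
    by (rule order_tendstoD) (use e \<nu> in simp)
  then have "\<forall>\<^sub>F k in E. lam k * \<Delta> k < e * \<nu>" by (rule filter_leD[OF E])
  then show ?thesis
  proof eventually_elim
    case (elim k)
    have "lam k * ((norm (y k - x k))\<^sup>2 / \<gamma> k) \<le> lam k * (\<Delta> k / \<nu>)"
      using norm_le_\<Delta> lam(1)[of k] by (intro mult_left_mono) auto
    also have "\<dots> < e" using elim \<nu> by (simp add: field_simps)
    finally show ?case .
  qed
qed

text \<open>Summability only makes \<open>lam k * ((norm (y k - x k))\<^sup>2 / \<gamma> k)\<close>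
  small. If step sizes are backtracked, the steps are then short, so the gradient hardly varies up
  to the rejected trial, and rejection makes the quotient small. If the relaxation is backtracked, a
  step that stays long forces \<open>lam k\<close> to be small, and the rejection of
  \<open>lam k / \<theta>\<close> contradicts uniform continuity.\<close>

lemma steps_vanish:
  assumes E: "E \<le> sequentially" and m: "\<And>k. m \<le> F (x k)"
    and bdd: "\<forall>\<^sub>F k in E. norm (x k) \<le> R"
  shows "((\<lambda>k. norm (y k - x k) / \<gamma> k) \<longlongrightarrow> 0) E"
proof -
  obtain K r where K: "compactin weak_topology K" "convex K" "K \<subseteq> D" and r: "0 < r" and ev:
    "\<forall>\<^sub>F k in E. x k \<in> K \<and> y k \<in> K \<and> norm (y k - x k) \<le> r \<and>
       (\<forall>t>0. norm (P k (x k) t - x k) \<le> sqrt (\<mu> / \<nu>) / \<theta> * norm (y k - x k) \<longrightarrow> P k (x k) t \<in> K)"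
    by (rule bounded_iterates_compact[OF bdd])
  define \<kappa> where "\<kappa> = sqrt (\<mu> / \<nu>)"
  have \<kappa>: "0 < \<kappa>" using \<mu> \<nu> by (simp add: \<kappa>_def)
  have uc: "\<exists>d>0. \<forall>z\<in>K. \<forall>w\<in>K. norm (w - z) < d \<longrightarrow> norm (G w - G z) < e" if "0 < e" for e
    using uniform[OF K(1,3)] that unfolding uniformly_continuous_on_def dist_norm by blast
  have seg: "z + t *\<^sub>R (w - z) \<in> K" if "z \<in> K" "w \<in> K" "0 \<le> t" "t \<le> 1" for z w t
  proof -
    have "z + t *\<^sub>R (w - z) = (1 - t) *\<^sub>R z + t *\<^sub>R w" by (simp add: algebra_simps)
    then show ?thesis using K(2) that by (auto intro!: convexD)
  qed
  have "\<forall>\<^sub>F k in E. norm (y k - x k) / \<gamma> k < e" if e: "0 < e" for e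
    using parameters
  proof (elim disjE conjE exE)
    fix c assume c: "0 < c" "\<forall>k. c \<le> lam k"
    assume fail: "\<forall>k. \<gamma> k = \<gamma>max
        \<or> line_search_failure G (\<delta> * \<nu>) (x k) (P k (x k) (\<gamma> k / \<theta>)) (\<gamma> k / \<theta>) (lam k)"
    \<comment> \<open>Chosen because \<open>norm (y k - x k) / \<gamma> k\<close> is at most
      \<open>\<kappa> / \<theta>\<close> times the corresponding quotient of the rejected
      trial.\<close>
    have "0 < \<delta> * \<nu> * (\<theta> * e / \<kappa>)" using \<delta> \<nu> \<theta> e \<kappa> by simp
    then obtain d where d: "0 < d" "\<And>z w. z \<in> K \<Longrightarrow> w \<in> K \<Longrightarrow> norm (w - z) < d \<Longrightarrow>
        norm (G w - G z) < \<delta> * \<nu> * (\<theta> * e / \<kappa>)"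
      using uc by meson
    \<comment> \<open>The first bound brings the rejected trial point within \<open>d\<close> of
      \<open>x k\<close>; the second settles the case
      \<open>\<gamma> k = \<gamma>max\<close>.\<close>
    define s where "s = min (\<theta> * d / \<kappa>) (e * \<gamma>max)"
    have s: "0 < s" using \<theta> d \<kappa> e \<gamma>max by (simp add: s_def)
    have "0 < s\<^sup>2 * c / \<gamma>max" using s c \<gamma>max by simp
    from scaled_steps_small[OF E m this] ev
    show ?thesis
    proof eventually_elim
      case (elim k)
      define n where "n = norm (y k - x k)"
      have "c * (n\<^sup>2 / \<gamma>max) \<le> lam k * (n\<^sup>2 / \<gamma> k)"
        using c \<gamma> \<gamma>max lam(1)[of k] by (intro mult_mono divide_left_mono) auto
      also have "\<dots> < s\<^sup>2 * c / \<gamma>max" using elim(1) by (simp add: n_def)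
      finally have "n\<^sup>2 < s\<^sup>2" using c \<gamma>max by (simp add: field_simps)
      then have n: "n < s" using s by (simp add: power_less_imp_less_base)
      show ?case
      proof (cases "\<gamma> k = \<gamma>max")
        case True
        then show ?thesis using n \<gamma>max by (simp add: s_def n_def field_simps)
      next
        case False
        define t where "t = \<gamma> k / \<theta>"
        have t: "0 < t" "\<gamma> k \<le> t" using \<gamma>(1)[of k] \<theta> by (simp_all add: t_def field_simps)
        define p where "p = P k (x k) t"
        have pn: "norm (p - x k) \<le> \<kappa> / \<theta> * n"
        proof -
          have "norm (p - x k) / t \<le> \<kappa> * n / \<gamma> k"
            unfolding p_def n_def \<kappa>_def y_def by (rule norm_step_mono(2)[OF \<gamma>(1) t(2)])
          then have "norm (p - x k) \<le> \<kappa> * n / \<gamma> k * t" using t(1) by (simp add: pos_divide_le_eq)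
          also have "\<dots> = \<kappa> / \<theta> * n" using \<gamma>(1)[of k] by (simp add: t_def)
          finally show ?thesis .
        qed
        then have pK: "p \<in> K" using elim(2) t(1) by (simp add: p_def \<kappa>_def n_def)
        have "norm (x k + lam k *\<^sub>R (p - x k) - x k) \<le> 1 * norm (p - x k)"
          using lam[of k] mult_right_mono[of "lam k" 1 "norm (p - x k)"] by simp
        also have "\<dots> < d"
        proof -
          have "\<kappa> / \<theta> * n < \<kappa> / \<theta> * (\<theta> * d / \<kappa>)"
            using n \<kappa> \<theta> by (intro mult_strict_left_mono) (auto simp: s_def)
          then show ?thesis using pn \<kappa> \<theta> by simp
        qed
        finally have "norm (G (x k + lam k *\<^sub>R (p - x k)) - G (x k)) < \<delta> * \<nu> * (\<theta> * e / \<kappa>)"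
          using elim(2) lam[of k] pK by (intro d seg) auto
        moreover have "\<delta> * \<nu> * norm (p - x k) / t \<le> norm (G (x k + lam k *\<^sub>R (p - x k)) - G (x k))"
          using fail False by (auto simp: line_search_failure_def p_def t_def)
        ultimately have "\<delta> * \<nu> * (norm (p - x k) / t) < \<delta> * \<nu> * (\<theta> * e / \<kappa>)" by simp
        then have pt: "norm (p - x k) / t < \<theta> * e / \<kappa>" using \<delta> \<nu> by (simp only: mult_less_cancel_left_pos mult_pos_pos)
        have "n / \<gamma> k \<le> \<kappa> * norm (p - x k) / \<gamma> k"
          unfolding p_def n_def \<kappa>_def y_def
          by (rule divide_right_mono[OF norm_step_mono(1)[OF \<gamma>(1) t(2)]]) (use \<gamma>(1)[of k] in simp)
        also have "\<dots> = \<kappa> / \<theta> * (norm (p - x k) / t)" using \<theta> by (simp add: t_def)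
        also have "\<dots> < \<kappa> / \<theta> * (\<theta> * e / \<kappa>)" using pt \<kappa> \<theta> by (intro mult_strict_left_mono) auto
        also have "\<dots> = e" using \<kappa> \<theta> by simp
        finally show ?thesis by (simp add: n_def)
      qed
    qed
  next
    fix c l :: real assume c: "0 < c" "\<forall>k. c \<le> \<gamma> k" and l: "0 < l" "l \<le> 1"
    assume fail: "\<forall>k. lam k = l \<or> lam k / \<theta> \<le> l
        \<and> line_search_failure G (\<delta> * \<nu>) (x k) (y k) (\<gamma> k) (lam k / \<theta>)"
    \<comment> \<open>As \<open>c \<le> \<gamma> k\<close>, steps shorter than \<open>c * e\<close>
      are enough.\<close>
    define e' where "e' = c * e"
    have e': "0 < e'" using c e by (simp add: e'_def)
    have "0 < \<delta> * \<nu> * (e' / \<gamma>max)" using \<delta> \<nu> e' \<gamma>max by simp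
    then obtain d where d: "0 < d" "\<And>z w. z \<in> K \<Longrightarrow> w \<in> K \<Longrightarrow> norm (w - z) < d \<Longrightarrow>
        norm (G w - G z) < \<delta> * \<nu> * (e' / \<gamma>max)"
      using uc by meson
    \<comment> \<open>\<open>lam k < l\<close> means that backtracking took place, so a rejected
      trial exists; the second bound keeps that trial within \<open>d\<close> of
      \<open>x k\<close>.\<close>
    define s where "s = min l (\<theta> * d / r)"
    have s: "0 < s" using l \<theta> d r by (simp add: s_def)
    have "0 < s * (e'\<^sup>2 / \<gamma>max)" using s e' \<gamma>max by simp
    from scaled_steps_small[OF E m this] ev
    show ?thesis
    proof eventually_elim
      case (elim k)
      define n where "n = norm (y k - x k)"
      have "n < e'"
      proof (rule ccontr)
        assume "\<not> n < e'"
        then have n: "e' \<le> n" by simp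
        have "lam k * (e'\<^sup>2 / \<gamma>max) \<le> lam k * (n\<^sup>2 / \<gamma> k)"
          using n e' \<gamma> \<gamma>max lam(1)[of k] by (intro mult_left_mono frac_le power_mono) auto
        also have "\<dots> < s * (e'\<^sup>2 / \<gamma>max)" using elim(1) by (simp add: n_def)
        finally have ls: "lam k < s" by (rule mult_right_less_imp_less) (use \<gamma>max in simp)
        then have f: "lam k / \<theta> \<le> l" "line_search_failure G (\<delta> * \<nu>) (x k) (y k) (\<gamma> k) (lam k / \<theta>)"
          using fail[rule_format, of k] by (auto simp: s_def)
        have lt: "0 \<le> lam k / \<theta>" "lam k / \<theta> \<le> 1"
          using lam(1)[of k] \<theta>(1) order_trans[OF f(1) l(2)] by simp_all
        have "norm (x k + (lam k / \<theta>) *\<^sub>R (y k - x k) - x k) \<le> lam k / \<theta> * r"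
          using mult_left_mono[OF _ lt(1), of "norm (y k - x k)" r] elim(2) lam(1)[of k] \<theta>(1) by simp
        also have "\<dots> < d"
        proof -
          have "lam k < \<theta> * d / r" using ls by (simp add: s_def)
          then show ?thesis using \<theta> r by (simp add: field_simps)
        qed
        finally have "norm (G (x k + (lam k / \<theta>) *\<^sub>R (y k - x k)) - G (x k)) < \<delta> * \<nu> * (e' / \<gamma>max)"
          using elim(2) lt by (intro d seg) auto
        moreover have "\<delta> * \<nu> * n / \<gamma> k \<le> norm (G (x k + (lam k / \<theta>) *\<^sub>R (y k - x k)) - G (x k))"
          using f(2) by (simp add: line_search_failure_def n_def)
        ultimately have "\<delta> * \<nu> * (n / \<gamma> k) < \<delta> * \<nu> * (e' / \<gamma>max)" by simp
        moreover have "e' / \<gamma>max \<le> n / \<gamma> k" using n e' \<gamma> by (intro frac_le) auto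
        then have "\<delta> * \<nu> * (e' / \<gamma>max) \<le> \<delta> * \<nu> * (n / \<gamma> k)" using \<delta> \<nu> by (intro mult_left_mono) auto
        ultimately show False by simp
      qed
      moreover have "c * e \<le> \<gamma> k * e" using c e by (intro mult_right_mono) auto
      ultimately show ?case using \<gamma>(1)[of k] by (simp add: n_def e'_def pos_divide_less_eq mult.commute)
    qed
  qed
  then show ?thesis
    using \<gamma>(1) by (intro tendstoI) (auto simp: less_imp_le)
qed

text \<open>The subgradient inequality of \<open>f\<close> is taken at \<open>y k\<close> and not at
  \<open>x k\<close>. Added to the variational inequality it leaves two errors: the variation of the
  gradient between \<open>x k\<close> and \<open>y k\<close>, and
  \<open>B k (z - y k) (y k - x k) / \<gamma> k\<close>. Both tend to 0 because the scaled steps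
  do.\<close>

lemma F_y_upper:
  assumes E: "E \<le> sequentially" and m: "\<And>k. m \<le> F (x k)"
    and bdd: "\<forall>\<^sub>F k in E. norm (x k) \<le> R" and z: "z \<in> D" and e: "0 < e"
  shows "\<forall>\<^sub>F k in E. F (y k) < F z + e"
proof -
  obtain K r where K: "compactin weak_topology K" "convex K" "K \<subseteq> D" and r: "0 < r" and ev:
    "\<forall>\<^sub>F k in E. x k \<in> K \<and> y k \<in> K \<and> norm (y k - x k) \<le> r \<and>
       (\<forall>t>0. norm (P k (x k) t - x k) \<le> sqrt (\<mu> / \<nu>) / \<theta> * norm (y k - x k) \<longrightarrow> P k (x k) t \<in> K)"
    by (rule bounded_iterates_compact[OF bdd])
  define M where "M = norm z + \<bar>R\<bar> + r + 1"
  note lim = steps_vanish[OF E m bdd]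
  have M: "0 < M" using r by (simp add: M_def add_nonneg_pos)
  then have "0 < e / (2 * M)" using e by simp
  then obtain d where d: "0 < d" "\<And>z w. z \<in> K \<Longrightarrow> w \<in> K \<Longrightarrow> norm (w - z) < d \<Longrightarrow> norm (G w - G z) < e / (2 * M)"
    using uniform[OF K(1,3)] unfolding uniformly_continuous_on_def dist_norm by meson
  \<comment> \<open>Each of the two bounds holds one of the errors to \<open>e / 2\<close>.\<close>
  define s where "s = min (d / \<gamma>max) (e / (2 * \<mu> * M))"
  have s: "0 < s" using d e \<mu> M \<gamma>max by (simp add: s_def)
  have "\<forall>\<^sub>F k in E. norm (y k - x k) / \<gamma> k < s" by (rule order_tendstoD(2)[OF lim s])
  then show ?thesis using bdd ev
  proof eventually_elim
    case (elim k)
    have "norm (y k - x k) < s * \<gamma> k" using elim(1) \<gamma>(1)[of k] by (simp add: pos_divide_less_eq)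
    also have "\<dots> \<le> s * \<gamma>max" using s \<gamma>(2) by (intro mult_left_mono) auto
    also have "\<dots> \<le> d / \<gamma>max * \<gamma>max" using \<gamma>max by (intro mult_right_mono) (auto simp: s_def)
    also have "\<dots> = d" using \<gamma>max by simp
    finally have "norm (x k - y k) < d" by (simp add: norm_minus_commute)
    then have Gd: "norm (G (x k) - G (y k)) < e / (2 * M)" using elim(3) by (intro d) auto
    have zy: "norm (z - y k) < M"
      using norm_triangle_ineq4[of z "y k"] norm_triangle_sub[of "y k" "x k"] elim(2,3)
        unfolding M_def by linarith
    have "(z - y k) \<bullet> (G (x k) - G (y k)) \<le> norm (z - y k) * norm (G (x k) - G (y k))"
      by (rule norm_cauchy_schwarz)
    also have "\<dots> \<le> M * norm (G (x k) - G (y k))" using zy by (intro mult_right_mono) auto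
    also have "\<dots> < M * (e / (2 * M))" using Gd M by (intro mult_strict_left_mono)
    finally have 1: "(z - y k) \<bullet> (G (x k) - G (y k)) < e / 2" using M by simp
    have "- B k (z - y k) (x k - y k) / \<gamma> k \<le> \<mu> * norm (z - y k) * norm (x k - y k) / \<gamma> k"
      using equivalent_scalar_product.abs_le_norm[OF metric, of k "z - y k" "x k - y k"] \<gamma>(1)[of k]
      by (intro divide_right_mono) (auto simp: abs_le_iff)
    also have "\<dots> = \<mu> * norm (z - y k) * (norm (y k - x k) / \<gamma> k)" by (simp add: norm_minus_commute)
    also have "\<dots> \<le> \<mu> * M * s"
      using elim(1) zy \<mu> M \<gamma>(1)[of k] by (intro mult_mono) auto
    also have "\<dots> \<le> \<mu> * M * (e / (2 * \<mu> * M))" using \<mu> M by (intro mult_left_mono) (auto simp: s_def)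
    also have "\<dots> = e / 2" using \<mu> M by simp
    finally have 2: "- B k (z - y k) (x k - y k) / \<gamma> k \<le> e / 2" .
    show ?case
      using y_variational[OF z, of k] subgradient[OF y_mem z, of k] 1 2
      by (simp add: F_def inner_diff_right)
  qed
qed

lemma norm_step_tendsto_0:
  assumes E: "E \<le> sequentially" and m: "\<And>k. m \<le> F (x k)"
    and bdd: "\<forall>\<^sub>F k in E. norm (x k) \<le> R"
  shows "((\<lambda>k. y k - x k) \<longlongrightarrow> 0) E"
proof (rule Lim_null_comparison)
  show "((\<lambda>k. \<gamma>max * (norm (y k - x k) / \<gamma> k)) \<longlongrightarrow> 0) E"
    using tendsto_mult[OF tendsto_const steps_vanish[OF E m bdd], of \<gamma>max] by simp
  have "norm (y k - x k) \<le> \<gamma>max * (norm (y k - x k) / \<gamma> k)" for k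
  proof -
    have "norm (y k - x k) = \<gamma> k * (norm (y k - x k) / \<gamma> k)" using \<gamma>(1)[of k] by simp
    also have "\<dots> \<le> \<gamma>max * (norm (y k - x k) / \<gamma> k)" using \<gamma>[of k] by (intro mult_right_mono) auto
    finally show ?thesis .
  qed
  then show "\<forall>\<^sub>F k in E. norm (y k - x k) \<le> \<gamma>max * (norm (y k - x k) / \<gamma> k)" by simp
qed

lemma weak_limit_y:
  assumes "((\<lambda>k. y k - x k) \<longlongrightarrow> 0) E" "limitin weak_topology x p E"
  shows "limitin weak_topology y p E"
  unfolding limitin_weak_topology_iff
proof
  fix u
  have "((\<lambda>k. x k \<bullet> u + (y k - x k) \<bullet> u) \<longlongrightarrow> p \<bullet> u + 0 \<bullet> u) E"
    using assms(2)[unfolded limitin_weak_topology_iff, rule_format, of u]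
    by (rule tendsto_add[OF _ tendsto_inner[OF assms(1) tendsto_const]])
  then show "((\<lambda>k. y k \<bullet> u) \<longlongrightarrow> p \<bullet> u) E" by (simp add: inner_diff_left)
qed

text \<open>Values are controlled along \<open>y\<close>, which has the same weak limit as
  \<open>x\<close>. Linearizing \<open>f\<close> at the cluster point turns the bound on
  \<open>F (y k)\<close> into one on \<open>g (y k)\<close>, and the weakly closed sublevel set of
  \<open>g\<close> contains the limit. That \<open>p\<close> lies in \<open>D\<close>, where the
  linearization is available, comes from \<open>K \<subseteq> D\<close>.\<close>

lemma weak_cluster_point_minimizes:
  assumes E: "E \<le> sequentially" "E \<noteq> bot" and m: "\<And>k. m \<le> F (x k)"
    and bdd: "\<forall>\<^sub>F k in E. norm (x k) \<le> R"
  obtains p E' where "p \<in> D" "E' \<le> E" "E' \<noteq> bot" "limitin weak_topology x p E'" "\<And>z. z \<in> D \<Longrightarrow> F p \<le> F z"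
proof -
  obtain K r where K: "compactin weak_topology K" "convex K" "K \<subseteq> D" and r: "0 < r" and ev:
    "\<forall>\<^sub>F k in E. x k \<in> K \<and> y k \<in> K \<and> norm (y k - x k) \<le> r \<and>
       (\<forall>t>0. norm (P k (x k) t - x k) \<le> sqrt (\<mu> / \<nu>) / \<theta> * norm (y k - x k) \<longrightarrow> P k (x k) t \<in> K)"
    by (rule bounded_iterates_compact[OF bdd])
  have "\<forall>\<^sub>F k in E. x k \<in> K" using ev by (rule eventually_mono) simp
  from compactin_cluster_filter[OF K(1) E(2) this]
  obtain p E' where p: "p \<in> K" and E': "E' \<le> E" "E' \<noteq> bot" and lim: "limitin weak_topology x p E'" by blast
  have pD: "p \<in> D" using p K(3) by blast
  have E'': "E' \<le> sequentially" using E'(1) E(1) by (rule order_trans)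
  have bdd': "\<forall>\<^sub>F k in E'. norm (x k) \<le> R" using bdd by (rule filter_leD[OF E'(1)])
  have limy: "limitin weak_topology y p E'"
    by (rule weak_limit_y[OF norm_step_tendsto_0[OF E'' m bdd'] lim])
  have "F p \<le> F z" if z: "z \<in> D" for z
  proof (rule field_le_epsilon)
    fix e :: real assume e: "0 < e"
    define c where "c = F z - f p + e"
    have "((\<lambda>k. y k \<bullet> G p) \<longlongrightarrow> p \<bullet> G p) E'" using limy by (simp add: limitin_weak_topology_iff)
    then have "\<forall>\<^sub>F k in E'. p \<bullet> G p - e / 2 < y k \<bullet> G p" by (rule order_tendstoD) (use e in simp)
    moreover have "\<forall>\<^sub>F k in E'. F (y k) < F z + e / 2" by (rule F_y_upper[OF E'' m bdd' z]) (use e in simp)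
    ultimately have "\<forall>\<^sub>F k in E'. y k \<in> {v \<in> D. g v \<le> c}"
    proof eventually_elim
      case (elim k)
      have "f p + (y k - p) \<bullet> G p \<le> f (y k)" by (rule subgradient[OF pD y_mem])
      then show ?case using elim y_mem by (simp add: F_def c_def inner_diff_left)
    qed
    with limy closed_convex_closedin_weak_topology[OF closed_sublevel convex_sublevel]
    have "p \<in> {v \<in> D. g v \<le> c}" using E'(2) by (rule limitin_closedin)
    then show "F p \<le> F z + e" by (simp add: F_def c_def)
  qed
  then show ?thesis using that pD E' lim by blast
qed

end

text \<open>The block of indices from \<open>n div 2\<close> to \<open>n - 1\<close> has at least
  \<open>n / 2\<close> terms, none below \<open>a n\<close>, and its sum tends to 0 as a difference
  of partial sums.\<close>

lemma decseq_summable_smallo: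
  fixes a :: "nat \<Rightarrow> real"
  assumes dec: "decseq a" and nonneg: "\<And>k. 0 \<le> a k" and sum: "summable a"
  shows "a \<in> o(\<lambda>k. 1 / real k)"
proof (rule smalloI_tendsto)
  have tail: "(\<lambda>n. \<Sum>k<n. a k) \<longlonglongrightarrow> suminf a" by (rule summable_LIMSEQ[OF sum])
  have half: "filterlim (\<lambda>n::nat. n div 2) sequentially sequentially"
    unfolding filterlim_at_top
  proof
    show "\<forall>\<^sub>F n in sequentially. Z \<le> n div 2" for Z :: nat
      using eventually_ge_at_top[of "2 * Z"] by eventually_elim simp
  qed
  have "(\<lambda>n. 2 * ((\<Sum>k<n. a k) - (\<Sum>k<n div 2. a k))) \<longlonglongrightarrow> 2 * (suminf a - suminf a)"
    by (intro tendsto_intros tail filterlim_compose[OF tail half])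
  then have lim: "(\<lambda>n. 2 * ((\<Sum>k<n. a k) - (\<Sum>k<n div 2. a k))) \<longlonglongrightarrow> 0" by simp
  have bound: "real n * a n \<le> 2 * ((\<Sum>k<n. a k) - (\<Sum>k<n div 2. a k))" for n
  proof -
    have "n \<le> 2 * (n - n div 2)" by simp
    then have "real n \<le> 2 * real (n - n div 2)" by linarith
    then have "real n * a n \<le> 2 * real (n - n div 2) * a n" by (rule mult_right_mono[OF _ nonneg])
    also have "\<dots> = 2 * (\<Sum>k\<in>{n div 2..<n}. a n)" by simp
    also have "\<dots> \<le> 2 * (\<Sum>k\<in>{n div 2..<n}. a k)"
      by (intro mult_left_mono sum_mono) (use decseqD[OF dec] in auto)
    also have "(\<Sum>k\<in>{n div 2..<n}. a k) = (\<Sum>k<n. a k) - (\<Sum>k<n div 2. a k)"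
      using sum_diff_nat_ivl[of 0 "n div 2" n a] by (simp add: lessThan_atLeast0)
    finally show ?thesis .
  qed
  have "(\<lambda>n. real n * a n) \<longlonglongrightarrow> 0"
    by (rule tendsto_sandwich[OF _ _ tendsto_const lim])
       (intro always_eventually allI bound mult_nonneg_nonneg nonneg of_nat_0_le_iff)+
  then show "((\<lambda>k. a k / (1 / real k)) \<longlongrightarrow> 0) sequentially" by (simp add: mult.commute)
qed (auto intro: eventually_mono[OF eventually_gt_at_top[of 0]])

text \<open>\<open>transfer\<close> carries the inequality of one iteration from \<open>B k\<close>
  to \<open>C\<close>. Its error term \<open>e\<close> has no fixed sign, so the exact factor
  \<open>s k\<close> is kept on it; the bounds \<open>s1\<close> and \<open>s0\<close> are applied
  later to the positive and negative parts.\<close>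

locale fb_quasi_Fejer = fb_sequence D g f G B \<nu> \<mu> \<delta> \<theta> \<gamma>max P x y \<gamma> lam + C: quasi_decreasing_metrics C \<nu>' \<mu>' \<eta>
  for D :: "'a::{real_inner, complete_space} set" and g f G B \<nu> \<mu> \<delta> \<theta> \<gamma>max P x y \<gamma> lam C \<nu>' \<mu>' \<eta> +
  fixes s :: "nat \<Rightarrow> real" and s0 s1 :: real
  assumes s: "0 < s0" "\<And>k. s0 \<le> s k" "\<And>k. s k \<le> s1"
    and transfer: "\<And>k u v e. B k u u \<le> B k v v + e \<Longrightarrow> C (Suc k) u u \<le> (1 + \<eta> k) * C k v v + s k * e"
begin

text \<open>The condition on \<open>z\<close> compares it with the iterates only, so it can be
  tested on points that are not minimizers; this later rules out a gap in the values when no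
  minimizer exists.\<close>

lemma Fejer_convergence:
  assumes z: "z \<in> D" and le: "\<And>k. F z \<le> F (x k)"
  shows "convergent (\<lambda>k. C k (x k - z) (x k - z))"
    and "summable (\<lambda>k. \<gamma> k * lam k * (F (x k) - F z))"
    and "\<exists>R. \<forall>k. norm (x k) \<le> R"
proof -
  define \<epsilon> where "\<epsilon> k = s1 * (2 * \<gamma>max) * (lam k * \<Delta> k)" for k
  define b where "b k = 2 * s0 * (\<gamma> k * lam k * (F (x k) - F z))" for k
  define a where "a k = C k (x k - z) (x k - z)" for k
  have s1: "0 < s1" using s(1) s(2)[of 0] s(3)[of 0] by linarith
  have nn: "0 \<le> lam k * \<Delta> k" "0 \<le> \<gamma> k * lam k * (F (x k) - F z)" for k
    using lam(1)[of k] \<gamma>(1)[of k] \<Delta>_nonneg[of k] le[of k] by auto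
  have a_nonneg: "0 \<le> a k" for k
    unfolding a_def by (rule equivalent_scalar_product.nonneg[OF C.metric])
  have step: "a (Suc k) \<le> (1 + \<eta> k) * a k + \<epsilon> k - b k" for k
  proof -
    have "a (Suc k) \<le> (1 + \<eta> k) * a k
        + s k * (2 * \<gamma> k * lam k * (F z - F (x k)) + 2 * \<gamma> k * (lam k * \<Delta> k))"
      unfolding a_def by (rule transfer) (rule Fejer_inequality[OF z])
    also have "\<dots> = (1 + \<eta> k) * a k + s k * (2 * \<gamma> k) * (lam k * \<Delta> k) - 2 * s k * (\<gamma> k * lam k * (F (x k) - F z))"
      by (simp add: algebra_simps)
    also have "\<dots> \<le> (1 + \<eta> k) * a k + \<epsilon> k - b k"
    proof (intro diff_mono add_left_mono)
      show "s k * (2 * \<gamma> k) * (lam k * \<Delta> k) \<le> \<epsilon> k"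
        unfolding \<epsilon>_def by (intro mult_right_mono mult_mono nn) (use s s1 \<gamma>[of k] in auto)
      show "b k \<le> 2 * s k * (\<gamma> k * lam k * (F (x k) - F z))"
        unfolding b_def by (intro mult_right_mono nn) (use s in auto)
    qed
    finally show ?thesis .
  qed
  have b_nonneg: "0 \<le> b k" for k using s(1) nn(2)[of k] by (simp add: b_def)
  have \<epsilon>_nonneg: "0 \<le> \<epsilon> k" for k using s1 \<gamma>max nn(1)[of k] by (simp add: \<epsilon>_def)
  have \<epsilon>_summable: "summable \<epsilon>"
    unfolding \<epsilon>_def by (rule summable_mult[OF summable_\<Delta>[OF le]])
  note qf = quasi_Fejer_sequence[OF a_nonneg b_nonneg \<epsilon>_nonneg C.\<eta>_nonneg C.\<eta>_summable \<epsilon>_summable step]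
  show "convergent (\<lambda>k. C k (x k - z) (x k - z))" using qf(1) by (simp add: a_def)
  have "summable (\<lambda>k. 2 * s0 * (\<gamma> k * lam k * (F (x k) - F z)))" using qf(2) by (simp only: b_def)
  then show "summable (\<lambda>k. \<gamma> k * lam k * (F (x k) - F z))" using s(1) by (simp add: summable_cmult_iff)
  have "Bseq a" by (rule convergent_imp_Bseq[OF qf(1)])
  then obtain A where A: "\<And>k. a k \<le> A" unfolding Bseq_def using abs_le_D1 by fastforce
  have "norm (x k) \<le> norm z + sqrt (A / \<nu>')" for k
  proof -
    have "\<nu>' * (norm (x k - z))\<^sup>2 \<le> A"
      using equivalent_scalar_product.lower[OF C.metric, of "x k - z" k] A[of k] by (simp add: a_def)
    then have "(norm (x k - z))\<^sup>2 \<le> A / \<nu>'"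
      using equivalent_scalar_product.pos[OF C.metric] by (simp add: pos_le_divide_eq mult.commute)
    then have "norm (x k - z) \<le> sqrt (A / \<nu>')" by (rule real_le_rsqrt)
    then show ?thesis using norm_triangle_sub[of "x k" z] by linarith
  qed
  then show "\<exists>R. \<forall>k. norm (x k) \<le> R" by blast
qed

section \<open>Behaviour of the iteration when a minimizer exists\<close>

context
  fixes z assumes z: "z \<in> D" and z_min: "\<And>w. w \<in> D \<Longrightarrow> F z \<le> F w"
begin

text \<open>If weak convergence to the cluster point \<open>p\<close> failed for some
  \<open>u\<close>, the indices of failure would carry a cluster point of their own, again a
  minimizer and hence equal to \<open>p\<close> by uniqueness of cluster points.\<close>

lemma weak_convergence:
  "\<exists>p\<in>D. (\<forall>w\<in>D. F p \<le> F w) \<and> limitin weak_topology x p sequentially \<and> limitin weak_topology y p sequentially"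
proof -
  have le: "F z \<le> F (x k)" for k by (rule z_min[OF x_mem])
  obtain R where R: "\<And>k. norm (x k) \<le> R" using Fejer_convergence(3)[OF z le] by blast
  have bdd: "\<forall>\<^sub>F k in E. norm (x k) \<le> R" for E by (simp add: R)
  obtain p E where p: "p \<in> D" "\<And>w. w \<in> D \<Longrightarrow> F p \<le> F w"
    and E: "E \<le> sequentially" "E \<noteq> bot" "limitin weak_topology x p E"
    using weak_cluster_point_minimizes[OF order_refl trivial_limit_sequentially le bdd] by blast
  have x: "limitin weak_topology x p sequentially"
    unfolding limitin_weak_topology_iff
  proof (rule allI, rule tendstoI, rule ccontr)
    fix u and e :: real assume e: "0 < e" and "\<not> (\<forall>\<^sub>F k in sequentially. dist (x k \<bullet> u) (p \<bullet> u) < e)"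
    then have freq: "\<exists>\<^sub>F k in sequentially. \<not> dist (x k \<bullet> u) (p \<bullet> u) < e"
      by (simp only: not_eventually)
    define E1 where "E1 = inf sequentially (principal {k. \<not> dist (x k \<bullet> u) (p \<bullet> u) < e})"
    have E1: "E1 \<le> sequentially" by (simp add: E1_def)
    have "E1 \<noteq> bot"
      using freq by (simp add: E1_def trivial_limit_def eventually_inf_principal frequently_def)
    then obtain q E' where q: "q \<in> D" "\<And>w. w \<in> D \<Longrightarrow> F q \<le> F w"
      and E': "E' \<le> E1" "E' \<noteq> bot" "limitin weak_topology x q E'"
      using weak_cluster_point_minimizes[OF E1 _ le bdd] by blast
    have E'_seq: "E' \<le> sequentially" using E'(1) E1 by (rule order_trans)
    have "p = q"
      by (rule C.weak_cluster_point_unique[OF Fejer_convergence(1)[OF p(1) p(2)[OF x_mem]]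
            Fejer_convergence(1)[OF q(1) q(2)[OF x_mem]] R E E'_seq E'(2,3)])
    then have "((\<lambda>k. x k \<bullet> u) \<longlongrightarrow> p \<bullet> u) E'" using E'(3) by (simp add: limitin_weak_topology_iff)
    then have "\<forall>\<^sub>F k in E'. dist (x k \<bullet> u) (p \<bullet> u) < e" using e by (rule tendstoD)
    moreover have "\<forall>\<^sub>F k in E'. \<not> dist (x k \<bullet> u) (p \<bullet> u) < e"
      by (rule filter_leD[OF E'(1)]) (simp add: E1_def eventually_inf_principal)
    ultimately have "\<forall>\<^sub>F k in E'. False" by eventually_elim blast
    then show False using E'(2) by (simp only: eventually_False)
  qed
  have "limitin weak_topology y p sequentially"
    by (rule weak_limit_y[OF norm_step_tendsto_0[OF order_refl le bdd] x])
  with p x show ?thesis by blast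
qed

lemma F_y_tendsto: "(\<lambda>k. F (y k)) \<longlonglongrightarrow> F z"
proof -
  have le: "F z \<le> F (x k)" for k by (rule z_min[OF x_mem])
  obtain R where R: "\<And>k. norm (x k) \<le> R" using Fejer_convergence(3)[OF z le] by blast
  show ?thesis
  proof (rule tendstoI)
    fix e :: real assume e: "0 < e"
    have "\<forall>\<^sub>F k in sequentially. F (y k) < F z + e"
      by (rule F_y_upper[where R = R, OF order_refl le _ z e]) (simp add: R)
    then show "\<forall>\<^sub>F k in sequentially. dist (F (y k)) (F z) < e"
    proof eventually_elim
      case (elim k)
      then show ?case using z_min[OF y_mem, of k] by (simp add: dist_real_def)
    qed
  qed
qed

text \<open>A limit of the values above the minimum would bound \<open>\<gamma> k * lam k\<close> by
  a multiple of the summable weighted gaps.\<close>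

lemma F_x_tendsto:
  assumes "\<not> summable (\<lambda>k. \<gamma> k * lam k)"
  shows "(\<lambda>k. F (x k)) \<longlonglongrightarrow> F z"
proof -
  have le: "F z \<le> F (x k)" for k by (rule z_min[OF x_mem])
  obtain L where L: "(\<lambda>k. F (x k)) \<longlonglongrightarrow> L" "\<And>k. L \<le> F (x k)"
    using decseq_convergent[OF decseq_F, of "F z"] le by blast
  have "L = F z"
  proof (rule ccontr)
    assume "L \<noteq> F z"
    moreover have "F z \<le> L" by (rule LIMSEQ_le_const[OF L(1)]) (simp add: le)
    ultimately have gap: "0 < L - F z" by simp
    have "summable (\<lambda>k. inverse (L - F z) * (\<gamma> k * lam k * (F (x k) - F z)))"
      by (rule summable_mult[OF Fejer_convergence(2)[OF z le]])
    moreover have "norm (\<gamma> k * lam k) \<le> inverse (L - F z) * (\<gamma> k * lam k * (F (x k) - F z))" for k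
    proof -
      have p: "0 \<le> \<gamma> k * lam k" using \<gamma>(1)[of k] lam(1)[of k] by simp
      then have "\<gamma> k * lam k * (L - F z) \<le> \<gamma> k * lam k * (F (x k) - F z)"
        using L(2)[of k] by (intro mult_left_mono) auto
      then show ?thesis using gap p by (simp add: field_simps)
    qed
    ultimately have "summable (\<lambda>k. \<gamma> k * lam k)" by (rule summable_comparison_test'[where N = 0])
    with assms show False by simp
  qed
  then show ?thesis using L(1) by simp
qed

lemma F_x_smallo:
  assumes c: "0 < c" "\<And>k. c \<le> \<gamma> k * lam k"
  shows "(\<lambda>k. F (x k) - F z) \<in> o(\<lambda>k. 1 / real k)"
proof (rule decseq_summable_smallo)
  have le: "F z \<le> F (x k)" for k by (rule z_min[OF x_mem])
  show "decseq (\<lambda>k. F (x k) - F z)" using decseqD[OF decseq_F] by (auto simp: decseq_def)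
  show "0 \<le> F (x k) - F z" for k by (simp add: le)
  have "norm (F (x k) - F z) \<le> inverse c * (\<gamma> k * lam k * (F (x k) - F z))" for k
  proof -
    have "c * (F (x k) - F z) \<le> \<gamma> k * lam k * (F (x k) - F z)"
      using le[of k] c(2)[of k] by (intro mult_right_mono) auto
    then show ?thesis using le[of k] c(1) by (simp add: field_simps)
  qed
  then show "summable (\<lambda>k. F (x k) - F z)"
    using summable_mult[OF Fejer_convergence(2)[OF z le], of "inverse c"]
    by (rule summable_comparison_test'[rotated, where N = 0])
qed

end

text \<open>At indices of bounded iterates the minorants of \<open>f\<close> and \<open>g\<close>
  bound the values from below; as the values decrease, the bound extends to all indices, and a weak
  cluster point along the bounded part would be a minimizer.\<close>

lemma no_minimizer_norm_at_top:
  assumes none: "\<not> (\<exists>p\<in>D. \<forall>w\<in>D. F p \<le> F w)"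
  shows "filterlim (\<lambda>k. norm (x k)) at_top sequentially"
proof (rule ccontr)
  assume "\<not> ?thesis"
  then obtain R where "\<not> (\<forall>\<^sub>F k in sequentially. R \<le> norm (x k))"
    unfolding filterlim_at_top by blast
  then have freq: "\<exists>\<^sub>F k in sequentially. norm (x k) \<le> R"
    unfolding not_eventually by (rule frequently_elim1) simp
  define E where "E = inf sequentially (principal {k. norm (x k) \<le> R})"
  have E: "E \<le> sequentially" by (simp add: E_def)
  have ne: "E \<noteq> bot"
    using freq by (simp add: E_def trivial_limit_def eventually_inf_principal frequently_def)
  have bdd: "\<forall>\<^sub>F k in E. norm (x k) \<le> R" by (simp add: E_def eventually_inf_principal)
  obtain a b where ab: "0 \<le> b" "\<And>w. w \<in> D \<Longrightarrow> a - b * norm w \<le> g w" using conical_minorant by blast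
  define m where "m = f (x 0) - (R + norm (x 0)) * norm (G (x 0)) + (a - b * R)"
  have near: "m \<le> F (x k)" if "norm (x k) \<le> R" for k
  proof -
    have "f (x 0) + (x k - x 0) \<bullet> G (x 0) \<le> f (x k)" by (rule subgradient[OF x0 x_mem])
    moreover have "- ((x k - x 0) \<bullet> G (x 0)) \<le> norm (x k - x 0) * norm (G (x 0))"
      using Cauchy_Schwarz_ineq2[of "x k - x 0" "G (x 0)"] by (simp add: abs_le_iff)
    moreover have "norm (x k - x 0) * norm (G (x 0)) \<le> (R + norm (x 0)) * norm (G (x 0))"
      using norm_triangle_ineq4[of "x k" "x 0"] that by (intro mult_right_mono) auto
    moreover have "b * norm (x k) \<le> b * R" using that ab(1) by (rule mult_left_mono)
    ultimately show ?thesis using ab(2)[OF x_mem, of k] unfolding F_def m_def by linarith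
  qed
  have m: "m \<le> F (x k)" for k
  proof -
    obtain n where "k \<le> n" "norm (x n) \<le> R"
      using freq unfolding frequently_sequentially by blast
    then show ?thesis using near[of n] decseqD[OF decseq_F, of k n] by linarith
  qed
  obtain p where "p \<in> D" "\<And>w. w \<in> D \<Longrightarrow> F p \<le> F w"
    using weak_cluster_point_minimizes[OF E ne m bdd] by blast
  with none show False by blast
qed

text \<open>Otherwise quasi-Fejer monotonicity with respect to \<open>z\<close> would bound the
  iterates, whose norms tend to infinity.\<close>

lemma no_minimizer_F_x_unbounded:
  assumes none: "\<not> (\<exists>p\<in>D. \<forall>w\<in>D. F p \<le> F w)" and z: "z \<in> D"
  shows "\<exists>k. F (x k) < F z"
proof (rule ccontr)
  assume "\<not> ?thesis"
  then have "F z \<le> F (x k)" for k by (simp add: not_less)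
  then obtain R where R: "\<And>k. norm (x k) \<le> R" using Fejer_convergence(3)[OF z] by blast
  have "\<forall>\<^sub>F k in sequentially. R + 1 \<le> norm (x k)"
    using no_minimizer_norm_at_top[OF none] unfolding filterlim_at_top by blast
  then obtain k where "R + 1 \<le> norm (x k)" unfolding eventually_sequentially by blast
  with R[of k] show False by linarith
qed

end

subsection \<open>Line searches\<close>

text \<open>\<open>C = B\<close> under the first condition, and the original scalar product under the second one.\<close>

lemma quasi_decreasing_metrics_exist:
  fixes B :: "nat \<Rightarrow> 'a::{real_inner, complete_space} \<Rightarrow> 'a \<Rightarrow> real"
  assumes metric: "\<And>k. equivalent_scalar_product (B k) \<nu> \<mu>" and \<nu>\<mu>: "\<nu> \<le> \<mu>"
    and cond: "(\<exists>\<eta>::nat \<Rightarrow> real. (\<forall>k. 0 \<le> \<eta> k) \<and> summable \<eta> \<and> (\<forall>k z. B (Suc k) z z \<le> (1 + \<eta> k) * B k z z))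
       \<or> summable (\<lambda>k. upper_bound (B k) - lower_bound (B k))"
  obtains C :: "nat \<Rightarrow> 'a \<Rightarrow> 'a \<Rightarrow> real" and \<nu>' \<mu>' \<eta> s s0 s1
  where "quasi_decreasing_metrics C \<nu>' \<mu>' \<eta>" "0 < s0" "\<And>k. s0 \<le> s k" "\<And>k. s k \<le> s1"
    "\<And>k u v e. B k u u \<le> B k v v + e \<Longrightarrow> C (Suc k) u u \<le> (1 + \<eta> k) * C k v v + s k * e"
proof (cases "\<exists>\<eta>::nat \<Rightarrow> real. (\<forall>k. 0 \<le> \<eta> k) \<and> summable \<eta> \<and> (\<forall>k z. B (Suc k) z z \<le> (1 + \<eta> k) * B k z z)")
  case True
  then obtain \<eta> :: "nat \<Rightarrow> real" where \<eta>: "\<And>k. 0 \<le> \<eta> k" "summable \<eta>" "\<And>k z. B (Suc k) z z \<le> (1 + \<eta> k) * B k z z"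
    by blast
  show ?thesis
  \<comment> \<open>One step of growth of the metrics multiplies the whole inequality by
    \<open>1 + \<eta> k\<close>, which is therefore also the factor \<open>s k\<close>.\<close>
  proof (rule that[of B \<nu> \<mu> \<eta> 1 "\<lambda>k. 1 + \<eta> k" "1 + suminf \<eta>"])
    show "quasi_decreasing_metrics B \<nu> \<mu> \<eta>"
      using metric \<nu>\<mu> \<eta> by (intro quasi_decreasing_metrics.intro) auto
    show "1 + \<eta> k \<le> 1 + suminf \<eta>" for k using sum_le_suminf[OF \<eta>(2), of "{k}"] \<eta>(1) by simp
    fix k u v and e :: real assume "B k u u \<le> B k v v + e"
    then have "(1 + \<eta> k) * B k u u \<le> (1 + \<eta> k) * (B k v v + e)" using \<eta>(1)[of k] by (intro mult_left_mono) auto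
    then show "B (Suc k) u u \<le> (1 + \<eta> k) * B k v v + (1 + \<eta> k) * e"
      using \<eta>(3)[of k u] by (simp add: distrib_left)
  qed (use \<eta>(1) in auto)
next
  case False
  \<comment> \<open>In the zero space all forms vanish and the first condition holds with
    \<open>\<eta> = 0\<close>, a case already excluded.\<close>
  have "\<exists>e::'a. norm e = 1"
  proof (rule ccontr)
    assume none: "\<nexists>e::'a. norm e = 1"
    have "z = 0" for z :: 'a
    proof (rule ccontr)
      assume "z \<noteq> 0"
      then have "norm (z /\<^sub>R norm z) = 1" by simp
      with none show False by blast
    qed
    then have "B j z z = 0" for j and z :: 'a
      using bilinear_lzero[OF equivalent_scalar_product.bilinear[OF metric]] by metis
    then have "\<exists>\<eta>::nat \<Rightarrow> real. (\<forall>k. 0 \<le> \<eta> k) \<and> summable \<eta> \<and> (\<forall>k z. B (Suc k) z z \<le> (1 + \<eta> k) * B k z z)"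
      by (intro exI[of _ "\<lambda>_. 0"]) simp
    with False show False by contradiction
  qed
  then obtain e :: 'a where e: "norm e = 1" by blast
  note W = equivalent_scalar_product.assoc_operator_bounds[OF metric e]
  have \<nu>: "0 < \<nu>" by (rule equivalent_scalar_product.pos[OF metric])
  define l u where "l k = lower_bound (B k)" and "u k = upper_bound (B k)" for k
  have l: "\<nu> \<le> l k" "l k \<le> u k" "u k \<le> \<mu>" for k unfolding l_def u_def by (rule W)+
  have l0: "0 < l k" for k using \<nu> l(1)[of k] by linarith
  \<comment> \<open>\<open>1 + \<eta> k\<close> is the condition number \<open>u k / l k\<close>,
    the cost of passing from the ambient norm to \<open>B k\<close> and back; the bound
    \<open>\<nu> \<le> l k\<close> makes \<open>\<eta>\<close> summable.\<close>
  define \<eta> where "\<eta> k = (u k - l k) / l k" for k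
  have \<eta>0: "0 \<le> \<eta> k" for k using l(2)[of k] l0[of k] by (simp add: \<eta>_def)
  have \<eta>1: "1 + \<eta> k = u k / l k" for k using l0[of k] by (simp add: \<eta>_def field_simps)
  have "summable (\<lambda>k. (u k - l k) / \<nu>)"
    using cond False unfolding u_def l_def by (intro summable_divide) blast
  moreover have "norm (\<eta> k) \<le> (u k - l k) / \<nu>" for k
    using \<eta>0[of k] unfolding \<eta>_def using l[of k] \<nu> by (simp add: frac_le)
  ultimately have \<eta>s: "summable \<eta>" by (rule summable_comparison_test'[where N = 0])
  show ?thesis
  proof (rule that[of "\<lambda>_. inner" 1 1 \<eta> "1 / \<mu>" "\<lambda>k. 1 / l k" "1 / \<nu>"])
    show "quasi_decreasing_metrics (\<lambda>_. inner :: 'a \<Rightarrow> 'a \<Rightarrow> real) 1 1 \<eta>"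
    proof (rule quasi_decreasing_metrics.intro)
      show "z \<bullet> z \<le> (1 + \<eta> k) * (z \<bullet> z)" for k and z :: 'a
        using mult_right_mono[of 1 "1 + \<eta> k" "z \<bullet> z"] \<eta>0[of k] by simp
    qed (use \<eta>0 \<eta>s equivalent_scalar_product_inner in auto)
    show "0 < 1 / \<mu>" using \<nu> \<nu>\<mu> by simp
    show "1 / \<mu> \<le> 1 / l k" for k using l(2,3)[of k] l0[of k] by (intro divide_left_mono) auto
    show "1 / l k \<le> 1 / \<nu>" for k using l(1)[of k] l0[of k] \<nu> by (intro divide_left_mono) auto
    fix k and a b :: 'a and e assume "B k a a \<le> B k b b + e"
    then have "l k * (norm a)\<^sup>2 \<le> u k * (norm b)\<^sup>2 + e"
      using W(4)[of k a] W(5)[of k b] unfolding l_def u_def by linarith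
    then have "(norm a)\<^sup>2 \<le> (u k * (norm b)\<^sup>2 + e) / l k" using l0[of k] by (simp add: pos_le_divide_eq mult.commute)
    then show "a \<bullet> a \<le> (1 + \<eta> k) * (b \<bullet> b) + 1 / l k * e"
      by (simp add: \<eta>1 add_divide_distrib power2_norm_eq_inner)
  qed
qed

text \<open>Trial values decrease geometrically, so the predecessor \<open>t / \<theta>\<close> of
  the accepted one is larger and must have been rejected, unless \<open>t\<close> is the initial
  value \<open>a\<close>.\<close>

lemma is_largest_geometric:
  fixes a \<theta> :: real
  assumes "0 < a" "0 < \<theta>" "\<theta> < 1"
    and largest: "is_largest t {t \<in> range (\<lambda>i::nat. a * \<theta> ^ i). Q t}"
  shows "Q t" "0 < t" "t \<le> a" "t = a \<or> t / \<theta> \<le> a \<and> \<not> Q (t / \<theta>)"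
proof -
  obtain i where i: "t = a * \<theta> ^ i" using largest by (auto simp: is_largest_def)
  have le: "a * \<theta> ^ j \<le> a" for j using assms by (simp add: power_le_one mult_left_le)
  show "Q t" using largest by (simp add: is_largest_def)
  show t: "0 < t" using assms by (simp add: i)
  show "t \<le> a" unfolding i by (rule le)
  show "t = a \<or> t / \<theta> \<le> a \<and> \<not> Q (t / \<theta>)"
  proof (cases i)
    case (Suc j)
    then have e: "t / \<theta> = a * \<theta> ^ j" using assms by (simp add: i)
    have "\<not> t / \<theta> \<le> t" using t assms by (simp add: field_simps)
    then have "\<not> Q (t / \<theta>)" using largest e unfolding is_largest_def by blast
    then show ?thesis using le[of j] e by simp
  qed (simp add: i)
qed

section \<open>One trial step in a fixed metric\<close>

locale fb_problem = equivalent_scalar_product B \<nu> \<mu>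
  for B :: "'a::{real_inner, complete_space} \<Rightarrow> 'a \<Rightarrow> real" and \<nu> \<mu> +
  fixes f g :: "'a \<Rightarrow> ereal" and \<delta> :: real
  assumes f: "proper f" "econvex f"
    and g: "proper g" "econvex g" "lsc g"
    and dom: "edom g \<subseteq> edom f"
    and diff: "gateaux_differentiable_on f (edom g)"
    and \<delta>: "0 < \<delta>" "\<delta> < 1"
begin

definition f' where "f' z = real_of_ereal (f z)"
definition g' where "g' z = real_of_ereal (g z)"

lemma f_real: "z \<in> edom g \<Longrightarrow> f z = ereal (f' z)"
  unfolding f'_def using dom by (intro proper_ereal_real f) auto

lemma g_real: "z \<in> edom g \<Longrightarrow> g z = ereal (g' z)"
  unfolding g'_def by (intro proper_ereal_real g)

lemma subgradient:
  assumes "z \<in> edom g" "w \<in> edom g"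
  shows "f' z + (w - z) \<bullet> gradient f z \<le> f' w"
proof -
  obtain u where u: "has_gateaux_gradient f z u"
    using diff assms(1) unfolding gateaux_differentiable_on_def by blast
  show ?thesis unfolding f'_def gradient_eq[OF u]
    by (rule gradient_inequality[OF f u]) (use assms dom in auto)
qed

context
  fixes z t s p J d
  assumes z: "z \<in> edom g" and t: "0 < t" and s: "0 < s" "s \<le> 1"
  defines "p \<equiv> fb_point B f g z t"
    and "J \<equiv> fb_step B f g z t s"
    and "d \<equiv> g' (fb_point B f g z t) - g' z + (fb_point B f g z t - z) \<bullet> gradient f z"
begin

lemma step_eq: "J = z + s *\<^sub>R (p - z)"
  by (simp add: J_def p_def fb_step_def)

lemma point_mem: "p \<in> edom g"
  unfolding p_def by (rule fb_point_variational(1)[OF g t])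

lemma step_mem: "J \<in> edom g" and g_step_le: "g' J \<le> g' z + s * (g' p - g' z)"
  unfolding step_eq g'_def
  using closed_convex_function.segment[OF closed_convex_function_edom[OF g] z point_mem] s by auto

lemma model_decrease_le: "B (p - z) (p - z) / t \<le> - d"
  using fb_point_variational(2)[OF g t z, of f z]
  unfolding d_def p_def g'_def by (simp add: algebra inner_diff_left algebra_simps)

text \<open>The subgradient inequality is taken at the trial point \<open>J\<close> and tested at
  \<open>z\<close>, which brings the gradient at \<open>J\<close> into the rejection
  arguments.\<close>

lemma f_step_upper: "f' J - f' z \<le> s * ((p - z) \<bullet> gradient f J)"
  using subgradient[OF step_mem z] by (simp add: step_eq)

text \<open>Reduces a rejection to an inequality in the single direction \<open>p - z\<close>: after
  Cauchy-Schwarz one factor \<open>norm (p - z)\<close> cancels, and for \<open>p = z\<close> the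
  failure is trivially true.\<close>

lemma line_search_failureI:
  assumes le: "\<delta> * (B (p - z) (p - z) / t) \<le> (p - z) \<bullet> (gradient f J - gradient f z)"
  shows "line_search_failure (gradient f) (\<delta> * \<nu>) z p t s"
proof (cases "p = z")
  case False
  have "\<delta> * (\<nu> * (norm (p - z))\<^sup>2 / t) \<le> \<delta> * (B (p - z) (p - z) / t)"
    using lower \<delta> t by (intro mult_left_mono divide_right_mono) auto
  also note le
  also have "(p - z) \<bullet> (gradient f J - gradient f z) \<le> norm (p - z) * norm (gradient f J - gradient f z)"
    by (rule norm_cauchy_schwarz)
  finally have "norm (p - z) * (\<delta> * \<nu> * norm (p - z) / t) \<le> norm (p - z) * norm (gradient f J - gradient f z)"
    by (simp add: power2_eq_square mult_ac)
  then have "\<delta> * \<nu> * norm (p - z) / t \<le> norm (gradient f J - gradient f z)"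
    by (rule mult_left_le_imp_le) (use False in simp)
  then show ?thesis by (simp add: line_search_failure_def step_eq)
qed (simp add: line_search_failure_def)

lemma descent_test_iff:
  "descent_test B f g \<delta> z t s \<longleftrightarrow> f' J - f' z - s * ((p - z) \<bullet> gradient f z) \<le> s * (\<delta> * (B (p - z) (p - z) / t))"
proof -
  have "\<delta> / (t * s) * (ipnorm B (J - z))\<^sup>2 = s * (\<delta> * (B (p - z) (p - z) / t))"
    using s t by (simp add: ipnorm_power2 step_eq algebra field_simps)
  then show ?thesis
    unfolding descent_test_def J_def[symmetric] using f_real[OF z] f_real[OF step_mem]
    by (simp add: step_eq)
qed

text \<open>The quadratic allowance of the test is at most \<open>- \<delta> * s * d\<close>,
  because \<open>- d\<close> dominates \<open>B (p - z) (p - z) / t\<close>; convexity of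
  \<open>g\<close> supplies the rest.\<close>

lemma sufficient_decrease_if_descent_test:
  assumes "descent_test B f g \<delta> z t s"
  shows "f' J + g' J - (f' z + g' z) \<le> (1 - \<delta>) * s * d"
proof -
  have "s * (\<delta> * (B (p - z) (p - z) / t)) \<le> s * (\<delta> * - d)"
    using model_decrease_le s \<delta> by (intro mult_left_mono) auto
  then show ?thesis
    using assms g_step_le unfolding descent_test_iff d_def p_def by (simp add: algebra_simps)
qed

lemma failure_if_not_descent_test:
  assumes "\<not> descent_test B f g \<delta> z t s"
  shows "line_search_failure (gradient f) (\<delta> * \<nu>) z p t s"
proof (rule line_search_failureI)
  have "s * (\<delta> * (B (p - z) (p - z) / t)) < s * ((p - z) \<bullet> gradient f J) - s * ((p - z) \<bullet> gradient f z)"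
    using assms f_step_upper unfolding descent_test_iff by linarith
  then have "s * (\<delta> * (B (p - z) (p - z) / t)) \<le> s * ((p - z) \<bullet> (gradient f J - gradient f z))"
    by (simp add: inner_diff_right right_diff_distrib)
  then show "\<delta> * (B (p - z) (p - z) / t) \<le> (p - z) \<bullet> (gradient f J - gradient f z)"
    using s by (simp only: mult_le_cancel_left_pos)
qed

lemma armijo_iff:
  "f J + g J - (f z + g z) \<le> ereal ((1 - \<delta>) * s) * (g p - g z + ereal ((p - z) \<bullet> gradient f z))
    \<longleftrightarrow> f' J + g' J - (f' z + g' z) \<le> (1 - \<delta>) * s * d"
  by (simp add: f_real[OF z] f_real[OF step_mem] g_real[OF z] g_real[OF step_mem] g_real[OF point_mem] d_def flip: p_def)

text \<open>After division by \<open>s\<close>, subtracting \<open>d\<close> turns the rejected test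
  into the lower bound \<open>- \<delta> * d\<close> of the gradient variation along
  \<open>p - z\<close>.\<close>

lemma failure_if_not_armijo:
  assumes "\<not> f' J + g' J - (f' z + g' z) \<le> (1 - \<delta>) * s * d"
  shows "line_search_failure (gradient f) (\<delta> * \<nu>) z p t s"
proof (rule line_search_failureI)
  have "s * ((1 - \<delta>) * d) < s * ((p - z) \<bullet> gradient f J) + s * (g' p - g' z)"
    using assms f_step_upper g_step_le by (simp add: mult.commute mult.left_commute)
  then have "s * ((1 - \<delta>) * d) < s * ((p - z) \<bullet> gradient f J + (g' p - g' z))"
    by (simp only: distrib_left)
  then have "(1 - \<delta>) * d < (p - z) \<bullet> gradient f J + (g' p - g' z)"
    using s by (simp only: mult_less_cancel_left_pos)
  moreover have "\<delta> * (B (p - z) (p - z) / t) \<le> \<delta> * - d"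
    using model_decrease_le \<delta> by (intro mult_left_mono) auto
  ultimately show "\<delta> * (B (p - z) (p - z) / t) \<le> (p - z) \<bullet> (gradient f J - gradient f z)"
    unfolding d_def p_def by (simp add: inner_diff_right algebra_simps)
qed

lemma gradient_wrt_diff: "B v (gradient_wrt B f J - gradient_wrt B f z) = v \<bullet> (gradient f J - gradient f z)"
  by (simp add: gradient_wrt_def algebra inv_assoc_operator inner_diff_right)

text \<open>By the subgradient inequality at \<open>J\<close> and Cauchy-Schwarz in \<open>B\<close>
  the gradient test is the stronger one, so the fourth line search inherits the decrease of the
  first.\<close>

lemma descent_test_if_gradient_test:
  assumes "ipnorm B (gradient_wrt B f J - gradient_wrt B f z) \<le> \<delta> / (t * s) * ipnorm B (J - z)"
  shows "descent_test B f g \<delta> z t s"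
proof -
  have "f' J - f' z - (J - z) \<bullet> gradient f z \<le> (J - z) \<bullet> (gradient f J - gradient f z)"
    using subgradient[OF step_mem z] by (simp add: inner_diff_left inner_diff_right)
  also have "\<dots> = B (J - z) (gradient_wrt B f J - gradient_wrt B f z)" by (simp only: gradient_wrt_diff)
  also have "\<dots> \<le> ipnorm B (J - z) * ipnorm B (gradient_wrt B f J - gradient_wrt B f z)"
    using Cauchy_Schwarz by (rule abs_le_D1)
  also have "\<dots> \<le> ipnorm B (J - z) * (\<delta> / (t * s) * ipnorm B (J - z))"
    by (rule mult_left_mono[OF assms ipnorm_nonneg])
  also have "\<dots> = \<delta> / (t * s) * (ipnorm B (J - z))\<^sup>2" by (simp add: power2_eq_square)
  finally show ?thesis
    unfolding descent_test_def J_def[symmetric] by (simp add: f_real[OF z] f_real[OF step_mem])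
qed

text \<open>The factor \<open>\<nu>\<close> arises as \<open>sqrt \<nu> * sqrt \<nu>\<close>: one
  root converts the norm of the step, the other relates \<open>ipnorm B v\<close> to the ordinary
  gradient difference through \<open>B v v = v \<bullet> ?G\<close>.\<close>

lemma failure_if_not_gradient_test:
  assumes "\<not> ipnorm B (gradient_wrt B f J - gradient_wrt B f z) \<le> \<delta> / (t * s) * ipnorm B (J - z)"
  shows "line_search_failure (gradient f) (\<delta> * \<nu>) z p t s"
proof -
  define v where "v = gradient_wrt B f J - gradient_wrt B f z"
  let ?G = "gradient f J - gradient f z"
  have s\<nu>: "0 < sqrt \<nu>" "sqrt \<nu> * sqrt \<nu> = \<nu>" using pos by simp_all
  have "ipnorm B (J - z) = s * ipnorm B (p - z)"
    using s by (simp add: step_eq ipnorm_def algebra(7,8) real_sqrt_mult flip: mult.assoc)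
  then have "\<delta> / (t * s) * ipnorm B (J - z) = \<delta> / t * ipnorm B (p - z)"
    using s t by simp
  then have v: "\<delta> / t * ipnorm B (p - z) < ipnorm B v" using assms by (simp add: v_def)
  moreover have "0 \<le> \<delta> / t * ipnorm B (p - z)" using \<delta> t ipnorm_nonneg by simp
  ultimately have v0: "0 < ipnorm B v" by linarith
  have "sqrt \<nu> * (ipnorm B v)\<^sup>2 = sqrt \<nu> * (v \<bullet> ?G)"
    using gradient_wrt_diff[of v] by (simp add: ipnorm_power2 v_def)
  also have "\<dots> \<le> sqrt \<nu> * (norm v * norm ?G)"
    using s\<nu>(1) by (intro mult_left_mono norm_cauchy_schwarz) simp
  also have "\<dots> \<le> ipnorm B v * norm ?G"
    using mult_right_mono[OF norm_equivalence(1)[of v], of "norm ?G"] by (simp add: mult.assoc)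
  finally have "ipnorm B v * (sqrt \<nu> * ipnorm B v) \<le> ipnorm B v * norm ?G"
    by (simp add: power2_eq_square mult_ac)
  then have vG: "sqrt \<nu> * ipnorm B v \<le> norm ?G" using v0 by (simp only: mult_le_cancel_left_pos)
  have "\<delta> * \<nu> * norm (p - z) / t = sqrt \<nu> * (\<delta> / t * (sqrt \<nu> * norm (p - z)))"
    by (subst s\<nu>(2)[symmetric]) simp
  also have "\<dots> \<le> sqrt \<nu> * (\<delta> / t * ipnorm B (p - z))"
    using s\<nu> \<delta> t norm_equivalence(1) by (intro mult_left_mono) auto
  also have "\<dots> \<le> sqrt \<nu> * ipnorm B v" using s\<nu>(1) v by (intro mult_left_mono) auto
  also note vG
  finally show ?thesis by (simp add: line_search_failure_def step_eq)
qed

end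

end

lemma INF_pos_lower_bound:
  fixes a :: "nat \<Rightarrow> real"
  assumes "0 < (INF k. a k)" "\<And>k. 0 < a k"
  shows "\<exists>c>0. \<forall>k. c \<le> a k"
proof -
  have "bdd_below (range a)" using assms(2) by (auto intro!: bdd_belowI2[of _ 0] less_imp_le)
  then have "(INF k. a k) \<le> a k" for k by (rule cINF_lower) simp
  then show ?thesis using assms(1) by blast
qed

section \<open>The four line searches along a run of the algorithm\<close>

locale vm_fbs_run =
  fixes f g :: "'a::{real_inner, complete_space} \<Rightarrow> ereal" and ip :: "nat \<Rightarrow> 'a \<Rightarrow> 'a \<Rightarrow> real"
    and \<nu> \<mu> \<delta> \<theta> :: real and \<gamma> lam :: "nat \<Rightarrow> real" and x y :: "nat \<Rightarrow> 'a"
  assumes problem: "\<And>k. fb_problem (ip k) \<nu> \<mu> f g \<delta>"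
    and alg: "vm_fbs ip f g \<gamma> lam x y"
    and \<theta>: "0 < \<theta>" "\<theta> < 1"
begin

abbreviation "f' \<equiv> fb_problem.f' f"
abbreviation "g' \<equiv> fb_problem.g' g"

abbreviation "decrease k \<equiv> f' (x (Suc k)) + g' (x (Suc k)) - (f' (x k) + g' (x k))
  \<le> (1 - \<delta>) * lam k * (g' (y k) - g' (x k) + (y k - x k) \<bullet> gradient f (x k))"

abbreviation "failure k t s \<equiv> line_search_failure (gradient f) (\<delta> * \<nu>) (x k) (fb_point (ip k) f g (x k) t) t s"

definition "valid_parameters \<gamma>max \<longleftrightarrow>
  (\<exists>c>0. \<forall>k. c \<le> lam k) \<and> (\<forall>k. \<gamma> k = \<gamma>max \<or> failure k (\<gamma> k / \<theta>) (lam k))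
  \<or> (\<exists>c>0. \<forall>k. c \<le> \<gamma> k)
    \<and> (\<exists>l. 0 < l \<and> l \<le> 1 \<and> (\<forall>k. lam k = l \<or> lam k / \<theta> \<le> l \<and> failure k (\<gamma> k) (lam k / \<theta>)))"

lemma \<gamma>_pos: "0 < \<gamma> k" and lam_pos: "0 < lam k" and lam_le_1: "lam k \<le> 1"
  and y_eq: "y k = fb_point (ip k) f g (x k) (\<gamma> k)"
  and x_Suc: "x (Suc k) = x k + lam k *\<^sub>R (y k - x k)" and x0: "x 0 \<in> edom g"
  using alg by (simp_all add: vm_fbs_def)

lemma x_Suc_eq_fb_step: "x (Suc k) = fb_step (ip k) f g (x k) (\<gamma> k) (lam k)"
  by (simp add: x_Suc y_eq fb_step_def)

lemma x_mem: "x k \<in> edom g"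
proof (induction k)
  case (Suc k)
  show ?case
    unfolding x_Suc_eq_fb_step by (rule fb_problem.step_mem[OF problem Suc.IH \<gamma>_pos lam_pos lam_le_1])
qed (rule x0)

lemmas at_iterate = problem x_mem \<gamma>_pos lam_pos lam_le_1

lemma decrease_if_descent_test:
  assumes "descent_test (ip k) f g \<delta> (x k) (\<gamma> k) (lam k)"
  shows "decrease k"
  using fb_problem.sufficient_decrease_if_descent_test[OF at_iterate assms]
  by (simp add: x_Suc_eq_fb_step y_eq)

text \<open>Covers the first and fourth line searches; \<open>Q\<close> is the acceptance test and
  \<open>\<gamma>bar\<close> becomes \<open>\<gamma>max\<close>.\<close>

lemma step_size_backtracking:
  assumes inf: "0 < (INF k. lam k)" and \<gamma>bar: "0 < \<gamma>bar"
    and largest: "\<And>k. is_largest (\<gamma> k) {t \<in> range (\<lambda>i::nat. \<gamma>bar * \<theta> ^ i). Q k t}"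
    and accept: "\<And>k. Q k (\<gamma> k) \<Longrightarrow> descent_test (ip k) f g \<delta> (x k) (\<gamma> k) (lam k)"
    and reject: "\<And>k t. 0 < t \<Longrightarrow> \<not> Q k t \<Longrightarrow> failure k t (lam k)"
  shows "(\<forall>k. decrease k) \<and> (\<exists>\<gamma>max. (\<forall>k. \<gamma> k \<le> \<gamma>max) \<and> valid_parameters \<gamma>max)"
proof -
  note L = is_largest_geometric[OF \<gamma>bar \<theta> largest]
  have "\<gamma> k = \<gamma>bar \<or> failure k (\<gamma> k / \<theta>) (lam k)" for k
    using L(4)[of k] reject[of "\<gamma> k / \<theta>" k] \<gamma>_pos[of k] \<theta> by auto
  then have "valid_parameters \<gamma>bar"
    unfolding valid_parameters_def using INF_pos_lower_bound[OF inf lam_pos] by blast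
  moreover have "decrease k" for k by (rule decrease_if_descent_test[OF accept[OF L(1)]])
  ultimately show ?thesis using L(3) by blast
qed

text \<open>Covers the second and third line searches. A rejected \<open>lam k / \<theta>\<close> is
  at most \<open>lbar\<close>, hence at most 1, so its trial point stays on the segment to
  \<open>y k\<close>.\<close>

lemma relaxation_backtracking:
  assumes inf: "0 < (INF k. \<gamma> k)" "bdd_above (range \<gamma>)" and lbar: "0 < lbar" "lbar \<le> 1"
    and largest: "\<And>k. is_largest (lam k) {t \<in> range (\<lambda>i::nat. lbar * \<theta> ^ i). Q k t}"
    and accept: "\<And>k. Q k (lam k) \<Longrightarrow> decrease k"
    and reject: "\<And>k s. 0 < s \<Longrightarrow> s \<le> 1 \<Longrightarrow> \<not> Q k s \<Longrightarrow> failure k (\<gamma> k) s"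
  shows "(\<forall>k. decrease k) \<and> (\<exists>\<gamma>max. (\<forall>k. \<gamma> k \<le> \<gamma>max) \<and> valid_parameters \<gamma>max)"
proof -
  note L = is_largest_geometric[OF lbar(1) \<theta> largest]
  have "lam k = lbar \<or> lam k / \<theta> \<le> lbar \<and> failure k (\<gamma> k) (lam k / \<theta>)" for k
  proof (rule disjE[OF L(4)[of k]])
    assume a: "lam k / \<theta> \<le> lbar \<and> \<not> Q k (lam k / \<theta>)"
    have "failure k (\<gamma> k) (lam k / \<theta>)"
    proof (rule reject)
      show "0 < lam k / \<theta>" using lam_pos[of k] \<theta> by simp
      show "lam k / \<theta> \<le> 1" using a lbar(2) by linarith
    qed (use a in blast)
    with a show ?thesis by blast
  qed simp
  \<comment> \<open>Any \<open>m\<close> will do, since only the other alternative mentions the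
    bound on the step sizes; a suitable one is taken from \<open>bdd_above\<close> below.\<close>
  then have "valid_parameters m" for m
    unfolding valid_parameters_def using INF_pos_lower_bound[OF inf(1) \<gamma>_pos] lbar by blast
  moreover have "decrease k" for k by (rule accept[OF L(1)])
  moreover obtain m where "\<And>k. \<gamma> k \<le> m" using inf(2) by (auto simp: bdd_above_def)
  ultimately show ?thesis by blast
qed

lemma line_search:
  assumes "LS1 ip f g \<delta> \<theta> \<gamma>bar \<gamma> lam x \<or> LS2 ip f g \<delta> \<theta> lbar \<gamma> lam x \<or>
       LS3 ip f g \<delta> \<theta> lbar \<gamma> lam x y \<or> LS4 ip f g \<delta> \<theta> \<gamma>bar \<gamma> lam x"
  shows "(\<forall>k. decrease k) \<and> (\<exists>\<gamma>max. (\<forall>k. \<gamma> k \<le> \<gamma>max) \<and> valid_parameters \<gamma>max)"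
  using assms
proof (elim disjE)
  assume L: "LS1 ip f g \<delta> \<theta> \<gamma>bar \<gamma> lam x"
  show ?thesis
  proof (rule step_size_backtracking)
    show "is_largest (\<gamma> k) {t \<in> range (\<lambda>i::nat. \<gamma>bar * \<theta> ^ i). descent_test (ip k) f g \<delta> (x k) t (lam k)}" for k
      using L by (simp add: LS1_def)
    show "failure k t (lam k)" if "0 < t" "\<not> descent_test (ip k) f g \<delta> (x k) t (lam k)" for k t
      by (rule fb_problem.failure_if_not_descent_test[OF problem x_mem that(1) lam_pos lam_le_1 that(2)])
  qed (use L in \<open>simp_all add: LS1_def\<close>)
next
  assume L: "LS4 ip f g \<delta> \<theta> \<gamma>bar \<gamma> lam x"
  let ?Q = "\<lambda>k t. ipnorm (ip k) (gradient_wrt (ip k) f (fb_step (ip k) f g (x k) t (lam k)) - gradient_wrt (ip k) f (x k))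
           \<le> \<delta> / (t * lam k) * ipnorm (ip k) (fb_step (ip k) f g (x k) t (lam k) - x k)"
  show ?thesis
  proof (rule step_size_backtracking)
    show "is_largest (\<gamma> k) {t \<in> range (\<lambda>i::nat. \<gamma>bar * \<theta> ^ i). ?Q k t}" for k
      using L by (simp add: LS4_def)
    show "descent_test (ip k) f g \<delta> (x k) (\<gamma> k) (lam k)" if "?Q k (\<gamma> k)" for k
      by (rule fb_problem.descent_test_if_gradient_test[OF at_iterate that])
    show "failure k t (lam k)" if "0 < t" "\<not> ?Q k t" for k t
      by (rule fb_problem.failure_if_not_gradient_test[OF problem x_mem that(1) lam_pos lam_le_1 that(2)])
  qed (use L in \<open>simp_all add: LS4_def\<close>)
next
  assume L: "LS2 ip f g \<delta> \<theta> lbar \<gamma> lam x"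
  show ?thesis
  proof (rule relaxation_backtracking)
    show "is_largest (lam k) {t \<in> range (\<lambda>i::nat. lbar * \<theta> ^ i). descent_test (ip k) f g \<delta> (x k) (\<gamma> k) t}" for k
      using L by (simp add: LS2_def)
    show "failure k (\<gamma> k) s" if "0 < s" "s \<le> 1" "\<not> descent_test (ip k) f g \<delta> (x k) (\<gamma> k) s" for k s
      by (rule fb_problem.failure_if_not_descent_test[OF problem x_mem \<gamma>_pos that])
  qed (use L decrease_if_descent_test in \<open>simp_all add: LS2_def\<close>)
next
  assume L: "LS3 ip f g \<delta> \<theta> lbar \<gamma> lam x y"
  let ?Q = "\<lambda>k t. (f (fb_step (ip k) f g (x k) (\<gamma> k) t) + g (fb_step (ip k) f g (x k) (\<gamma> k) t)) - (f (x k) + g (x k))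
           \<le> ereal ((1 - \<delta>) * t) * (g (y k) - g (x k) + ereal ((y k - x k) \<bullet> gradient f (x k)))"
  show ?thesis
  proof (rule relaxation_backtracking)
    show "is_largest (lam k) {t \<in> range (\<lambda>i::nat. lbar * \<theta> ^ i). ?Q k t}" for k
      using L by (simp add: LS3_def)
    show "decrease k" if "?Q k (lam k)" for k
      using that unfolding y_eq x_Suc_eq_fb_step by (simp only: fb_problem.armijo_iff[OF at_iterate])
    show "failure k (\<gamma> k) s" if s: "0 < s" "s \<le> 1" and "\<not> ?Q k s" for k s
      using that(3) unfolding y_eq fb_problem.armijo_iff[OF problem x_mem \<gamma>_pos s]
      by (rule fb_problem.failure_if_not_armijo[OF problem x_mem \<gamma>_pos s])
  qed (use L in \<open>simp_all add: LS3_def\<close>)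
qed

end

section \<open>Convergence of the variable metric forward-backward iteration\<close>

theorem theorem3p18:
  fixes f g F :: "'a::{real_inner, complete_space} \<Rightarrow> ereal"
    and ip :: "nat \<Rightarrow> 'a \<Rightarrow> 'a \<Rightarrow> real"
    and \<nu> \<mu> \<delta> \<theta> \<gamma>bar lbar :: real
    and \<gamma> lam :: "nat \<Rightarrow> real"
    and x y :: "nat \<Rightarrow> 'a"
    and S :: "'a set"
  assumes f: "proper f" "econvex f" "lsc f"
    and g: "proper g" "econvex g" "lsc g"
    and dom: "edom g \<subseteq> edom f"
    and diff: "gateaux_differentiable_on f (edom g)"
    and unif: "\<And>K. compactin weak_topology K \<Longrightarrow> K \<subseteq> edom g \<Longrightarrow> uniformly_continuous_on K (gradient f)"
    and ip: "\<And>k. is_scalar_product (ip k)"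
    and \<nu>\<mu>: "0 < \<nu>" "\<nu> \<le> \<mu>"
    and bounds: "\<And>k z. \<nu> * (norm z)\<^sup>2 \<le> (ipnorm (ip k) z)\<^sup>2"
                "\<And>k z. (ipnorm (ip k) z)\<^sup>2 \<le> \<mu> * (norm z)\<^sup>2"
    and metrics:
      "(\<exists>\<eta>::nat \<Rightarrow> real. (\<forall>k. 0 \<le> \<eta> k) \<and> summable \<eta> \<and>
          (\<forall>k z. (ipnorm (ip (Suc k)) z)\<^sup>2 \<le> (1 + \<eta> k) * (ipnorm (ip k) z)\<^sup>2))
       \<or> summable (\<lambda>k. upper_bound (ip k) - lower_bound (ip k))"
    and alg: "vm_fbs ip f g \<gamma> lam x y"
    and \<delta>: "0 < \<delta>" "\<delta> < 1" and \<theta>: "0 < \<theta>" "\<theta> < 1"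
    and line_search:
      "LS1 ip f g \<delta> \<theta> \<gamma>bar \<gamma> lam x \<or> LS2 ip f g \<delta> \<theta> lbar \<gamma> lam x \<or>
       LS3 ip f g \<delta> \<theta> lbar \<gamma> lam x y \<or> LS4 ip f g \<delta> \<theta> \<gamma>bar \<gamma> lam x"
  defines "F \<equiv> (\<lambda>z. f z + g z)" and "S \<equiv> minimizers (\<lambda>z. f z + g z)"
  shows "decseq (\<lambda>k. F (x k))
    \<and> ((INF k. F (x k)) > -\<infinity> \<longrightarrow> summable (\<lambda>k. (norm (x (Suc k) - x k))\<^sup>2))
    \<and> (S \<noteq> {} \<longrightarrow>
          (\<exists>p\<in>S. limitin weak_topology x p sequentially \<and> limitin weak_topology y p sequentially)
        \<and> (\<lambda>k. F (y k)) \<longlonglongrightarrow> (INF z. F z)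
        \<and> ((\<Sum>k. ereal (\<gamma> k * lam k)) = \<infinity> \<longrightarrow> (\<lambda>k. F (x k)) \<longlonglongrightarrow> (INF z. F z))
        \<and> ((INF k. \<gamma> k * lam k) > 0 \<longrightarrow>
             (\<lambda>k. real_of_ereal (F (x k) - (INF z. F z))) \<in> o(\<lambda>k. 1 / real k)))
    \<and> (S = {} \<longrightarrow>
          filterlim (\<lambda>k. norm (x k)) at_top sequentially \<and> (\<lambda>k. F (x k)) \<longlonglongrightarrow> (INF z. F z))"
proof -
  have "0 \<le> ip k z z" for k z
    using ip[of k] bilinear_lzero[of "ip k" z] by (cases "z = 0") (auto simp: is_scalar_product_def less_imp_le)
  then have ipnorm: "(ipnorm (ip k) z)\<^sup>2 = ip k z z" for k z by (simp add: ipnorm_def)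
  have metric: "equivalent_scalar_product (ip k) \<nu> \<mu>" for k
    using bounds[unfolded ipnorm] by (intro equivalent_scalar_product.intro ip \<nu>\<mu>(1))
  have problem: "fb_problem (ip k) \<nu> \<mu> f g \<delta>" for k
    using metric f g dom diff \<delta> by (auto intro!: fb_problem.intro fb_problem_axioms.intro)
  interpret run: vm_fbs_run f g ip \<nu> \<mu> \<delta> \<theta> \<gamma> lam x y
    using problem alg \<theta> by (rule vm_fbs_run.intro)
  note search = run.line_search[OF line_search]
  note decrease = search[THEN conjunct1, rule_format]
  obtain \<gamma>max where \<gamma>max: "\<forall>k. \<gamma> k \<le> \<gamma>max" "run.valid_parameters \<gamma>max"
    using search[THEN conjunct2] by (elim exE conjE)
  obtain C :: "nat \<Rightarrow> 'a \<Rightarrow> 'a \<Rightarrow> real" and \<nu>' \<mu>' \<eta> s0 s s1 where C: "quasi_decreasing_metrics C \<nu>' \<mu>' \<eta>"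
    "0 < s0" "\<And>k. s0 \<le> s k" "\<And>k. s k \<le> s1"
    "\<And>k u v e. ip k u u \<le> ip k v v + e \<Longrightarrow> C (Suc k) u u \<le> (1 + \<eta> k) * C k v v + s k * e"
    by (rule quasi_decreasing_metrics_exist[OF metric \<nu>\<mu>(2) metrics[unfolded ipnorm]]) blast
  have g'_def: "run.g' = (\<lambda>z. real_of_ereal (g z))"
    by (rule ext) (rule fb_problem.g'_def[OF problem])
  note point = equivalent_scalar_product.fb_point_variational[OF metric g]
  interpret fb: fb_sequence "edom g" "run.g'" "run.f'" "gradient f" ip \<nu> \<mu> \<delta> \<theta> \<gamma>max
    "\<lambda>k z t. fb_point (ip k) f g z t" x y \<gamma> lam
  proof (intro fb_sequence.intro fb_sequence_axioms.intro)
    show "closed_convex_function (edom g) run.g'"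
      unfolding g'_def by (rule closed_convex_function_edom[OF g])
    show "run.f' z + (w - z) \<bullet> gradient f z \<le> run.f' w" if "z \<in> edom g" "w \<in> edom g" for z w
      by (rule fb_problem.subgradient[OF problem that])
    show "run.g' (fb_point (ip k) f g z t)
        + ip k (w - fb_point (ip k) f g z t) (z - fb_point (ip k) f g z t) / t
        \<le> run.g' w + (w - fb_point (ip k) f g z t) \<bullet> gradient f z" if "0 < t" "w \<in> edom g" for k z t w
      unfolding g'_def by (rule point(2)[OF that])
    show "(\<exists>c>0. \<forall>k. c \<le> lam k) \<and> (\<forall>k. \<gamma> k = \<gamma>max
          \<or> line_search_failure (gradient f) (\<delta> * \<nu>) (x k) (fb_point (ip k) f g (x k) (\<gamma> k / \<theta>)) (\<gamma> k / \<theta>) (lam k))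
        \<or> (\<exists>c>0. \<forall>k. c \<le> \<gamma> k) \<and> (\<exists>l. 0 < l \<and> l \<le> 1 \<and> (\<forall>k. lam k = l \<or> lam k / \<theta> \<le> l
          \<and> line_search_failure (gradient f) (\<delta> * \<nu>) (x k) (y k) (\<gamma> k) (lam k / \<theta>)))"
      using \<gamma>max(2) unfolding run.valid_parameters_def by (simp only: run.y_eq)
  qed (rule metric \<nu>\<mu>(2) unif point(1) run.x0 run.y_eq run.x_Suc run.\<gamma>_pos \<gamma>max(1)[rule_format] run.lam_pos
      run.lam_le_1 \<delta> \<theta> decrease; assumption)+
  interpret fb: fb_quasi_Fejer "edom g" "run.g'" "run.f'" "gradient f" ip \<nu> \<mu> \<delta> \<theta> \<gamma>max
    "\<lambda>k z t. fb_point (ip k) f g z t" x y \<gamma> lam C \<nu>' \<mu>' \<eta> s s0 s1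
    using fb.fb_sequence_axioms C by (intro fb_quasi_Fejer.intro fb_quasi_Fejer_axioms.intro)
  have F: "F z = ereal (fb.F z)" if "z \<in> edom g" for z
    using fb_problem.f_real[OF problem that] fb_problem.g_real[OF problem that]
    by (simp add: F_def fb.F_def)
  have F_inf: "F z = \<infinity>" if "z \<notin> edom g" for z
    using that f(1) by (simp add: F_def proper_not_edom proper_def)
  have S_iff: "p \<in> S \<longleftrightarrow> p \<in> edom g \<and> (\<forall>w\<in>edom g. fb.F p \<le> fb.F w)" for p
  proof -
    have "p \<in> S \<longleftrightarrow> (\<forall>w. F p \<le> F w)"
      by (simp add: S_def minimizers_def is_arg_min_linorder F_def)
    also have "\<dots> \<longleftrightarrow> p \<in> edom g \<and> (\<forall>w\<in>edom g. fb.F p \<le> fb.F w)"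
    proof
      assume min: "\<forall>w. F p \<le> F w"
      have "p \<in> edom g"
      proof (rule ccontr)
        assume "p \<notin> edom g"
        with min[rule_format, of "x 0"] show False by (simp add: F_inf F[OF run.x0])
      qed
      moreover have "fb.F p \<le> fb.F w" if "w \<in> edom g" for w
        using min[rule_format, of w] by (simp add: F that calculation)
      ultimately show "p \<in> edom g \<and> (\<forall>w\<in>edom g. fb.F p \<le> fb.F w)" by blast
    next
      assume p: "p \<in> edom g \<and> (\<forall>w\<in>edom g. fb.F p \<le> fb.F w)"
      show "\<forall>w. F p \<le> F w"
      proof
        fix w show "F p \<le> F w" using p by (cases "w \<in> edom g") (simp_all add: F F_inf)
      qed
    qed
    finally show ?thesis .
  qed
  have dec: "decseq (\<lambda>k. F (x k))"
    using fb.decseq_F by (simp add: decseq_def F[OF run.x_mem])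
  have ii: "summable (\<lambda>k. (norm (x (Suc k) - x k))\<^sup>2)" if "(INF k. F (x k)) > -\<infinity>"
  proof -
    have le: "(INF k. F (x k)) \<le> F (x k)" for k by (rule INF_lower) simp
    \<comment> \<open>Finiteness of \<open>F (x 0)\<close> makes the infimum real, so that it can
      serve as the bound \<open>m\<close>.\<close>
    have "(INF k. F (x k)) \<noteq> \<infinity>" using le[of 0] by (auto simp: F[OF run.x0])
    with that obtain m where "(INF k. F (x k)) = ereal m" by (cases "INF k. F (x k)") auto
    with le have "m \<le> fb.F (x k)" for k by (simp add: F[OF run.x_mem])
    then show ?thesis by (rule fb.summable_steps)
  qed
  have iii: "(\<exists>p\<in>S. limitin weak_topology x p sequentially \<and> limitin weak_topology y p sequentially)
        \<and> (\<lambda>k. F (y k)) \<longlonglongrightarrow> (INF z. F z)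
        \<and> ((\<Sum>k. ereal (\<gamma> k * lam k)) = \<infinity> \<longrightarrow> (\<lambda>k. F (x k)) \<longlonglongrightarrow> (INF z. F z))
        \<and> ((INF k. \<gamma> k * lam k) > 0 \<longrightarrow>
             (\<lambda>k. real_of_ereal (F (x k) - (INF z. F z))) \<in> o(\<lambda>k. 1 / real k))"
    if "S \<noteq> {}"
  proof -
    from that obtain z where "z \<in> S" by blast
    then have z: "z \<in> edom g" "\<And>w. w \<in> edom g \<Longrightarrow> fb.F z \<le> fb.F w" by (auto simp: S_iff)
    have INF: "(INF z. F z) = ereal (fb.F z)"
    proof (rule antisym)
      show "(INF z. F z) \<le> ereal (fb.F z)" unfolding F[OF z(1), symmetric] by (rule INF_lower) simp
      show "ereal (fb.F z) \<le> (INF z. F z)"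
      proof (rule INF_greatest)
        fix w show "ereal (fb.F z) \<le> F w" using z(2) by (cases "w \<in> edom g") (simp_all add: F F_inf)
      qed
    qed
    show ?thesis
    proof (intro conjI impI)
      show "\<exists>p\<in>S. limitin weak_topology x p sequentially \<and> limitin weak_topology y p sequentially"
        using fb.weak_convergence[OF z] by (auto simp: S_iff)
      show "(\<lambda>k. F (y k)) \<longlonglongrightarrow> (INF z. F z)"
        using fb.F_y_tendsto[OF z] by (simp add: INF F[OF fb.y_mem])
    next
      assume sum: "(\<Sum>k. ereal (\<gamma> k * lam k)) = \<infinity>"
      have "\<not> summable (\<lambda>k. \<gamma> k * lam k)"
      proof
        assume "summable (\<lambda>k. \<gamma> k * lam k)"
        then have "(\<lambda>k. ereal (\<gamma> k * lam k)) sums ereal (\<Sum>k. \<gamma> k * lam k)"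
          by (simp add: sums_ereal summable_sums)
        from sums_unique[OF this] sum show False by simp
      qed
      then show "(\<lambda>k. F (x k)) \<longlonglongrightarrow> (INF z. F z)"
        using fb.F_x_tendsto[OF z] by (simp add: INF F[OF run.x_mem])
    next
      assume "(INF k. \<gamma> k * lam k) > 0"
      then obtain c where "0 < c" "\<And>k. c \<le> \<gamma> k * lam k"
        using INF_pos_lower_bound[of "\<lambda>k. \<gamma> k * lam k"] run.\<gamma>_pos run.lam_pos by auto
      from fb.F_x_smallo[OF z this]
      show "(\<lambda>k. real_of_ereal (F (x k) - (INF z. F z))) \<in> o(\<lambda>k. 1 / real k)"
        by (simp add: INF F[OF run.x_mem])
    qed
  qed
  have iv: "filterlim (\<lambda>k. norm (x k)) at_top sequentially \<and> (\<lambda>k. F (x k)) \<longlonglongrightarrow> (INF z. F z)"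
    if "S = {}"
  proof
    have none: "\<not> (\<exists>p\<in>edom g. \<forall>w\<in>edom g. fb.F p \<le> fb.F w)" using that S_iff by blast
    show "filterlim (\<lambda>k. norm (x k)) at_top sequentially" by (rule fb.no_minimizer_norm_at_top[OF none])
    \<comment> \<open>Without minimizers some iterate lies strictly below any given point of the
      domain, so the infimum over the iterates is the global one; monotonicity makes it the
      limit.\<close>
    have "(INF k. F (x k)) = (INF z. F z)"
    proof (rule antisym)
      show "(INF z. F z) \<le> (INF k. F (x k))" by (rule INF_greatest) (rule INF_lower, simp)
      show "(INF k. F (x k)) \<le> (INF z. F z)"
      proof (rule INF_greatest)
        fix w
        show "(INF k. F (x k)) \<le> F w"
        proof (cases "w \<in> edom g")
          case True
          from fb.no_minimizer_F_x_unbounded[OF none True] obtain k where "fb.F (x k) < fb.F w" by blast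
          then have "F (x k) \<le> F w" by (simp add: F[OF run.x_mem] F[OF True])
          then show ?thesis by (rule INF_lower2[rotated]) simp
        qed (simp add: F_inf)
      qed
    qed
    then show "(\<lambda>k. F (x k)) \<longlonglongrightarrow> (INF z. F z)" using LIMSEQ_INF[OF dec] by simp
  qed
  show ?thesis using dec ii iii iv by blast
qed

end
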